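(* Let $H$ be a graph that is not projective-planar, let $\mathbf{A}\in\mathbb{Z}^{m\times n}$ be such that $\mathbf{A}^\top$ is bimodular with $\operatorname{rank}(\mathbf{A}^\top)=n$ and $\mathbf{A}^\top$ represents the cographic matroid of $H$ (that is, $M(\mathbf{A}^\top)=M(H)^*$), and let $\mathbf{b}\in\mathbb{Z}^m$ with $\mathbf{b}\in\operatorname{span}(\mathbf{A})$. Then $\operatorname{conv}(\mathcal{P}(\mathbf{A},\mathbf{b})\cap\mathbb{Z}^n)$ admits an extended formulation of size in $O(n^2)$.
   Context: For $\mathbf{A} \in \mathbb{Z}^{m\times n}$ and $\mathbf{b}\in\mathbb{Z}^m$, $\mathcal{P}(\mathbf{A},\mathbf{b}) := \{\mathbf{x}\in\mathbb{R}^n : \mathbf{A}\mathbf{x}\le \mathbf{b}\}$. The set $\operatorname{span}(\mathbf{A})\subseteq\mathbb{R}^m$ is the (real) column span of $\mathbf{A}$. Here "bimodular" means that every $n\times n$ submatrix (of $\mathbf{A}$, equivalently of $\mathbf{A}^\top$) has determinant of absolute value at most $2$, where $n$ is the rank. The column matroid $M(\mathbf{C})$ of a matrix $\mathbf{C}$ (over $\mathbb{R}$) is the matroid on the set of columns of $\mathbf{C}$ whose rank function is the linear rank of column subsets. $M(H)$ is the graphic (cycle) matroid of the graph $H$ and $M(H)^*$ is its dual, called the cographic matroid of $H$. A graph is projective-planar if it can be embedded in the projective plane. An extended formulation of a polyhedron $\mathcal{E}\subseteq\mathbb{R}^n$ is a description $\mathcal{E}=\{\mathbf{x}\in\mathbb{R}^n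 : \exists\, \mathbf{y}\in\mathbb{R}^k \text{ such that } \mathbf{B}\mathbf{x}+\mathbf{C}\mathbf{y}\le\mathbf{d}\}$ with $\mathbf{B}\in\mathbb{R}^{\ell\times n}$, $\mathbf{C}\in\mathbb{R}^{\ell\times k}$, $\mathbf{d}\in\mathbb{R}^\ell$; its size is $\ell$. *)

theory Defs
  imports
    "HOL-Analysis.Analysis"
    "HOL-Library.Landau_Symbols"
    "Jordan_Normal_Form.DL_Rank"
    "Jordan_Normal_Form.DL_Submatrix"
begin

unbundle no vec_syntax

section \<open>Finite undirected multigraphs\<close>

text \<open>Loops (one end) and parallel edges are allowed.\<close>

record ('v, 'e) multigraph =
  verts :: "'v set"
  edges :: "'e set"
  ends :: "'e \<Rightarrow> 'v set"

definition finite_multigraph :: "('v, 'e) multigraph \<Rightarrow> bool" where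
  "finite_multigraph H \<longleftrightarrow>
     finite (verts H) \<and> finite (edges H) \<and>
     (\<forall>e \<in> edges H. ends H e \<subseteq> verts H \<and> card (ends H e) \<in> {1, 2})"

text \<open>Vertex list \<open>vs\<close> and edge list \<open>es\<close> list the cycle in cyclic order; a loop is
  a cycle of length 1 and two parallel edges form a cycle of length 2.\<close>

definition is_cycle :: "('v, 'e) multigraph \<Rightarrow> 'v list \<Rightarrow> 'e list \<Rightarrow> bool" where
  "is_cycle H vs es \<longleftrightarrow>
     es \<noteq> [] \<and> length vs = length es \<and> distinct vs \<and> distinct es \<and> set es \<subseteq> edges H \<and>
     (\<forall>i < length es. ends H (es ! i) = {vs ! i, vs ! (Suc i mod length es)})"

definition is_forest :: "('v, 'e) multigraph \<Rightarrow> 'e set \<Rightarrow> bool" where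
  "is_forest H F \<longleftrightarrow> F \<subseteq> edges H \<and> \<not> (\<exists>vs es. is_cycle H vs es \<and> set es \<subseteq> F)"

section \<open>Matroids given by their rank function\<close>

text \<open>Only the values of the rank function on subsets of the ground set are meaningful.\<close>

record 'a matroid =
  ground :: "'a set"
  rk :: "'a set \<Rightarrow> nat"

definition matroid_iso :: "'a matroid \<Rightarrow> 'b matroid \<Rightarrow> bool" where
  "matroid_iso M N \<longleftrightarrow>
     (\<exists>f. bij_betw f (ground M) (ground N) \<and> (\<forall>X \<subseteq> ground M. rk N (f ` X) = rk M X))"

text \<open>The truncated subtraction is harmless, since submodularity gives
  \<open>rk M (ground M) \<le> rk M (ground M - X) + card X\<close> for every finite matroid.\<close>

definition dual_matroid :: "'a matroid \<Rightarrow> 'a matroid" where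
  "dual_matroid M =
     \<lparr>ground = ground M, rk = (\<lambda>X. card X + rk M (ground M - X) - rk M (ground M))\<rparr>"

text \<open>The independent sets of the cycle matroid are the forests.\<close>

definition cycle_matroid :: "('v, 'e) multigraph \<Rightarrow> 'e matroid" where
  "cycle_matroid H =
     \<lparr>ground = edges H, rk = (\<lambda>X. Max (card ` {F. F \<subseteq> X \<and> is_forest H F}))\<rparr>"

abbreviation cographic_matroid :: "('v, 'e) multigraph \<Rightarrow> 'e matroid" where
  "cographic_matroid H \<equiv> dual_matroid (cycle_matroid H)"

definition mat_rank :: "real mat \<Rightarrow> nat" where
  "mat_rank C = vec_space.rank (dim_row C) C"

text \<open>Columns are represented by their indices, so that equal columns are parallel elements.\<close>

definition column_matroid :: "real mat \<Rightarrow> nat matroid" where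
  "column_matroid C =
     \<lparr>ground = {..<dim_col C}, rk = (\<lambda>J. mat_rank (submatrix C UNIV J))\<rparr>"

section \<open>Embeddings in the projective plane\<close>

definition antipodal_class :: "real ^ 3 \<Rightarrow> (real ^ 3) set" where
  "antipodal_class x = {x, - x}"

definition projective_plane :: "(real ^ 3) set topology" where
  "projective_plane = topology (\<lambda>U.
     U \<subseteq> antipodal_class ` sphere 0 1 \<and>
     openin (top_of_set (sphere 0 1)) {x \<in> sphere 0 1. antipodal_class x \<in> U})"

lemma openin_projective_plane:
  "openin projective_plane U \<longleftrightarrow>
     U \<subseteq> antipodal_class ` sphere 0 1 \<and>
     openin (top_of_set (sphere 0 1)) {x \<in> sphere 0 1. antipodal_class x \<in> U}"
proof -
  let ?S = "sphere (0 :: real ^ 3) 1"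
  let ?pre = "\<lambda>U. {x \<in> ?S. antipodal_class x \<in> U}"
  let ?P = "\<lambda>U. U \<subseteq> antipodal_class ` ?S \<and> openin (top_of_set ?S) (?pre U)"
  have "istopology ?P"
    unfolding istopology_def
  proof (intro conjI allI impI)
    fix U V assume U: "?P U" and V: "?P V"
    have "?pre (U \<inter> V) = ?pre U \<inter> ?pre V" by blast
    moreover have "openin (top_of_set ?S) (?pre U \<inter> ?pre V)"
      using U V by (intro openin_Int) (rule conjunct2, assumption)+
    ultimately show "openin (top_of_set ?S) (?pre (U \<inter> V))" by (rule ssubst)
    show "U \<inter> V \<subseteq> antipodal_class ` ?S"
      by (rule subset_trans[OF Int_lower1 conjunct1[OF U]])
  next
    fix \<K> assume K: "\<forall>U \<in> \<K>. ?P U"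
    have "?pre (\<Union>\<K>) = (\<Union>U \<in> \<K>. ?pre U)" by blast
    moreover have "openin (top_of_set ?S) (\<Union>U \<in> \<K>. ?pre U)"
      by (rule openin_Union) (use K in \<open>elim imageE, hypsubst, blast\<close>)
    ultimately show "openin (top_of_set ?S) (?pre (\<Union>\<K>))" by (rule ssubst)
    show "\<Union>\<K> \<subseteq> antipodal_class ` ?S"
      by (rule Union_least) (rule conjunct1[OF bspec[OF K]])
  qed
  then show ?thesis
    unfolding projective_plane_def by (rule topology_inverse'[THEN fun_cong])
qed

lemma topspace_projective_plane: "topspace projective_plane = antipodal_class ` sphere 0 1"
proof (rule subset_antisym)
  show "topspace projective_plane \<subseteq> antipodal_class ` sphere 0 1"
    using openin_topspace[of projective_plane] unfolding openin_projective_plane by (rule conjunct1)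
  have "{x \<in> sphere 0 1. antipodal_class x \<in> antipodal_class ` sphere 0 1} = sphere 0 1"
    by blast
  then have "openin projective_plane (antipodal_class ` sphere 0 1)"
    unfolding openin_projective_plane by (metis openin_subtopology_self subset_refl)
  then show "antipodal_class ` sphere 0 1 \<subseteq> topspace projective_plane"
    by (rule openin_subset)
qed

lemma quotient_map_antipodal_class:
  "quotient_map (top_of_set (sphere 0 1)) projective_plane antipodal_class"
  unfolding quotient_map_def topspace_projective_plane openin_projective_plane topspace_euclidean_subtopology
  by (intro conjI refl allI impI) simp

text \<open>Vertices go to distinct points and edges to arcs (closed curves for loops) that meet
  each other and the vertices only in common ends.\<close>

definition embeddable_in :: "('v, 'e) multigraph \<Rightarrow> 'p topology \<Rightarrow> bool" where
  "embeddable_in H X \<longleftrightarrow>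
     (\<exists>\<phi> \<gamma>. inj_on \<phi> (verts H) \<and> \<phi> ` verts H \<subseteq> topspace X \<and>
       (\<forall>e \<in> edges H.
          pathin X (\<gamma> e) \<and>
          {\<gamma> e 0, \<gamma> e 1} = \<phi> ` ends H e \<and>
          inj_on (\<gamma> e) {0<..<1} \<and>
          \<gamma> e ` {0<..<1} \<inter> \<phi> ` verts H = {}) \<and>
       (\<forall>e \<in> edges H. \<forall>e' \<in> edges H. e \<noteq> e' \<longrightarrow>
          \<gamma> e ` {0<..<1} \<inter> \<gamma> e' ` {0<..<1} = {}))"

definition projective_planar :: "('v, 'e) multigraph \<Rightarrow> bool" where
  "projective_planar H \<longleftrightarrow> embeddable_in H projective_plane"

section \<open>Integer matrices and polyhedra\<close>

definition bimodular :: "int mat \<Rightarrow> bool" where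
  "bimodular C \<longleftrightarrow>
     (\<forall>I J. I \<subseteq> {..<dim_row C} \<longrightarrow> J \<subseteq> {..<dim_col C} \<longrightarrow>
        card I = mat_rank (map_mat real_of_int C) \<longrightarrow>
        card J = mat_rank (map_mat real_of_int C) \<longrightarrow>
        \<bar>Determinant.det (submatrix C I J)\<bar> \<le> 2)"

definition column_span :: "real mat \<Rightarrow> real vec set" where
  "column_span C = vec_space.col_space (dim_row C) C"

definition constraint_polyhedron :: "int mat \<Rightarrow> int vec \<Rightarrow> real vec set" where
  "constraint_polyhedron A b =
     {x \<in> carrier_vec (dim_col A). map_mat real_of_int A *\<^sub>v x \<le> map_vec real_of_int b}"

definition integer_points :: "nat \<Rightarrow> real vec set" where
  "integer_points n = {x \<in> carrier_vec n. \<forall>i < n. x $ i \<in> \<int>}"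

text \<open>Type \<open>real vec\<close> is not an instance of \<open>real_vector\<close>; this mirrors \<open>convex\<close>.\<close>

definition convex_vec :: "real vec set \<Rightarrow> bool" where
  "convex_vec S \<longleftrightarrow>
     (\<forall>x \<in> S. \<forall>y \<in> S. \<forall>u \<ge> 0. \<forall>v \<ge> 0. u + v = 1 \<longrightarrow> u \<cdot>\<^sub>v x + v \<cdot>\<^sub>v y \<in> S)"

abbreviation conv :: "real vec set \<Rightarrow> real vec set" where
  "conv S \<equiv> convex_vec hull S"

definition extended_formulation ::
    "nat \<Rightarrow> real vec set \<Rightarrow> nat \<Rightarrow> nat \<Rightarrow> real mat \<Rightarrow> real mat \<Rightarrow> real vec \<Rightarrow> bool" where
  "extended_formulation n E k l B C d \<longleftrightarrow>
     B \<in> carrier_mat l n \<and> C \<in> carrier_mat l k \<and> d \<in> carrier_vec l \<and>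
     E = {x \<in> carrier_vec n. \<exists>y \<in> carrier_vec k. B *\<^sub>v x + C *\<^sub>v y \<le> d}"

definition admits_ext_formulation :: "nat \<Rightarrow> real vec set \<Rightarrow> nat \<Rightarrow> bool" where
  "admits_ext_formulation n E l \<longleftrightarrow> (\<exists>k B C d. extended_formulation n E k l B C d)"

end

theory Submission
  imports Defs
begin

text \<open>Write \<open>b = A x0\<close>. The points of the polyhedron are then \<open>x0 - z\<close> with \<open>A z \<ge> 0\<close>, so the polyhedron is a
cone with apex \<open>x0\<close>. The proof turns this cone into a cone of circulations of a small digraph.

The rows of \<open>A\<close> represent the cographic matroid. Rank conditions on the graph become linear
statements about the rows: the rows of the edges at a vertex are dependent with full support
(\<open>star_dependency\<close>), and every cycle supports a vector of the column space (\<open>cycle_vector\<close>). Pairing the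
two shows that the dependencies at the vertices can be scaled so that they cancel on every edge
(\<open>cancelling_star_dependencies\<close>). Then each edge has an orientation and a positive factor that turn the
column space into circulations (\<open>cographic_orientation\<close>), and the vectors \<open>z\<close> of the cone
become linear images of nonnegative circulations. Vertices left by a single edge are contracted,
which leaves at most \<open>2 n\<close> edges and \<open>n + 1\<close> vertices (\<open>digraph_reduction\<close>).

If \<open>x0\<close> is integral, the cone is generated by integer vectors, so the hull is the translated cone and
the circulations describe it with a linear number of inequalities.

If \<open>x0\<close> is not integral, the bound on the minors makes the rows unimodular on the lattice \<open>L\<close>
generated by the integer vectors and \<open>x0\<close>, and twice \<open>x0\<close> is integral (\<open>det_le_2_solutions\<close>). The vectors \<open>z\<close>
of \<open>L\<close> in the cone correspond exactly to the integer circulations, and \<open>x0 - z\<close> is integral iff the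
circulation has odd weight with respect to a set of odd edges (\<open>label_point_integral_iff\<close>). An odd
circulation contains an odd directed cycle, and adding even circulations keeps it odd. So the hull is
the hull of the odd cycles plus the cone of all circulations. An odd cycle through
\<open>u\<close> is a path in the double cover of the digraph between the two copies of \<open>u\<close>. One unit
of flow, distributed over one copy of the double cover for every start vertex \<open>u\<close>, therefore describes
the hull (\<open>conv_odd_circulations\<close>). There are \<open>n + 1\<close> copies of linear size, hence quadratically many
inequalities.\<close>

section \<open>Circulations and directed cycles\<close>

text \<open>Flow conservation, tested against all potentials instead of at single vertices. In this form,
identifying vertices or projecting a cover is a substitution in \<open>\<phi>\<close>.\<close>

definition balanced :: "'e set \<Rightarrow> ('e \<Rightarrow> 'v) \<Rightarrow> ('e \<Rightarrow> 'v) \<Rightarrow> ('e \<Rightarrow> real) \<Rightarrow> bool" where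
  "balanced E t h f \<longleftrightarrow> (\<forall>\<phi> :: 'v \<Rightarrow> real. (\<Sum>e\<in>E. f e * (\<phi> (h e) - \<phi> (t e))) = 0)"

definition circulation :: "'e set \<Rightarrow> ('e \<Rightarrow> 'v) \<Rightarrow> ('e \<Rightarrow> 'v) \<Rightarrow> ('e \<Rightarrow> real) \<Rightarrow> bool" where
  "circulation E t h f \<longleftrightarrow> (\<forall>e. 0 \<le> f e) \<and> (\<forall>e. e \<notin> E \<longrightarrow> f e = 0) \<and> balanced E t h f"

definition dicycle :: "'e set \<Rightarrow> ('e \<Rightarrow> 'v) \<Rightarrow> ('e \<Rightarrow> 'v) \<Rightarrow> 'e list \<Rightarrow> bool" where
  "dicycle E t h es \<longleftrightarrow> es \<noteq> [] \<and> set es \<subseteq> E \<and> distinct (map t es) \<and>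
     (\<forall>i < length es. h (es ! i) = t (es ! (Suc i mod length es)))"

definition cycle_flow :: "'e list \<Rightarrow> 'e \<Rightarrow> real" where
  "cycle_flow es e = of_bool (e \<in> set es)"

lemma balanced_add:
  assumes "balanced E t h f" "balanced E t h g"
  shows "balanced E t h (\<lambda>e. f e + c * g e)"
proof -
  have "(\<Sum>e\<in>E. (f e + c * g e) * (\<phi> (h e) - \<phi> (t e)))
     = (\<Sum>e\<in>E. f e * (\<phi> (h e) - \<phi> (t e))) + c * (\<Sum>e\<in>E. g e * (\<phi> (h e) - \<phi> (t e)))" for \<phi>
    by (simp add: sum.distrib[symmetric] sum_distrib_left algebra_simps)
  then show ?thesis using assms unfolding balanced_def by simp
qed

lemma balanced_conservation:
  assumes "balanced E t h f" "finite E"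
  shows "(\<Sum>e\<in>{e\<in>E. h e = v}. f e) = (\<Sum>e\<in>{e\<in>E. t e = v}. f e)"
proof -
  have "(\<Sum>e\<in>E. f e * (of_bool (h e = v) - of_bool (t e = v))) = 0"
    using assms(1)[unfolded balanced_def, rule_format, of "\<lambda>w. of_bool (w = v)"] by simp
  then have "(\<Sum>e\<in>E. f e * of_bool (h e = v)) = (\<Sum>e\<in>E. f e * of_bool (t e = v))"
    by (simp add: right_diff_distrib sum_subtractf)
  then show ?thesis
    using assms(2) by (simp add: sum.inter_filter[symmetric] of_bool_def if_distrib cong: if_cong)
qed

lemma sum_cyclic_shift:
  fixes g :: "nat \<Rightarrow> 'a :: comm_monoid_add"
  shows "(\<Sum>i<n. g (Suc i mod n)) = (\<Sum>i<n. g i)"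
proof (cases n)
  case (Suc k)
  have "(\<Sum>i<Suc k. g (Suc i mod Suc k)) = (\<Sum>i<k. g (Suc i)) + g 0"
    by (simp add: lessThan_Suc_atMost[symmetric])
  also have "\<dots> = (\<Sum>i<Suc k. g i)"
    by (subst sum.lessThan_Suc_shift) (simp add: add.commute)
  finally show ?thesis using Suc by simp
qed simp

lemma dicycle_distinct: "dicycle E t h es \<Longrightarrow> distinct es"
  unfolding dicycle_def by (auto simp: distinct_map)

lemma sum_set_nth:
  assumes "distinct es"
  shows "(\<Sum>e\<in>set es. g e) = (\<Sum>i<length es. g (es ! i))"
  using assms by (metis (no_types, lifting) sum.cong sum.reindex_bij_betw bij_betw_nth)

lemma sum_support_dicycle:
  assumes "dicycle E t h es" "finite E" "\<And>e. e \<notin> set es \<Longrightarrow> f e = 0"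
  shows "(\<Sum>e\<in>E. f e * g e) = (\<Sum>i<length es. f (es ! i) * (g (es ! i) :: real))"
proof -
  have "(\<Sum>e\<in>E. f e * g e) = (\<Sum>e\<in>set es. f e * g e)"
    using assms by (intro sum.mono_neutral_right) (auto simp: dicycle_def)
  then show ?thesis using sum_set_nth[OF dicycle_distinct[OF assms(1)], of "\<lambda>e. f e * g e"] by simp
qed

lemma circulation_cycle_flow:
  assumes "dicycle E t h es" "finite E"
  shows "circulation E t h (cycle_flow es)"
proof -
  have "(\<Sum>e\<in>E. cycle_flow es e * (\<phi> (h e) - \<phi> (t e))) = 0" for \<phi> :: "_ \<Rightarrow> real"
  proof -
    have "(\<Sum>e\<in>E. cycle_flow es e * (\<phi> (h e) - \<phi> (t e)))
        = (\<Sum>i<length es. \<phi> (t (es ! (Suc i mod length es))) - \<phi> (t (es ! i)))"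
      using assms by (subst sum_support_dicycle[OF assms]) (auto simp: cycle_flow_def dicycle_def)
    then show ?thesis
      using sum_cyclic_shift[of "\<lambda>i. \<phi> (t (es ! i))" "length es"] by (simp add: sum_subtractf)
  qed
  then show ?thesis using assms by (auto simp: circulation_def balanced_def cycle_flow_def dicycle_def)
qed

text \<open>Every vertex of the cycle is entered and left by one edge of the support.\<close>

lemma balanced_const_on_dicycle:
  assumes "dicycle E t h es" "finite E" "\<And>e. e \<notin> set es \<Longrightarrow> f e = 0" "balanced E t h f"
    and "e \<in> set es" "e' \<in> set es"
  shows "f e = f e'"
proof -
  define n where "n = length es"
  have step: "f (es ! i) = f (es ! (Suc i mod n))" if i: "i < n" for i
  proof -
    define j where "j = Suc i mod n"
    have j: "j < n" using i by (simp add: j_def)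
    have inj: "t (es ! k) = t (es ! k') \<longleftrightarrow> k = k'" if "k < n" "k' < n" for k k'
      using assms(1) that nth_eq_iff_index_eq[of "map t es" k k'] by (simp add: dicycle_def n_def)
    have shift: "Suc k mod n = j \<longleftrightarrow> k = i" if "k < n" for k
      using that i unfolding j_def by (auto simp: mod_Suc split: if_splits)
    have "0 = (\<Sum>e\<in>E. f e * (of_bool (h e = t (es ! j)) - of_bool (t e = t (es ! j))))"
      using assms(4)[unfolded balanced_def, rule_format, of "\<lambda>w. of_bool (w = t (es ! j))"] by simp
    also have "\<dots> = (\<Sum>k<n. f (es ! k) * (of_bool (h (es ! k) = t (es ! j)) - of_bool (t (es ! k) = t (es ! j))))"
      unfolding n_def by (rule sum_support_dicycle[OF assms(1-3)])
    also have "\<dots> = (\<Sum>k<n. f (es ! k) * (of_bool (k = i) - of_bool (k = j)))"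
    proof (rule sum.cong[OF refl])
      fix k assume k: "k \<in> {..<n}"
      then have "h (es ! k) = t (es ! (Suc k mod n))" using assms(1) by (simp add: dicycle_def n_def)
      moreover have "Suc k mod n < n" using k by simp
      ultimately show "f (es ! k) * (of_bool (h (es ! k) = t (es ! j)) - of_bool (t (es ! k) = t (es ! j)))
        = f (es ! k) * (of_bool (k = i) - of_bool (k = j))"
        using inj[of "Suc k mod n" j] inj[of k j] shift[of k] k j by simp
    qed
    also have "\<dots> = f (es ! i) - f (es ! j)"
    proof -
      have "(\<Sum>k<n. f (es ! k) * of_bool (k = l)) = f (es ! l)" if "l < n" for l
        using that by (simp add: of_bool_def if_distrib cong: if_cong)
      then show ?thesis using i j by (simp add: right_diff_distrib sum_subtractf)
    qed
    finally show ?thesis by (simp add: j_def)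
  qed
  have "f (es ! i) = f (es ! 0)" if "i < n" for i
    using that
  proof (induction i)
    case (Suc i)
    then show ?case using step[of i] by simp
  qed simp
  then show ?thesis using assms(5,6) by (metis in_set_conv_nth n_def)
qed

text \<open>Out of a positive edge one can walk forward for ever along positive edges; the first repeated
  tail closes a cycle.\<close>

lemma circulation_support_dicycle:
  assumes f: "circulation E t h f" and fin: "finite E" and e0: "f e0 \<noteq> 0"
  obtains es where "dicycle {e \<in> E. 0 < f e} t h es"
proof -
  define S where "S = {e \<in> E. 0 < f e}"
  have finS: "finite S" using fin by (simp add: S_def)
  have nn: "0 \<le> f e" "e \<notin> E \<Longrightarrow> f e = 0" for e using f by (auto simp: circulation_def)
  have "\<exists>e'\<in>S. t e' = h e" if "e \<in> S" for e
  proof -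
    have "0 < f e" and eE: "e \<in> E" using that by (auto simp: S_def)
    note this(1)
    also have "f e \<le> (\<Sum>e'\<in>{e'\<in>E. h e' = h e}. f e')"
      using fin nn eE by (intro member_le_sum) auto
    finally have "0 < (\<Sum>e'\<in>{e'\<in>E. t e' = h e}. f e')"
      using balanced_conservation[of E t h f "h e"] f fin unfolding circulation_def by metis
    then obtain e' where "e' \<in> E" "t e' = h e" "f e' \<noteq> 0"
      by (metis (mono_tags, lifting) less_irrefl mem_Collect_eq sum.neutral)
    then show ?thesis using nn(1)[of e'] by (intro bexI[of _ e']) (auto simp: S_def)
  qed
  then obtain nxt where nxt: "\<And>e. e \<in> S \<Longrightarrow> nxt e \<in> S \<and> t (nxt e) = h e" by metis
  define w where "w k = (nxt ^^ k) e0" for k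
  have "e0 \<in> S" using e0 nn[of e0] by (force simp: S_def)
  then have wS: "w k \<in> S" for k by (induction k) (auto simp: w_def nxt)
  have wt: "t (w (Suc k)) = h (w k)" for k using nxt[OF wS[of k]] by (simp add: w_def)
  have "\<not> inj_on (\<lambda>k. t (w k)) UNIV"
  proof
    assume "inj_on (\<lambda>k. t (w k)) UNIV"
    moreover have "range (\<lambda>k. t (w k)) \<subseteq> t ` S" using wS by auto
    ultimately show False using finS by (meson finite_imageD finite_imageI infinite_UNIV_nat rev_finite_subset)
  qed
  then obtain i j where "i < j" "t (w i) = t (w j)"
    by (metis (no_types, lifting) inj_onI linorder_neqE_nat)
  then have ex: "\<exists>d i. 0 < d \<and> t (w i) = t (w (i + d))"
    by (intro exI[of _ "j - i"] exI[of _ i]) auto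
  \<comment> \<open>the least distance of two visits to the same vertex, so that the walk between them is simple\<close>
  define d where "d = (LEAST d. \<exists>i. 0 < d \<and> t (w i) = t (w (i + d)))"
  obtain i where i: "0 < d" "t (w i) = t (w (i + d))" using LeastI_ex[OF ex] unfolding d_def by blast
  have min: "d \<le> d'" if "0 < d'" "t (w i) = t (w (i + d'))" for d' i
    unfolding d_def by (rule Least_le) (use that in blast)
  define es where "es = map (\<lambda>k. w (i + k)) [0..<d]"
  have "inj_on (\<lambda>k. t (w (i + k))) {0..<d}"
  proof (rule linorder_inj_onI)
    fix x y assume xy: "x < y" "x \<in> {0..<d}" "y \<in> {0..<d}"
    then show "t (w (i + x)) \<noteq> t (w (i + y))" using min[of "y - x" "i + x"] by auto
  qed auto
  then have "distinct (map t es)" by (simp add: es_def distinct_map inj_on_def)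
  moreover have "h (es ! k) = t (es ! (Suc k mod length es))" if "k < length es" for k
  proof (cases "Suc k = d")
    case True
    then have "i + d = Suc (i + k)" by simp
    then have "h (w (i + k)) = t (w i)" using wt[of "i + k"] i(2) by metis
    then show ?thesis using True that i(1) by (simp add: es_def)
  next
    case False
    then show ?thesis using that wt[of "i + k"] by (simp add: es_def)
  qed
  ultimately have "dicycle S t h es" using i wS by (auto simp: dicycle_def es_def)
  then show thesis using that by (simp add: S_def)
qed

lemma dicycle_mono: "dicycle E t h es \<Longrightarrow> E \<subseteq> E' \<Longrightarrow> dicycle E' t h es"
  by (auto simp: dicycle_def)

lemma circulation_zero: "circulation E t h (\<lambda>e. 0)"
  by (simp add: circulation_def balanced_def)

lemma circulation_add:
  assumes "circulation E t h f" "circulation E t h g" "0 \<le> c"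
  shows "circulation E t h (\<lambda>e. f e + c * g e)"
  using assms balanced_add[of E t h f g c] by (auto simp: circulation_def)

text \<open>Subtracting the largest possible multiple of a cycle in the support empties an edge \<open>e\<close> of the
cycle. Recording \<open>f e = 0\<close> in the step lets one read off \<open>c\<close> as a value of the new circulation, so that
\<open>c\<close> is an integer when the new circulation is integral.\<close>

lemma circulation_induct [consumes 2, case_names zero add]:
  assumes f: "circulation E t h f" and fin: "finite E"
    and zero: "P (\<lambda>e. 0)"
    and add: "\<And>f c es e. circulation E t h f \<Longrightarrow> dicycle E t h es \<Longrightarrow> 0 < c \<Longrightarrow> e \<in> set es \<Longrightarrow> f e = 0
               \<Longrightarrow> P f \<Longrightarrow> P (\<lambda>e. f e + c * cycle_flow es e)"
  shows "P f"
  using f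
proof (induction "card {e \<in> E. 0 < f e}" arbitrary: f rule: less_induct)
  case less
  show ?case
  proof (cases "\<exists>e0. f e0 \<noteq> 0")
    case False
    then have "f = (\<lambda>e. 0)" by auto
    then show ?thesis using zero by simp
  next
    case True
    then obtain es where es: "dicycle {e \<in> E. 0 < f e} t h es"
      using circulation_support_dicycle[OF less.prems fin] by blast
    have dE: "dicycle E t h es" by (rule dicycle_mono[OF es]) auto
    define c where "c = Min (f ` set es)"
    have ne: "set es \<noteq> {}" using es by (simp add: dicycle_def)
    obtain e where e: "e \<in> set es" "f e = c"
      using Min_in[of "f ` set es"] ne unfolding c_def by (metis (no_types, lifting) List.finite_set finite_imageI image_iff image_is_empty)
    have cle: "c \<le> f e'" if "e' \<in> set es" for e' using that by (simp add: c_def)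
    have "0 < c" using e es by (auto simp: dicycle_def)
    define g where "g = (\<lambda>e. f e - c * cycle_flow es e)"
    have g: "circulation E t h g"
    proof -
      have "balanced E t h (\<lambda>e. f e + (- c) * cycle_flow es e)"
        using less.prems circulation_cycle_flow[OF dE fin]
        by (intro balanced_add) (auto simp: circulation_def)
      moreover have "0 \<le> g e'" for e'
        using less.prems cle[of e'] by (auto simp: g_def cycle_flow_def circulation_def)
      moreover have "g e' = 0" if "e' \<notin> E" for e'
        using that less.prems dE by (auto simp: g_def cycle_flow_def circulation_def dicycle_def)
      ultimately show ?thesis by (simp add: circulation_def g_def)
    qed
    have "g e = 0" using e by (simp add: g_def cycle_flow_def)
    have "{e \<in> E. 0 < g e} \<subset> {e \<in> E. 0 < f e}"
    proof (rule psubsetI)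
      show "{e \<in> E. 0 < g e} \<subseteq> {e \<in> E. 0 < f e}"
        using \<open>0 < c\<close> by (auto simp: g_def cycle_flow_def split: if_splits)
      show "{e \<in> E. 0 < g e} \<noteq> {e \<in> E. 0 < f e}"
        using e \<open>g e = 0\<close> es by (force simp: dicycle_def)
    qed
    then have "P g" using less.hyps[OF psubset_card_mono g] fin by simp
    then have "P (\<lambda>e. g e + c * cycle_flow es e)"
      using add[OF g dE \<open>0 < c\<close> e(1) \<open>g e = 0\<close>] by blast
    then show ?thesis by (simp add: g_def)
  qed
qed

section \<open>Shrinking a labelled digraph\<close>

definition label_sum :: "'e set \<Rightarrow> ('e \<Rightarrow> nat \<Rightarrow> real) \<Rightarrow> ('e \<Rightarrow> real) \<Rightarrow> nat \<Rightarrow> real" where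
  "label_sum E l f k = (\<Sum>e\<in>E. f e * l e k)"

text \<open>Gaussian elimination: an equation with a nonzero coefficient at \<open>e0\<close> eliminates the unknown \<open>e0\<close>.\<close>

lemma homogeneous_system_nontrivial:
  fixes a :: "'j \<Rightarrow> 'e \<Rightarrow> real"
  assumes "finite J" "finite E" "card J < card E"
  shows "\<exists>d. (\<exists>e\<in>E. d e \<noteq> 0) \<and> (\<forall>j\<in>J. (\<Sum>e\<in>E. a j e * d e) = 0)"
  using assms
proof (induction J arbitrary: E a rule: finite_induct)
  case empty
  then obtain e where "e \<in> E" by (metis card.empty card_gt_0_iff ex_in_conv)
  then show ?case by (intro exI[of _ "\<lambda>_. 1"]) auto
next
  case (insert k J)
  show ?case
  proof (cases "\<exists>e0\<in>E. a k e0 \<noteq> 0")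
    case False
    then show ?thesis using insert.IH[of E a] insert.prems insert.hyps by auto
  next
    case True
    then obtain e0 where e0: "e0 \<in> E" "a k e0 \<noteq> 0" by blast
    define a' where "a' j e = a j e - a j e0 * a k e / a k e0" for j e
    have "card J < card (E - {e0})" using insert.prems insert.hyps e0 by simp
    then obtain d where d: "\<exists>e\<in>E - {e0}. d e \<noteq> 0" "\<And>j. j \<in> J \<Longrightarrow> (\<Sum>e\<in>E - {e0}. a' j e * d e) = 0"
      using insert.IH[of "E - {e0}" a'] insert.prems by auto
    define s where "s = (\<Sum>e\<in>E - {e0}. a k e * d e)"
    define d' where "d' = d(e0 := - s / a k e0)"
    have split: "(\<Sum>e\<in>E. a j e * d' e) = a j e0 * (- s / a k e0) + (\<Sum>e\<in>E - {e0}. a j e * d e)" for j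
    proof -
      have "(\<Sum>e\<in>E. a j e * d' e) = a j e0 * d' e0 + (\<Sum>e\<in>E - {e0}. a j e * d' e)"
        using e0 insert.prems by (simp add: sum.remove)
      also have "(\<Sum>e\<in>E - {e0}. a j e * d' e) = (\<Sum>e\<in>E - {e0}. a j e * d e)"
        by (rule sum.cong) (auto simp: d'_def)
      finally show ?thesis by (simp add: d'_def)
    qed
    have "(\<Sum>e\<in>E. a j e * d' e) = 0" if "j \<in> insert k J" for j
    proof (cases "j = k")
      case True
      then show ?thesis using split[of k] e0 by (simp add: s_def)
    next
      case False
      then have "0 = (\<Sum>e\<in>E - {e0}. a' j e * d e)" using d that by simp
      also have "\<dots> = (\<Sum>e\<in>E - {e0}. a j e * d e - a j e0 / a k e0 * (a k e * d e))"
        by (rule sum.cong) (auto simp: a'_def algebra_simps)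
      also have "\<dots> = (\<Sum>e\<in>E - {e0}. a j e * d e) - a j e0 / a k e0 * s"
        by (simp add: sum_subtractf sum_distrib_left s_def)
      finally show ?thesis using split[of j] by simp
    qed
    moreover have "\<exists>e\<in>E. d' e \<noteq> 0" using d(1) by (auto simp: d'_def)
    ultimately show ?thesis by blast
  qed
qed

text \<open>Both digraphs produce the same label sums, from real and from integer circulations. That the
circulations agree on the smaller edge set makes them recoverable, so injectivity of
the labels is inherited.\<close>

definition reduces_to where
  "reduces_to E t h l E' t' h' l' \<longleftrightarrow> E' \<subseteq> E \<and>
     (\<forall>f. circulation E t h f \<longrightarrow> (\<exists>f'. circulation E' t' h' f' \<and>
        label_sum E' l' f' = label_sum E l f \<and> ((\<forall>e. f e \<in> \<int>) \<longrightarrow> (\<forall>e. f' e \<in> \<int>)))) \<and>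
     (\<forall>f'. circulation E' t' h' f' \<longrightarrow> (\<exists>f. circulation E t h f \<and>
        label_sum E l f = label_sum E' l' f' \<and> ((\<forall>e. f' e \<in> \<int>) \<longrightarrow> (\<forall>e. f e \<in> \<int>)) \<and>
        (\<forall>e\<in>E'. f e = f' e)))"

definition labels_injective where
  "labels_injective n E t h l \<longleftrightarrow> (\<forall>f f'. circulation E t h f \<longrightarrow> circulation E t h f' \<longrightarrow>
     (\<forall>k<n. label_sum E l f k = label_sum E l f' k) \<longrightarrow> f = f')"

lemma reduces_toD:
  assumes "reduces_to E t h l E' t' h' l'"
  shows "E' \<subseteq> E"
    and "circulation E t h f \<Longrightarrow> \<exists>f'. circulation E' t' h' f' \<and>
        label_sum E' l' f' = label_sum E l f \<and> ((\<forall>e. f e \<in> \<int>) \<longrightarrow> (\<forall>e. f' e \<in> \<int>))"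
    and "circulation E' t' h' f' \<Longrightarrow> \<exists>f. circulation E t h f \<and>
        label_sum E l f = label_sum E' l' f' \<and> ((\<forall>e. f' e \<in> \<int>) \<longrightarrow> (\<forall>e. f e \<in> \<int>)) \<and>
        (\<forall>e\<in>E'. f e = f' e)"
proof -
  note a = assms[unfolded reduces_to_def]
  show "E' \<subseteq> E" by (rule conjunct1[OF a])
  note r = spec[OF conjunct1[OF conjunct2[OF a]], of f] spec[OF conjunct2[OF conjunct2[OF a]], of f']
  show "circulation E t h f \<Longrightarrow> \<exists>f'. circulation E' t' h' f' \<and>
      label_sum E' l' f' = label_sum E l f \<and> ((\<forall>e. f e \<in> \<int>) \<longrightarrow> (\<forall>e. f' e \<in> \<int>))"
    by (rule mp[OF r(1)])
  show "circulation E' t' h' f' \<Longrightarrow> \<exists>f. circulation E t h f \<and>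
      label_sum E l f = label_sum E' l' f' \<and> ((\<forall>e. f' e \<in> \<int>) \<longrightarrow> (\<forall>e. f e \<in> \<int>)) \<and>
      (\<forall>e\<in>E'. f e = f' e)"
    by (rule mp[OF r(2)])
qed

lemma reduces_to_refl: "reduces_to E t h l E t h l"
  unfolding reduces_to_def
proof (intro conjI allI impI)
  show "\<exists>f'. circulation E t h f' \<and> label_sum E l f' = label_sum E l f \<and>
      ((\<forall>e. f e \<in> \<int>) \<longrightarrow> (\<forall>e. f' e \<in> \<int>))" if "circulation E t h f" for f
    using that by (intro exI[of _ f]) simp
  show "\<exists>f. circulation E t h f \<and> label_sum E l f = label_sum E l f' \<and>
      ((\<forall>e. f' e \<in> \<int>) \<longrightarrow> (\<forall>e. f e \<in> \<int>)) \<and> (\<forall>e\<in>E. f e = f' e)" if "circulation E t h f'" for f'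
    using that by (intro exI[of _ f']) simp
qed simp

lemma reduces_to_trans:
  assumes "reduces_to E t h l E' t' h' l'" "reduces_to E' t' h' l' E'' t'' h'' l''"
  shows "reduces_to E t h l E'' t'' h'' l''"
proof -
  have "\<exists>f''. circulation E'' t'' h'' f'' \<and> label_sum E'' l'' f'' = label_sum E l f \<and>
      ((\<forall>e. f e \<in> \<int>) \<longrightarrow> (\<forall>e. f'' e \<in> \<int>))" if f: "circulation E t h f" for f
  proof -
    obtain f' where f': "circulation E' t' h' f'" "label_sum E' l' f' = label_sum E l f"
        "(\<forall>e. f e \<in> \<int>) \<longrightarrow> (\<forall>e. f' e \<in> \<int>)"
      using reduces_toD(2)[OF assms(1) f] by (elim exE conjE)
    from f'(1) obtain f'' where "circulation E'' t'' h'' f''" "label_sum E'' l'' f'' = label_sum E' l' f'"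
        "(\<forall>e. f' e \<in> \<int>) \<longrightarrow> (\<forall>e. f'' e \<in> \<int>)"
      using reduces_toD(2)[OF assms(2) f'(1)] by (elim exE conjE)
    then show ?thesis using f'(2,3) by (intro exI[of _ f''] conjI impI) (simp_all only: simp_thms)
  qed
  moreover have "\<exists>f. circulation E t h f \<and> label_sum E l f = label_sum E'' l'' f'' \<and>
      ((\<forall>e. f'' e \<in> \<int>) \<longrightarrow> (\<forall>e. f e \<in> \<int>)) \<and> (\<forall>e\<in>E''. f e = f'' e)"
    if f'': "circulation E'' t'' h'' f''" for f''
  proof -
    obtain f' where "circulation E' t' h' f'" "label_sum E' l' f' = label_sum E'' l'' f''"
        "(\<forall>e. f'' e \<in> \<int>) \<longrightarrow> (\<forall>e. f' e \<in> \<int>)" "\<forall>e\<in>E''. f' e = f'' e"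
      using reduces_toD(3)[OF assms(2) f''] by (elim exE conjE)
    note f' = this
    from f'(1) obtain f where "circulation E t h f" "label_sum E l f = label_sum E' l' f'"
        "(\<forall>e. f' e \<in> \<int>) \<longrightarrow> (\<forall>e. f e \<in> \<int>)" "\<forall>e\<in>E'. f e = f' e"
      using reduces_toD(3)[OF assms(1) f'(1)] by (elim exE conjE)
    moreover have "E'' \<subseteq> E'" using reduces_toD(1)[OF assms(2)] .
    ultimately show ?thesis using f'(2-4) by (intro exI[of _ f] conjI ballI impI) (simp_all add: subset_iff)
  qed
  moreover have "E'' \<subseteq> E" using reduces_toD(1)[OF assms(1)] reduces_toD(1)[OF assms(2)] by (rule subset_trans[rotated])
  ultimately show ?thesis unfolding reduces_to_def by (intro conjI allI impI)
qed

lemma labels_injective_reduces_to: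
  assumes "reduces_to E t h l E' t' h' l'" "labels_injective n E t h l"
  shows "labels_injective n E' t' h' l'"
  unfolding labels_injective_def
proof (intro allI impI)
  fix f' g' assume f': "circulation E' t' h' f'" and g': "circulation E' t' h' g'"
    and eq: "\<forall>k<n. label_sum E' l' f' k = label_sum E' l' g' k"
  obtain f where f: "circulation E t h f" "label_sum E l f = label_sum E' l' f'" "\<forall>e\<in>E'. f e = f' e"
    using reduces_toD(3)[OF assms(1) f'] by (elim exE conjE)
  obtain g where g: "circulation E t h g" "label_sum E l g = label_sum E' l' g'" "\<forall>e\<in>E'. g e = g' e"
    using reduces_toD(3)[OF assms(1) g'] by (elim exE conjE)
  have "\<forall>k<n. label_sum E l f k = label_sum E l g k" using f(2) g(2) eq by simp
  then have fg: "f = g" using assms(2)[unfolded labels_injective_def, rule_format, OF f(1) g(1)] by simp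
  show "f' = g'"
  proof
    fix e
    show "f' e = g' e"
    proof (cases "e \<in> E'")
      case True
      then show ?thesis using f(3) g(3) fg by metis
    next
      case False
      then show ?thesis using f' g' by (simp add: circulation_def)
    qed
  qed
qed

lemma reduces_to_delete_edge:
  assumes "finite E" "e0 \<in> E" "\<And>f. circulation E t h f \<Longrightarrow> f e0 = 0"
  shows "reduces_to E t h l (E - {e0}) t h l"
proof -
  have *: "circulation (E - {e0}) t h f \<longleftrightarrow> circulation E t h f" if "f e0 = 0" for f
  proof -
    have "(\<Sum>e\<in>E - {e0}. f e * (\<phi> (h e) - \<phi> (t e))) = (\<Sum>e\<in>E. f e * (\<phi> (h e) - \<phi> (t e)))" for \<phi> :: "_ \<Rightarrow> real"
      using assms that by (intro sum.mono_neutral_left) auto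
    then have "balanced (E - {e0}) t h f \<longleftrightarrow> balanced E t h f" unfolding balanced_def by (simp only:)
    then show ?thesis using that by (auto simp: circulation_def)
  qed
  have **: "label_sum (E - {e0}) l f = label_sum E l f" if "f e0 = 0" for f
    unfolding label_sum_def using assms that by (intro ext sum.mono_neutral_left) auto
  show ?thesis
    unfolding reduces_to_def
  proof (intro conjI allI impI)
    fix f assume f: "circulation E t h f"
    show "\<exists>f'. circulation (E - {e0}) t h f' \<and> label_sum (E - {e0}) l f' = label_sum E l f \<and>
        ((\<forall>e. f e \<in> \<int>) \<longrightarrow> (\<forall>e. f' e \<in> \<int>))"
      using f * ** assms(3)[OF f] by (intro exI[of _ f]) simp
  next
    fix f assume f: "circulation (E - {e0}) t h f"
    then have "f e0 = 0" unfolding circulation_def by blast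
    then show "\<exists>f'. circulation E t h f' \<and> label_sum E l f' = label_sum (E - {e0}) l f \<and>
        ((\<forall>e. f e \<in> \<int>) \<longrightarrow> (\<forall>e. f' e \<in> \<int>)) \<and> (\<forall>e\<in>E - {e0}. f' e = f e)"
      using f * ** by (intro exI[of _ f]) simp
  qed blast
qed

lemma reduces_to_move_loop:
  assumes "t e0 = h e0"
  shows "reduces_to E t h l E (t(e0 := g)) (h(e0 := g)) l"
proof -
  have "circulation E (t(e0 := g)) (h(e0 := g)) f \<longleftrightarrow> circulation E t h f" for f
  proof -
    have "(\<Sum>e\<in>E. f e * (\<phi> ((h(e0 := g)) e) - \<phi> ((t(e0 := g)) e))) = (\<Sum>e\<in>E. f e * (\<phi> (h e) - \<phi> (t e)))"
      for \<phi> :: "_ \<Rightarrow> real"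
      using assms by (intro sum.cong) auto
    then show ?thesis unfolding circulation_def balanced_def by (simp only:)
  qed
  note eq = this
  show ?thesis using reduces_to_refl[of E t h l] unfolding reduces_to_def eq .
qed

text \<open>The only edge \<open>e0\<close> leaving \<open>v\<close> carries everything that enters \<open>v\<close>. So it can be
  contracted: its flow is recovered as the inflow of \<open>v\<close>, and its label is passed to the edges
  entering \<open>v\<close>.\<close>

lemma reduces_to_contract:
  assumes fin: "finite E" and e0: "e0 \<in> E" "t e0 = v" "h e0 \<noteq> v"
    and only: "\<And>e. e \<in> E \<Longrightarrow> t e = v \<Longrightarrow> e = e0"
  shows "reduces_to E t h l (E - {e0}) t (\<lambda>e. if h e = v then h e0 else h e)
    (\<lambda>e k. if h e = v then l e k + l e0 k else l e k)"
proof -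
  define E' h' l' where "E' = E - {e0}" and "h' = (\<lambda>e. if h e = v then h e0 else h e)"
    and "l' = (\<lambda>e k. if h e = v then l e k + l e0 k else l e k)"
  define inflow where "inflow f = (\<Sum>e\<in>E'. f e * of_bool (h e = v))" for f :: "_ \<Rightarrow> real"
  have finE': "finite E'" using fin by (simp add: E'_def)
  have out: "{e \<in> E. t e = v} = {e0}" using e0 only by blast
  have inE: "{e \<in> E. h e = v} = {e \<in> E'. h e = v}" using e0 by (auto simp: E'_def)
  have flow: "f e0 = inflow f" if "balanced E t h f" for f
  proof -
    have "inflow f = (\<Sum>e\<in>{e \<in> E'. h e = v}. f e)"
      unfolding inflow_def sum.inter_filter[OF finE'] by (rule sum.cong) simp_all
    then show ?thesis using balanced_conservation[OF that fin, of v] unfolding out inE by simp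
  qed
  have sum: "(\<Sum>e\<in>E. f e * (\<phi> (h e) - \<phi> (t e))) =
      (\<Sum>e\<in>E'. f e * (\<phi> (h' e) - \<phi> (t e)))" if f: "f e0 = inflow f" for f :: "_ \<Rightarrow> real" and \<phi> :: "_ \<Rightarrow> real"
  proof -
    have "(\<Sum>e\<in>E. f e * (\<phi> (h e) - \<phi> (t e))) = f e0 * (\<phi> (h e0) - \<phi> v) + (\<Sum>e\<in>E'. f e * (\<phi> (h e) - \<phi> (t e)))"
      using sum.remove[OF fin e0(1), of "\<lambda>e. f e * (\<phi> (h e) - \<phi> (t e))"] e0(2) by (simp only: E'_def)
    also have "f e0 * (\<phi> (h e0) - \<phi> v) = (\<Sum>e\<in>E'. f e * of_bool (h e = v) * (\<phi> (h e0) - \<phi> v))"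
      unfolding f inflow_def by (simp add: sum_distrib_right)
    also have "\<dots> + (\<Sum>e\<in>E'. f e * (\<phi> (h e) - \<phi> (t e))) = (\<Sum>e\<in>E'. f e * (\<phi> (h' e) - \<phi> (t e)))"
      unfolding sum.distrib[symmetric] by (rule sum.cong) (auto simp: h'_def algebra_simps)
    finally show ?thesis .
  qed
  have lab: "label_sum E' l' f = label_sum E l f" if f: "f e0 = inflow f" for f
  proof
    fix k
    have "label_sum E l f k = f e0 * l e0 k + (\<Sum>e\<in>E'. f e * l e k)"
      using sum.remove[OF fin e0(1), of "\<lambda>e. f e * l e k"] by (simp only: label_sum_def E'_def)
    also have "f e0 * l e0 k = (\<Sum>e\<in>E'. f e * of_bool (h e = v) * l e0 k)"
      unfolding f inflow_def by (simp add: sum_distrib_right)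
    also have "\<dots> + (\<Sum>e\<in>E'. f e * l e k) = (\<Sum>e\<in>E'. f e * l' e k)"
      unfolding sum.distrib[symmetric] by (rule sum.cong) (auto simp: l'_def algebra_simps)
    finally show "label_sum E' l' f k = label_sum E l f k" by (simp add: label_sum_def)
  qed
  have upd: "inflow (f(e0 := x)) = inflow f" "label_sum E' l' (f(e0 := x)) = label_sum E' l' f"
    "(\<Sum>e\<in>E'. (f(e0 := x)) e * (\<phi> (h' e) - \<phi> (t e))) = (\<Sum>e\<in>E'. f e * (\<phi> (h' e) - \<phi> (t e)))"
    for f x and \<phi> :: "_ \<Rightarrow> real"
    unfolding inflow_def label_sum_def by (intro sum.cong ext refl; simp add: E'_def)+
  have "reduces_to E t h l E' t h' l'"
    unfolding reduces_to_def
  proof (intro conjI allI impI)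
    fix f assume f: "circulation E t h f"
    define f' where "f' = f(e0 := 0)"
    have "f e0 = inflow f" using flow f by (auto simp: circulation_def)
    note fe0 = this
    have "circulation E' t h' f'"
      unfolding circulation_def balanced_def
    proof (intro conjI allI impI)
      show "0 \<le> f' e" for e using f by (simp add: f'_def circulation_def)
      show "f' e = 0" if "e \<notin> E'" for e
        using that f by (auto simp: f'_def circulation_def E'_def)
      show "(\<Sum>e\<in>E'. f' e * (\<phi> (h' e) - \<phi> (t e))) = 0" for \<phi> :: "_ \<Rightarrow> real"
        unfolding f'_def upd sum[OF fe0, symmetric]
        using f by (simp add: circulation_def balanced_def)
    qed
    moreover have "label_sum E' l' f' = label_sum E l f"
      using lab[OF fe0] unfolding f'_def upd by simp
    moreover have "\<forall>e. f' e \<in> \<int>" if "\<forall>e. f e \<in> \<int>"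
      using that by (simp add: f'_def)
    ultimately show "\<exists>f'. circulation E' t h' f' \<and> label_sum E' l' f' = label_sum E l f \<and>
        ((\<forall>e. f e \<in> \<int>) \<longrightarrow> (\<forall>e. f' e \<in> \<int>))"
      by blast
  next
    fix f' assume f': "circulation E' t h' f'"
    define f where "f = f'(e0 := inflow f')"
    have fe0: "f e0 = inflow f" unfolding f_def upd by simp
    have "circulation E t h f"
      unfolding circulation_def balanced_def
    proof (intro conjI allI impI)
      have nn: "0 \<le> f' e" for e using f' by (auto simp: circulation_def)
      then show "0 \<le> f e" for e unfolding f_def inflow_def by (simp add: sum_nonneg)
      show "f e = 0" if "e \<notin> E" for e
        using that f' e0(1) unfolding f_def circulation_def E'_def by auto
      show "(\<Sum>e\<in>E. f e * (\<phi> (h e) - \<phi> (t e))) = 0" for \<phi> :: "_ \<Rightarrow> real"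
        unfolding sum[OF fe0] unfolding f_def upd
        using f' by (simp add: circulation_def balanced_def)
    qed
    moreover have "label_sum E l f = label_sum E' l' f'"
      unfolding lab[OF fe0, symmetric] unfolding f_def upd ..
    moreover have "\<forall>e. f e \<in> \<int>" if int: "\<forall>e. f' e \<in> \<int>"
    proof -
      have "inflow f' \<in> \<int>" unfolding inflow_def by (intro Ints_sum Ints_mult) (use int in auto)
      then show ?thesis using int by (simp add: f_def)
    qed
    moreover have "\<forall>e\<in>E'. f e = f' e" unfolding f_def E'_def by simp
    ultimately show "\<exists>f. circulation E t h f \<and> label_sum E l f = label_sum E' l' f' \<and>
        ((\<forall>e. f' e \<in> \<int>) \<longrightarrow> (\<forall>e. f e \<in> \<int>)) \<and> (\<forall>e\<in>E'. f e = f' e)"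
      by (intro exI[of _ f]) simp
  next
    show "E' \<subseteq> E" unfolding E'_def by blast
  qed
  then show ?thesis unfolding E'_def h'_def l'_def .
qed

lemma circulation_sum:
  assumes "finite I" "\<And>i. i \<in> I \<Longrightarrow> circulation E t h (F i)"
  shows "circulation E t h (\<lambda>e. \<Sum>i\<in>I. F i e)"
  using assms
proof (induction I rule: finite_induct)
  case empty
  then show ?case using circulation_zero by simp
next
  case (insert i I)
  then have "circulation E t h (\<lambda>e. F i e + 1 * (\<Sum>i\<in>I. F i e))"
    by (intro circulation_add) auto
  then show ?case using insert.hyps by simp
qed

text \<open>The conservation equations sum to zero, so the one at \<open>g\<close> follows from the others.\<close>

lemma balanced_if_conserved_except:
  fixes t h :: "'e \<Rightarrow> 'v"
  assumes fin: "finite E"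
    and cons: "\<And>v. v \<in> (t ` E \<union> h ` E) - {g} \<Longrightarrow> (\<Sum>e\<in>E. (of_bool (h e = v) - of_bool (t e = v)) * d e) = 0"
  shows "balanced E t h d"
  unfolding balanced_def
  proof
  define V where "V = (t ` E \<union> h ` E) - {g}"
  have finV: "finite V" using fin by (simp add: V_def)
  have dV: "(\<Sum>e\<in>E. (of_bool (h e = v) - of_bool (t e = v)) * d e) = 0" if "v \<in> V" for v
    using cons that unfolding V_def .
  fix \<phi> :: "'v \<Rightarrow> real"
  have \<phi>: "\<phi> w - \<phi> g = (\<Sum>v\<in>V. (\<phi> v - \<phi> g) * of_bool (w = v))" if "w \<in> t ` E \<union> h ` E" for w
  proof (cases "w = g")
    case True
    have "(\<Sum>v\<in>V. (\<phi> v - \<phi> g) * of_bool (w = v)) = 0"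
      using True by (intro sum.neutral) (auto simp: V_def)
    then show ?thesis using True by simp
  next
    case False
    then have "w \<in> V" using that by (simp add: V_def)
    then have "(\<Sum>v\<in>V. (\<phi> v - \<phi> g) * of_bool (w = v)) = (\<Sum>v\<in>{w}. (\<phi> v - \<phi> g) * of_bool (w = v))"
      using finV by (intro sum.mono_neutral_right) auto
    then show ?thesis by simp
  qed
  have "(\<Sum>e\<in>E. d e * (\<phi> (h e) - \<phi> (t e)))
      = (\<Sum>e\<in>E. \<Sum>v\<in>V. (\<phi> v - \<phi> g) * ((of_bool (h e = v) - of_bool (t e = v)) * d e))"
  proof (rule sum.cong[OF refl])
    fix e assume "e \<in> E"
    then have "\<phi> (h e) - \<phi> (t e) = (\<Sum>v\<in>V. (\<phi> v - \<phi> g) * of_bool (h e = v)) - (\<Sum>v\<in>V. (\<phi> v - \<phi> g) * of_bool (t e = v))"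
      using \<phi>[of "h e"] \<phi>[of "t e"] by simp
    then show "d e * (\<phi> (h e) - \<phi> (t e)) = (\<Sum>v\<in>V. (\<phi> v - \<phi> g) * ((of_bool (h e = v) - of_bool (t e = v)) * d e))"
      by (simp add: sum_subtractf[symmetric] sum_distrib_left algebra_simps)
  qed
  also have "\<dots> = (\<Sum>v\<in>V. (\<phi> v - \<phi> g) * (\<Sum>e\<in>E. (of_bool (h e = v) - of_bool (t e = v)) * d e))"
    unfolding sum_distrib_left by (rule sum.swap)
  also have "\<dots> = 0" using dV by simp
  finally show "(\<Sum>e\<in>E. d e * (\<phi> (h e) - \<phi> (t e))) = 0" .
  qed

text \<open>A nonzero balanced vector with zero label could be added, after scaling, to a positive circulation
without changing its label. So there are at most as many edges as there are label coordinates plus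
conservation equations, where the equation at \<open>g\<close> is implied by the others.\<close>

lemma card_edges_le:
  fixes t h :: "'e \<Rightarrow> 'v"
  assumes fin: "finite E" and inj: "labels_injective n E t h l"
    and supp: "\<And>e. e \<in> E \<Longrightarrow> \<exists>f. circulation E t h f \<and> f e \<noteq> 0"
  shows "card E \<le> card ((t ` E \<union> h ` E) - {g}) + n"
proof (rule ccontr)
  assume less: "\<not> ?thesis"
  define V where "V = (t ` E \<union> h ` E) - {g}"
  have finV: "finite V" using fin by (simp add: V_def)
  define a where "a j e = (case j of Inl v \<Rightarrow> of_bool (h e = v) - of_bool (t e = v) | Inr k \<Rightarrow> l e k)" for j e
  have "card (Inl ` V \<union> Inr ` {..<n} :: ('v + nat) set) = card V + n"
    using finV by (subst card_Un_disjoint) (auto simp: card_image)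
  then have "card (Inl ` V \<union> Inr ` {..<n} :: ('v + nat) set) < card E" using less by (simp add: V_def)
  from homogeneous_system_nontrivial[OF _ fin this, of a] obtain d where d: "\<exists>e\<in>E. d e \<noteq> 0"
      "\<forall>j\<in>Inl ` V \<union> Inr ` {..<n}. (\<Sum>e\<in>E. a j e * d e) = 0"
    using finV by auto
  have dV: "(\<Sum>e\<in>E. (of_bool (h e = v) - of_bool (t e = v)) * d e) = 0" if "v \<in> V" for v
    using bspec[OF d(2), of "Inl v"] that by (simp add: a_def)
  have dl: "(\<Sum>e\<in>E. l e k * d e) = 0" if "k < n" for k
    using bspec[OF d(2), of "Inr k"] that by (simp add: a_def)
  have bal: "balanced E t h d"
    using dV by (intro balanced_if_conserved_except[OF fin, of t h g]) (simp add: V_def)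
  define d' where "d' e = (if e \<in> E then d e else 0)" for e
  have bal': "balanced E t h d'"
    using bal unfolding balanced_def d'_def by simp
  have "\<forall>e\<in>E. \<exists>f. circulation E t h f \<and> f e \<noteq> 0" by (intro ballI supp)
  from bchoice[OF this] obtain f where f0: "\<forall>e\<in>E. circulation E t h (f e) \<and> f e e \<noteq> 0" ..
  then have f: "\<And>e. e \<in> E \<Longrightarrow> circulation E t h (f e)" "\<And>e. e \<in> E \<Longrightarrow> f e e \<noteq> 0"
    by simp_all
  define F where "F x = (\<Sum>e\<in>E. f e x)" for x
  have F: "circulation E t h F"
    unfolding F_def using circulation_sum[OF fin f(1)] by simp
  have Fpos: "0 < F e" if "e \<in> E" for e
  proof -
    have "0 < f e e" using f[OF that] by (simp add: circulation_def less_le)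
    also have "f e e \<le> F e" unfolding F_def
      using f(1) that fin by (intro member_le_sum) (auto simp: circulation_def)
    finally show ?thesis .
  qed
  \<comment> \<open>small enough to keep the sum with the positive circulation nonnegative\<close>
  define c where "c = Min ((\<lambda>e. F e / (\<bar>d e\<bar> + 1)) ` E)"
  have "E \<noteq> {}" using d(1) by auto
  have quot_pos: "0 < F e / (\<bar>d e\<bar> + 1)" if "e \<in> E" for e
    using Fpos[OF that] by (intro divide_pos_pos) auto
  have c: "0 < c" unfolding c_def using fin \<open>E \<noteq> {}\<close> quot_pos by (subst Min_gr_iff) auto
  have cle: "c * \<bar>d e\<bar> \<le> F e" if "e \<in> E" for e
  proof -
    have "c \<le> F e / (\<bar>d e\<bar> + 1)" unfolding c_def using fin that by simp
    then have "c * (\<bar>d e\<bar> + 1) \<le> F e" by (simp add: pos_le_divide_eq)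
    then show ?thesis using c by (simp add: algebra_simps)
  qed
  have "circulation E t h (\<lambda>e. F e + c * d' e)"
    unfolding circulation_def
  proof (intro conjI allI impI)
    show "0 \<le> F e + c * d' e" for e
    proof (cases "e \<in> E")
      case True
      have "c * - \<bar>d e\<bar> \<le> c * d e" using c by (intro mult_left_mono) auto
      then show ?thesis using True cle[OF True] by (simp add: d'_def)
    next
      case False
      then show ?thesis using F by (simp add: d'_def circulation_def)
    qed
    show "F e + c * d' e = 0" if "e \<notin> E" for e using that F by (simp add: d'_def circulation_def)
    show "balanced E t h (\<lambda>e. F e + c * d' e)"
      using F bal' by (intro balanced_add) (simp_all add: circulation_def)
  qed
  moreover have "label_sum E l (\<lambda>e. F e + c * d' e) k = label_sum E l F k" if "k < n" for k
  proof -
    have "(\<Sum>e\<in>E. d' e * l e k) = 0" using dl[OF that] by (simp add: d'_def mult.commute)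
    moreover have "label_sum E l (\<lambda>e. F e + c * d' e) k = label_sum E l F k + c * (\<Sum>e\<in>E. d' e * l e k)"
      unfolding label_sum_def sum_distrib_left sum.distrib[symmetric] by (simp add: algebra_simps)
    ultimately show ?thesis by simp
  qed
  ultimately have "(\<lambda>e. F e + c * d' e) = F"
    using inj[unfolded labels_injective_def, rule_format, of "\<lambda>e. F e + c * d' e" F] F by simp
  then have "F e + c * d' e = F e" for e by (rule fun_cong)
  then have "d' e = 0" for e using c by simp
  moreover from d(1) obtain e where "e \<in> E" "d e \<noteq> 0" by blast
  ultimately show False by (metis d'_def)
qed

text \<open>If nothing can enter or nothing can leave \<open>w\<close>, conservation at \<open>w\<close> makes both sums of nonnegative flows
vanish.\<close>

lemma circulation_no_in_or_out_edges:
  assumes f: "circulation E t h f" and fin: "finite E"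
    and "{x \<in> E. t x = w} = {} \<or> {x \<in> E. h x = w} = {}" and e: "e \<in> E" "t e = w \<or> h e = w"
  shows "f e = 0"
proof -
  have nn: "0 \<le> f x" for x using f by (simp add: circulation_def)
  have cons: "sum f {x \<in> E. h x = w} = sum f {x \<in> E. t x = w}"
    using f fin by (intro balanced_conservation) (simp_all add: circulation_def)
  have zero: "sum f {x \<in> E. h x = w} = 0"
    using assms(3)
  proof
    assume "{x \<in> E. t x = w} = {}"
    then show ?thesis unfolding cons by (simp only: sum.empty)
  next
    assume "{x \<in> E. h x = w} = {}"
    then show ?thesis by (simp only: sum.empty)
  qed
  from e(2) show ?thesis
  proof
    assume "t e = w"
    then show ?thesis using sum_nonneg_0[of "{x \<in> E. t x = w}" f e] fin nn e(1) zero cons by simp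
  next
    assume "h e = w"
    then show ?thesis using sum_nonneg_0[of "{x \<in> E. h x = w}" f e] fin nn e(1) zero by simp
  qed
qed

lemma card_edges_ge_outdegree:
  assumes "finite E" "finite V" "\<And>v. v \<in> V \<Longrightarrow> k \<le> card {e \<in> E. t e = v}"
  shows "k * card V \<le> card E"
proof -
  have "k * card V = (\<Sum>v\<in>V. k)" by simp
  also have "\<dots> \<le> (\<Sum>v\<in>V. card {e \<in> E. t e = v})" using assms by (intro sum_mono) auto
  also have "\<dots> = card (\<Union>v\<in>V. {e \<in> E. t e = v})"
    using assms by (subst card_UN_disjoint) auto
  also have "\<dots> \<le> card E" using assms by (intro card_mono) auto
  finally show ?thesis .
qed

text \<open>As long as an edge carries no circulation, or a vertex other than a fixed vertex \<open>g\<close> is left by at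
most one edge, the digraph can be made smaller; a loop at such a vertex moves to \<open>g\<close>. Afterwards twice
the number of vertices other than \<open>g\<close> is at most the number of edges, which with
\<open>card_edges_le\<close> bounds both. The predicate \<open>G\<close> carries a lattice that contains the labels.\<close>

lemma digraph_reduction:
  fixes t h :: "'e \<Rightarrow> 'v"
  assumes "finite E" "labels_injective n E t h l" "\<And>e. e \<in> E \<Longrightarrow> G (l e)"
    and G: "\<And>x y. G x \<Longrightarrow> G y \<Longrightarrow> G (\<lambda>k. x k + y k)"
  shows "\<exists>E' t' h' l'. reduces_to E t h l E' (t' :: 'e \<Rightarrow> 'v) h' l' \<and> card E' \<le> 2 * n \<and>
    card (t' ` E' \<union> h' ` E') \<le> n + 1 \<and> (\<forall>e\<in>E'. G (l' e))"
  using assms(1-3)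
proof (induction "card E + card ((t ` E \<union> h ` E) - {undefined})" arbitrary: E t h l rule: less_induct)
  case less
  define g :: 'v where "g = undefined"
  define V where "V = (t ` E \<union> h ` E) - {g}"
  have finV: "finite V" using less.prems by (simp add: V_def)
  \<comment> \<open>it suffices to find a smaller digraph, by induction\<close>
  have recurse: ?case
    if red: "reduces_to E t h l E' t' h' l'" and G': "\<And>e. e \<in> E' \<Longrightarrow> G (l' e)"
      and small: "card E' + card ((t' ` E' \<union> h' ` E') - {g}) < card E + card V" for E' t' h' l'
  proof -
    have "finite E'" using reduces_toD(1)[OF red] less.prems(1) by (rule finite_subset)
    then obtain E'' t'' h'' l'' where "reduces_to E' t' h' l' E'' (t'' :: 'e \<Rightarrow> 'v) h'' l''" "card E'' \<le> 2 * n"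
        "card (t'' ` E'' \<union> h'' ` E'') \<le> n + 1" "\<forall>e\<in>E''. G (l'' e)"
      using less.hyps[of E' t' h' l'] small labels_injective_reduces_to[OF red less.prems(2)] G'
      unfolding V_def g_def by blast
    then show ?thesis using reduces_to_trans[OF red] by blast
  qed
  define used where "used e \<longleftrightarrow> (\<exists>f. circulation E t h f \<and> f e \<noteq> 0)" for e
  consider (unused) e0 where "e0 \<in> E" "\<not> used e0"
    | (few) v where "v \<in> V" "\<not> 2 \<le> card {e \<in> E. t e = v}" "\<forall>e\<in>E. used e"
    | (dense) "\<forall>v\<in>V. 2 \<le> card {e \<in> E. t e = v}" "\<forall>e\<in>E. used e"
    by blast
  then show ?case
  proof cases
    case unused
    then have zero: "f e0 = 0" if "circulation E t h f" for f using that unfolding used_def by blast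
    have "(t ` (E - {e0}) \<union> h ` (E - {e0})) - {g} \<subseteq> V" by (auto simp: V_def)
    then have "card ((t ` (E - {e0}) \<union> h ` (E - {e0})) - {g}) \<le> card V" using finV by (rule card_mono[rotated])
    moreover have "card (E - {e0}) < card E" using unused(1) less.prems(1) by (rule card_Diff1_less[rotated])
    moreover have "reduces_to E t h l (E - {e0}) t h l"
      by (rule reduces_to_delete_edge[OF less.prems(1) unused(1)]) (rule zero)
    ultimately show ?thesis
      using less.prems(3) by (intro recurse[of "E - {e0}" t h l]) (simp_all add: add_less_le_mono)
  next
    case few
    have inout: "(\<exists>e\<in>E. t e = w) \<and> (\<exists>e\<in>E. h e = w)" if e: "e \<in> E" "t e = w \<or> h e = w" for e w
    proof -
      obtain f where f: "circulation E t h f" "f e \<noteq> 0"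
        using bspec[OF few(3) e(1)] unfolding used_def by (elim exE conjE)
      show ?thesis
      proof (rule ccontr)
        assume "\<not> ?thesis"
        then have "{x \<in> E. t x = w} = {} \<or> {x \<in> E. h x = w} = {}" by blast
        then have "f e = 0"
          using circulation_no_in_or_out_edges[OF f(1) less.prems(1) _ e] by blast
        then show False using f(2) by contradiction
      qed
    qed
    obtain e' where "e' \<in> E" "t e' = v \<or> h e' = v" using few(1) by (auto simp: V_def)
    from conjunct1[OF inout[OF this]] obtain e0 where e0: "e0 \<in> E" "t e0 = v" ..
    have "v \<noteq> g" using few(1) by (simp add: V_def)
    have out: "{e \<in> E. t e = v} = {e0}"
    proof -
      have "finite {e \<in> E. t e = v}" "{e0} \<subseteq> {e \<in> E. t e = v}" using e0 less.prems(1) by simp_all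
      moreover have "card {e \<in> E. t e = v} \<le> card {e0}" using few(2) by simp
      ultimately show ?thesis by (rule card_seteq[symmetric])
    qed
    have only: "e = e0" if "e \<in> E" "t e = v" for e using out that by blast
    show ?thesis
    proof (cases "h e0 = v")
      case True
      have only_in: "e = e0" if e: "e \<in> E" "h e = v" for e
      proof (rule ccontr)
        assume ne: "e \<noteq> e0"
        obtain f where f: "circulation E t h f" "f e \<noteq> 0" 
          using bspec[OF few(3) e(1)] unfolding used_def by (elim exE conjE)
        have "(\<Sum>e\<in>{e\<in>E. h e = v}. f e) = (\<Sum>e\<in>{e\<in>E. t e = v}. f e)"
          using f(1) less.prems(1) by (intro balanced_conservation) (simp_all add: circulation_def)
        also have "\<dots> = f e0" unfolding out by simp
        finally have "f e0 = (\<Sum>e\<in>{e\<in>E. h e = v}. f e)" ..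
        also have "\<dots> \<ge> (\<Sum>e\<in>{e0, e}. f e)"
        proof (rule sum_mono2)
          show "finite {e \<in> E. h e = v}" using less.prems(1) by simp
          show "{e0, e} \<subseteq> {e \<in> E. h e = v}" using e e0(1) True by simp
          show "0 \<le> f b" for b using f(1) by (simp add: circulation_def)
        qed
        also have "(\<Sum>e\<in>{e0, e}. f e) = f e0 + f e" using ne by (subst sum.insert) auto
        finally have "f e \<le> 0" by linarith
        moreover have "0 \<le> f e" using f(1) by (simp add: circulation_def)
        ultimately show False using f(2) by simp
      qed
      define t' h' where "t' = t(e0 := g)" and "h' = h(e0 := g)"
      have "(t' ` E \<union> h' ` E) - {g} \<subseteq> V - {v}"
      proof
        fix w assume "w \<in> (t' ` E \<union> h' ` E) - {g}"
        then obtain e where e: "e \<in> E" "w = t' e \<or> w = h' e" "w \<noteq> g" by blast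
        then have "e \<noteq> e0" by (auto simp: t'_def h'_def)
        then have "t e \<noteq> v" "h e \<noteq> v" using only[OF e(1)] only_in[OF e(1)] by blast+
        moreover have "w = t e \<or> w = h e" using e(2) \<open>e \<noteq> e0\<close> by (simp add: t'_def h'_def)
        ultimately show "w \<in> V - {v}" using e(1,3) unfolding V_def by blast
      qed
      then have "card ((t' ` E \<union> h' ` E) - {g}) \<le> card (V - {v})" using finV by (intro card_mono) auto
      also have "\<dots> < card V" using finV few(1) by (rule card_Diff1_less)
      finally show ?thesis
        using reduces_to_move_loop[of t e0 h E l g] True e0(2) less.prems(3)
        by (intro recurse[of E t' h' l]) (simp_all add: t'_def h'_def)
    next
      case False
      define E' h' l' where "E' = E - {e0}" and "h' = (\<lambda>e. if h e = v then h e0 else h e)"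
        and "l' = (\<lambda>e k. if h e = v then l e k + l e0 k else l e k)"
      have "(t ` E' \<union> h' ` E') - {g} \<subseteq> V"
        using e0 by (auto simp: V_def E'_def h'_def)
      then have "card ((t ` E' \<union> h' ` E') - {g}) \<le> card V" using finV by (rule card_mono[rotated])
      moreover have "card E' < card E" using e0(1) less.prems(1) unfolding E'_def by (rule card_Diff1_less[rotated])
      moreover have "G (l' e)" if "e \<in> E'" for e
      proof (cases "h e = v")
        case True
        then show ?thesis using that G[of "l e" "l e0"] less.prems(3) e0(1) by (simp add: l'_def E'_def)
      next
        case False
        then show ?thesis using that less.prems(3) by (simp add: l'_def E'_def)
      qed
      moreover have "reduces_to E t h l E' t h' l'"
        unfolding E'_def h'_def l'_def
        by (rule reduces_to_contract[of E e0 t v h l, OF less.prems(1) e0 False]) (rule only)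
      ultimately show ?thesis by (intro recurse[of E' t h' l']) (simp_all add: add_less_le_mono)
    qed
  next
    case dense
    have "2 * card V \<le> card E"
      by (rule card_edges_ge_outdegree[OF less.prems(1) finV]) (rule bspec[OF dense(1)])
    moreover have "card E \<le> card V + n"
      unfolding V_def using dense(2) by (intro card_edges_le[OF less.prems(1,2)]) (simp add: used_def)
    moreover have "card (t ` E \<union> h ` E) \<le> card V + 1"
    proof -
      have "card (t ` E \<union> h ` E) \<le> card (insert g V)"
        using finV by (intro card_mono) (auto simp: V_def)
      also have "\<dots> \<le> card V + 1" using finV by (simp add: card_insert_if)
      finally show ?thesis .
    qed
    ultimately show ?thesis
      using less.prems(3) by (intro exI[of _ E] exI[of _ t] exI[of _ h] exI[of _ l] conjI reduces_to_refl) auto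
  qed
qed

section \<open>Extended formulations from circulations\<close>

lemma admits_ext_formulation_constraints:
  fixes cs :: "((nat \<Rightarrow> real) \<times> ('e \<Rightarrow> real) \<times> real) list"
  assumes fin: "finite E"
    and S: "S = {x \<in> carrier_vec n. \<exists>y :: 'e \<Rightarrow> real. \<forall>p\<in>set cs.
              (\<Sum>j<n. fst p j * x $ j) + (\<Sum>e\<in>E. fst (snd p) e * y e) \<le> snd (snd p)}"
  shows "admits_ext_formulation n S (length cs)"
proof -
  define l k where "l = length cs" and "k = card E"
  obtain g where g: "bij_betw g {..<k} E"
    using ex_bij_betw_nat_finite[OF fin] by (auto simp: k_def atLeast0LessThan)
  define g' where "g' = inv_into {..<k} g"
  have g': "g' (g j) = j" if "j < k" for j
    using g that by (simp add: g'_def bij_betw_inv_into_left)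
  define B where "B = mat l n (\<lambda>(i, j). fst (cs ! i) j)"
  define C where "C = mat l k (\<lambda>(i, j). fst (snd (cs ! i)) (g j))"
  define d where "d = vec l (\<lambda>i. snd (snd (cs ! i)))"
  have dims: "B \<in> carrier_mat l n" "C \<in> carrier_mat l k" "d \<in> carrier_vec l"
    by (simp_all add: B_def C_def d_def)
  have idx: "(B *\<^sub>v x + C *\<^sub>v z) $ i = (\<Sum>j<n. fst (cs ! i) j * x $ j) + (\<Sum>j<k. fst (snd (cs ! i)) (g j) * z $ j)"
    if "x \<in> carrier_vec n" "z \<in> carrier_vec k" "i < l" for x z i
    using that by (simp add: B_def C_def scalar_prod_def atLeast0LessThan)
  have reindex: "(\<Sum>j<k. c (g j) * y (g j)) = (\<Sum>e\<in>E. c e * y e)" for c y :: "'e \<Rightarrow> real"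
    using sum.reindex_bij_betw[OF g, of "\<lambda>e. c e * y e"] .
  have le: "B *\<^sub>v x + C *\<^sub>v z \<le> d \<longleftrightarrow>
      (\<forall>i<l. (\<Sum>j<n. fst (cs ! i) j * x $ j) + (\<Sum>j<k. fst (snd (cs ! i)) (g j) * z $ j) \<le> snd (snd (cs ! i)))"
    if "x \<in> carrier_vec n" "z \<in> carrier_vec k" for x z
    using idx[OF that] dims by (simp add: less_eq_vec_def d_def)
  have mem: "(\<exists>z\<in>carrier_vec k. B *\<^sub>v x + C *\<^sub>v z \<le> d) \<longleftrightarrow>
      (\<exists>y :: 'e \<Rightarrow> real. \<forall>p\<in>set cs. (\<Sum>j<n. fst p j * x $ j) + (\<Sum>e\<in>E. fst (snd p) e * y e) \<le> snd (snd p))"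
    (is "?L \<longleftrightarrow> ?R") if x: "x \<in> carrier_vec n" for x
  proof
    assume ?L
    then obtain z where z: "z \<in> carrier_vec k" "B *\<^sub>v x + C *\<^sub>v z \<le> d" by blast
    define y where "y e = z $ g' e" for e
    have "(\<Sum>j<k. c (g j) * z $ j) = (\<Sum>e\<in>E. c e * y e)" for c
      unfolding reindex[symmetric] by (rule sum.cong) (simp_all add: y_def g')
    then have "\<forall>i<l. (\<Sum>j<n. fst (cs ! i) j * x $ j) + (\<Sum>e\<in>E. fst (snd (cs ! i)) e * y e) \<le> snd (snd (cs ! i))"
      using z(2) unfolding le[OF x z(1)] by simp
    then have "\<forall>p\<in>set cs. (\<Sum>j<n. fst p j * x $ j) + (\<Sum>e\<in>E. fst (snd p) e * y e) \<le> snd (snd p)"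
      unfolding all_set_conv_all_nth l_def .
    then show ?R by (rule exI[of _ y])
  next
    assume ?R
    then obtain y where y: "\<forall>p\<in>set cs. (\<Sum>j<n. fst p j * x $ j) + (\<Sum>e\<in>E. fst (snd p) e * y e) \<le> snd (snd p)"
      by (rule exE)
    define z where "z = vec k (\<lambda>j. y (g j))"
    have z: "z \<in> carrier_vec k" by (simp add: z_def)
    have "(\<Sum>j<k. c (g j) * z $ j) = (\<Sum>e\<in>E. c e * y e)" for c
      unfolding reindex[symmetric] by (rule sum.cong) (simp_all add: z_def)
    moreover have "(\<Sum>j<n. fst (cs ! i) j * x $ j) + (\<Sum>e\<in>E. fst (snd (cs ! i)) e * y e) \<le> snd (snd (cs ! i))"
      if "i < l" for i
      using bspec[OF y, of "cs ! i"] that by (simp add: l_def)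
    ultimately have "B *\<^sub>v x + C *\<^sub>v z \<le> d" unfolding le[OF x z] by simp
    then show ?L using z by (rule bexI)
  qed
  have "S = {x \<in> carrier_vec n. \<exists>z\<in>carrier_vec k. B *\<^sub>v x + C *\<^sub>v z \<le> d}"
    unfolding S using mem by (intro Collect_cong) auto
  then show ?thesis
    using dims unfolding admits_ext_formulation_def extended_formulation_def l_def by blast
qed

text \<open>The size counts the sign constraints of the flow on the edges, and every conservation
  equation, the side equation and the equations for the coordinates twice.\<close>

lemma admits_circulation_formulation:
  fixes t h :: "'e \<Rightarrow> 'v"
  assumes fin: "finite E"
  shows "admits_ext_formulation n
    {vec n (\<lambda>k. x0 k - label_sum E l \<phi> k) | \<phi>. circulation E t h \<phi> \<and> (\<Sum>e\<in>E. w e * \<phi> e) = r}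
    (card E + 2 * card (t ` E \<union> h ` E) + 2 + 2 * n)" (is "admits_ext_formulation n ?S _")
proof -
  define V where "V = t ` E \<union> h ` E"
  obtain es where es: "set es = E" "length es = card E"
    using finite_distinct_list[OF fin] distinct_card by metis
  have "finite V" using fin by (simp add: V_def)
  then obtain vs where vs: "set vs = V" "length vs = card V"
    using finite_distinct_list distinct_card by metis
  define inc where "inc v e = (of_bool (h e = v) - of_bool (t e = v) :: real)" for v e
  define cs :: "((nat \<Rightarrow> real) \<times> ('e \<Rightarrow> real) \<times> real) list" where
    "cs = map (\<lambda>e. ((\<lambda>_. 0), (\<lambda>e'. - of_bool (e' = e)), 0)) es
      @ map (\<lambda>v. ((\<lambda>_. 0), inc v, 0)) vs @ map (\<lambda>v. ((\<lambda>_. 0), (\<lambda>e. - inc v e), 0)) vs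
      @ [((\<lambda>_. 0), w, r), ((\<lambda>_. 0), (\<lambda>e. - w e), - r)]
      @ map (\<lambda>k. ((\<lambda>j. of_bool (j = k)), (\<lambda>e. l e k), x0 k)) [0..<n]
      @ map (\<lambda>k. ((\<lambda>j. - of_bool (j = k)), (\<lambda>e. - l e k), - x0 k)) [0..<n]"
  have delta: "(\<Sum>j<n. of_bool (j = k) * x $ j) = x $ k" if "k < n" for k and x :: "real vec"
    using that by (simp add: of_bool_def if_distrib[of "\<lambda>z. z * _"] cong: if_cong)
  have delta_e: "(\<Sum>e'\<in>E. of_bool (e' = e) * y e') = y e" if "e \<in> E" for e and y :: "'e \<Rightarrow> real"
    using that fin by (simp add: of_bool_def if_distrib[of "\<lambda>z. z * _"] cong: if_cong)
  have cs_iff: "(\<forall>p\<in>set cs. (\<Sum>j<n. fst p j * x $ j) + (\<Sum>e\<in>E. fst (snd p) e * y e) \<le> snd (snd p)) \<longleftrightarrow>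
      (\<forall>e\<in>E. 0 \<le> y e) \<and> (\<forall>v\<in>V. (\<Sum>e\<in>E. inc v e * y e) = 0) \<and> (\<Sum>e\<in>E. w e * y e) = r \<and>
      (\<forall>k<n. x $ k = x0 k - label_sum E l y k)" for x :: "real vec" and y
  proof -
    have "(\<forall>p\<in>set cs. (\<Sum>j<n. fst p j * x $ j) + (\<Sum>e\<in>E. fst (snd p) e * y e) \<le> snd (snd p)) \<longleftrightarrow>
       (\<forall>e\<in>E. - y e \<le> 0) \<and> (\<forall>v\<in>V. (\<Sum>e\<in>E. inc v e * y e) \<le> 0) \<and> (\<forall>v\<in>V. - (\<Sum>e\<in>E. inc v e * y e) \<le> 0)
       \<and> (\<Sum>e\<in>E. w e * y e) \<le> r \<and> - (\<Sum>e\<in>E. w e * y e) \<le> - r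
       \<and> (\<forall>k\<in>{..<n}. x $ k + (\<Sum>e\<in>E. l e k * y e) \<le> x0 k)
       \<and> (\<forall>k\<in>{..<n}. - x $ k - (\<Sum>e\<in>E. l e k * y e) \<le> - x0 k)"
      unfolding cs_def set_append set_map ball_Un es vs
      by (simp add: sum_negf delta delta_e atLeast0LessThan)
    also have "\<dots> \<longleftrightarrow> (\<forall>e\<in>E. 0 \<le> y e) \<and> (\<forall>v\<in>V. (\<Sum>e\<in>E. inc v e * y e) = 0) \<and> (\<Sum>e\<in>E. w e * y e) = r \<and>
      (\<forall>k<n. x $ k = x0 k - label_sum E l y k)"
      unfolding label_sum_def mult.commute[of "y _"] by (force simp: eq_iff algebra_simps)
    finally show ?thesis .
  qed
  have len: "length cs = card E + 2 * card V + 2 + 2 * n"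
    using es vs by (simp add: cs_def)
  have "?S = {x \<in> carrier_vec n. \<exists>y :: 'e \<Rightarrow> real. \<forall>p\<in>set cs.
              (\<Sum>j<n. fst p j * x $ j) + (\<Sum>e\<in>E. fst (snd p) e * y e) \<le> snd (snd p)}"
  proof (intro equalityI subsetI)
    fix x assume "x \<in> ?S"
    then obtain \<phi> where \<phi>: "x = vec n (\<lambda>k. x0 k - label_sum E l \<phi> k)" "circulation E t h \<phi>"
        "(\<Sum>e\<in>E. w e * \<phi> e) = r"
      unfolding mem_Collect_eq by (elim exE conjE)
    have "(\<Sum>e\<in>E. inc v e * \<phi> e) = 0" for v
    proof -
      have "(\<Sum>e\<in>E. \<phi> e * (of_bool (h e = v) - of_bool (t e = v))) = 0"
        using \<phi>(2) unfolding circulation_def balanced_def by (elim conjE) (erule allE[where x = "\<lambda>w. of_bool (w = v)"])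
      then show ?thesis by (simp add: inc_def mult.commute)
    qed
    moreover have "0 \<le> \<phi> e" for e using \<phi>(2) by (simp add: circulation_def)
    ultimately have "\<forall>p\<in>set cs. (\<Sum>j<n. fst p j * x $ j) + (\<Sum>e\<in>E. fst (snd p) e * \<phi> e) \<le> snd (snd p)"
      unfolding cs_iff using \<phi>(1,3) by simp
    then show "x \<in> {x \<in> carrier_vec n. \<exists>y :: 'e \<Rightarrow> real. \<forall>p\<in>set cs.
              (\<Sum>j<n. fst p j * x $ j) + (\<Sum>e\<in>E. fst (snd p) e * y e) \<le> snd (snd p)}"
      using \<phi>(1) by (intro CollectI conjI exI[of _ \<phi>]) simp_all
  next
    fix x assume "x \<in> {x \<in> carrier_vec n. \<exists>y :: 'e \<Rightarrow> real. \<forall>p\<in>set cs.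
              (\<Sum>j<n. fst p j * x $ j) + (\<Sum>e\<in>E. fst (snd p) e * y e) \<le> snd (snd p)}"
    then obtain y where x: "x \<in> carrier_vec n"
      and y: "\<forall>p\<in>set cs. (\<Sum>j<n. fst p j * x $ j) + (\<Sum>e\<in>E. fst (snd p) e * y e) \<le> snd (snd p)"
      unfolding mem_Collect_eq by (elim exE conjE)
    note y' = y[unfolded cs_iff]
    define \<phi> where "\<phi> e = (if e \<in> E then y e else 0)" for e
    have sums: "(\<Sum>e\<in>E. c e * \<phi> e) = (\<Sum>e\<in>E. c e * y e)" "label_sum E l \<phi> = label_sum E l y" for c :: "'e \<Rightarrow> real"
      by (simp_all add: \<phi>_def label_sum_def fun_eq_iff)
    have "balanced E t h \<phi>"
    proof (rule balanced_if_conserved_except[OF fin])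
      fix v assume "v \<in> t ` E \<union> h ` E - {undefined}"
      then have "(\<Sum>e\<in>E. inc v e * \<phi> e) = 0" unfolding sums using y' by (simp add: V_def)
      then show "(\<Sum>e\<in>E. (of_bool (h e = v) - of_bool (t e = v)) * \<phi> e) = 0" by (simp add: inc_def)
    qed
    then have "circulation E t h \<phi>" using y' by (simp add: circulation_def \<phi>_def)
    moreover have "x = vec n (\<lambda>k. x0 k - label_sum E l \<phi> k)"
      using x y' unfolding sums by (intro eq_vecI) simp_all
    moreover have "(\<Sum>e\<in>E. w e * \<phi> e) = r" unfolding sums using y' by simp
    ultimately show "x \<in> ?S" by (intro CollectI exI[of _ \<phi>] conjI)
  qed
  from admits_ext_formulation_constraints[OF fin this] show ?thesis
    unfolding len V_def .
qed

section \<open>Hulls of odd circulations\<close>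

lemma convex_vec_conv: "convex_vec (conv S)"
  by (rule hull_in) (auto simp: convex_vec_def)

lemma conv_mono_convex: "S \<subseteq> C \<Longrightarrow> convex_vec C \<Longrightarrow> conv S \<subseteq> C"
  by (rule hull_minimal)

lemma convex_vec_carrier: "convex_vec (carrier_vec n)"
  by (auto simp: convex_vec_def)

lemma vec_combination:
  "u \<cdot>\<^sub>v vec n p + v \<cdot>\<^sub>v vec n q = vec n (\<lambda>k. u * p k + v * q k :: real)"
  by (intro eq_vecI) auto

lemma convex_vecD_fun:
  assumes "convex_vec C" "vec n p \<in> C" "vec n q \<in> C" "0 \<le> u" "0 \<le> v" "u + v = 1"
  shows "vec n (\<lambda>k. u * p k + v * q k) \<in> C"
  using assms unfolding convex_vec_def vec_combination[symmetric] by blast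

lemma vec_self: "p \<in> carrier_vec n \<Longrightarrow> vec n (\<lambda>k. p $ k) = (p :: real vec)"
  by (intro eq_vecI) auto

text \<open>A point of the ray lies between two of the translates.\<close>

lemma conv_recession:
  fixes q :: "nat \<Rightarrow> real"
  assumes T: "T \<subseteq> carrier_vec n"
    and step: "\<And>p j. p \<in> T \<Longrightarrow> vec n (\<lambda>k. p $ k - real j * q k) \<in> T"
    and p: "p \<in> conv T" and c: "0 \<le> c"
  shows "vec n (\<lambda>k. p $ k - c * q k) \<in> conv T"
proof -
  \<comment> \<open>the points for which the claim holds form a convex set containing \<open>T\<close>\<close>
  define M where "M = {p \<in> carrier_vec n. \<forall>c\<ge>0. vec n (\<lambda>k. p $ k - c * q k) \<in> conv T}"
  have "T \<subseteq> M"
  proof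
    fix p assume p: "p \<in> T"
    have "vec n (\<lambda>k. p $ k - c * q k) \<in> conv T" if c: "0 \<le> c" for c
    proof -
      obtain N :: nat where N: "c < real N" using reals_Archimedean2 by blast
      then have Npos: "0 < real N" using c by linarith
      have "vec n (\<lambda>k. p $ k) \<in> conv T"
        using p T vec_self[of p n] hull_inc[of p T convex_vec] by auto
      moreover have "vec n (\<lambda>k. p $ k - real N * q k) \<in> conv T"
        using step[OF p] by (rule hull_inc)
      ultimately have "vec n (\<lambda>k. (1 - c / N) * (p $ k) + (c / N) * (p $ k - real N * q k)) \<in> conv T"
        using N c Npos by (intro convex_vecD_fun[OF convex_vec_conv]) simp_all
      moreover have "(1 - c / N) * (p $ k) + (c / N) * (p $ k - real N * q k) = p $ k - c * q k" for k
        using Npos by (simp add: field_simps)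
      ultimately show ?thesis by simp
    qed
    then show "p \<in> M" using p T by (auto simp: M_def)
  qed
  moreover have "convex_vec M"
    unfolding convex_vec_def
  proof (intro ballI allI impI)
    fix x y :: "real vec" and u v :: real
    assume x: "x \<in> M" and y: "y \<in> M" and uv: "0 \<le> u" "0 \<le> v" "u + v = 1"
    have dims: "dim_vec x = n" "dim_vec y = n" using x y by (auto simp: M_def)
    have "vec n (\<lambda>k. (u \<cdot>\<^sub>v x + v \<cdot>\<^sub>v y) $ k - c * q k) \<in> conv T" if c: "0 \<le> c" for c
    proof -
      have "vec n (\<lambda>k. u * (x $ k - c * q k) + v * (y $ k - c * q k)) \<in> conv T"
        using x y c uv by (intro convex_vecD_fun[OF convex_vec_conv]) (simp_all add: M_def)
      moreover have "vec n (\<lambda>k. u * (x $ k - c * q k) + v * (y $ k - c * q k))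
          = vec n (\<lambda>k. (u \<cdot>\<^sub>v x + v \<cdot>\<^sub>v y) $ k - c * q k)"
      proof (intro eq_vecI)
        fix k assume k: "k < dim_vec (vec n (\<lambda>k. (u \<cdot>\<^sub>v x + v \<cdot>\<^sub>v y) $ k - c * q k))"
        have "c * q k = (u + v) * (c * q k)" using uv by simp
        then show "vec n (\<lambda>k. u * (x $ k - c * q k) + v * (y $ k - c * q k)) $ k
            = vec n (\<lambda>k. (u \<cdot>\<^sub>v x + v \<cdot>\<^sub>v y) $ k - c * q k) $ k"
          using dims k by (simp add: algebra_simps)
      qed simp
      ultimately show ?thesis by simp
    qed
    then show "u \<cdot>\<^sub>v x + v \<cdot>\<^sub>v y \<in> M" using x y by (simp add: M_def)
  qed
  ultimately have "conv T \<subseteq> M" by (rule conv_mono_convex)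
  then show ?thesis using p c by (auto simp: M_def)
qed

definition odd_real :: "real \<Rightarrow> bool" where
  "odd_real x \<longleftrightarrow> (\<exists>k :: int. odd k \<and> x = of_int k)"

lemma odd_real_of_int [simp]: "odd_real (of_int k) \<longleftrightarrow> odd k"
  by (auto simp: odd_real_def)

definition odd_weight :: "'e set \<Rightarrow> ('e \<Rightarrow> bool) \<Rightarrow> ('e \<Rightarrow> real) \<Rightarrow> real" where
  "odd_weight E od f = (\<Sum>e\<in>E. f e * of_bool (od e))"

lemma odd_weight_Ints: "(\<And>e. f e \<in> \<int>) \<Longrightarrow> odd_weight E od f \<in> \<int>"
  unfolding odd_weight_def by (intro Ints_sum Ints_mult) auto

lemma odd_weight_add: "odd_weight E od (\<lambda>e. f e + c * g e) = odd_weight E od f + c * odd_weight E od g"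
  unfolding odd_weight_def sum_distrib_left sum.distrib[symmetric] by (rule sum.cong) (auto simp: algebra_simps)

lemma cycle_flow_Ints: "cycle_flow es e \<in> \<int>"
  by (simp add: cycle_flow_def)

text \<open>Decompose into cycles with integer multiples: if every cycle were even, so would be the sum.\<close>

lemma odd_circulation_contains_odd_dicycle:
  assumes "circulation E t h f" "finite E" "\<And>e. f e \<in> \<int>" "odd_real (odd_weight E od f)"
  shows "\<exists>es. dicycle E t h es \<and> odd_real (odd_weight E od (cycle_flow es)) \<and> (\<forall>e. cycle_flow es e \<le> f e)"
proof -
  have "(\<forall>e. f e \<in> \<int>) \<longrightarrow> odd_real (odd_weight E od f) \<longrightarrow>
      (\<exists>es. dicycle E t h es \<and> odd_real (odd_weight E od (cycle_flow es)) \<and> (\<forall>e. cycle_flow es e \<le> f e))"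
    using assms(1,2)
  proof (induction rule: circulation_induct)
    case zero
    show ?case by (simp add: odd_weight_def odd_real_def)
  next
    case (add f c es e0)
    let ?g = "\<lambda>e. f e + c * cycle_flow es e"
    show ?case
    proof (intro impI)
      assume int: "\<forall>e. ?g e \<in> \<int>" and od: "odd_real (odd_weight E od ?g)"
      have cint: "c \<in> \<int>" using spec[OF int, of e0] add.hyps by (simp add: cycle_flow_def)
      have fint: "f e \<in> \<int>" for e
      proof -
        have "?g e - c * cycle_flow es e \<in> \<int>"
          using int cint cycle_flow_Ints by (intro Ints_diff Ints_mult) auto
        then show ?thesis by simp
      qed
      have nn: "0 \<le> f e" for e using add.hyps(1) by (simp add: circulation_def)
      obtain a b c' where abc: "odd_weight E od f = of_int a" "odd_weight E od (cycle_flow es) = of_int b" "c = of_int c'"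
        using odd_weight_Ints[of f E od] fint odd_weight_Ints[of "cycle_flow es" E od] cycle_flow_Ints cint
        by (metis Ints_cases)
      have weight: "odd_weight E od ?g = of_int (a + c' * b)"
        unfolding odd_weight_add abc by simp
      have "odd (a + c' * b)" using od unfolding weight odd_real_of_int .
      then have "odd b \<or> odd a" by auto
      then consider "odd b" | "odd a" by (rule disjE)
      then show "\<exists>es. dicycle E t h es \<and> odd_real (odd_weight E od (cycle_flow es)) \<and> (\<forall>e. cycle_flow es e \<le> ?g e)"
      proof cases
        case 1
        have "1 \<le> c" using \<open>0 < c\<close> abc(3) by simp
        then have "cycle_flow es e \<le> ?g e" for e using nn[of e] by (simp add: cycle_flow_def)
        then show ?thesis using add.hyps(2) 1 abc(2) by (intro exI[of _ es]) simp
      next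
        case 2
        then obtain es' where es': "dicycle E t h es'" "odd_real (odd_weight E od (cycle_flow es'))"
            "\<forall>e. cycle_flow es' e \<le> f e"
          using add.IH fint abc(1) by (metis odd_real_of_int)
        have "cycle_flow es' e \<le> ?g e" for e
        proof -
          have "0 \<le> c * cycle_flow es e" using \<open>0 < c\<close> by (simp add: cycle_flow_def)
          then show ?thesis using spec[OF es'(3), of e] by linarith
        qed
        then show ?thesis using es' by (intro exI[of _ es']) simp
      qed
    qed
  qed
  then show ?thesis using assms(3,4) by simp
qed

text \<open>For every start vertex \<open>u\<close> there is a copy of the double cover. The edge \<open>(u, Some (e, s))\<close> is the copy
of \<open>e\<close> that leaves sheet \<open>s\<close>, and \<open>(u, None)\<close> is a return edge from the copy of \<open>u\<close> in the upper
sheet to the one in the lower sheet.\<close>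

type_synonym ('v, 'e) cover_edge = "'v \<times> ('e \<times> bool) option"

definition cover_edges :: "'v set \<Rightarrow> 'e set \<Rightarrow> ('v, 'e) cover_edge set" where
  "cover_edges V E = V \<times> insert None (Some ` (E \<times> UNIV))"

definition cover_tail :: "('e \<Rightarrow> 'v) \<Rightarrow> ('v, 'e) cover_edge \<Rightarrow> 'v \<times> 'v \<times> bool" where
  "cover_tail t x = (case x of (u, None) \<Rightarrow> (u, u, True) | (u, Some (e, s)) \<Rightarrow> (u, t e, s))"

definition cover_head :: "('e \<Rightarrow> 'v) \<Rightarrow> ('e \<Rightarrow> bool) \<Rightarrow> ('v, 'e) cover_edge \<Rightarrow> 'v \<times> 'v \<times> bool" where
  "cover_head h od x = (case x of (u, None) \<Rightarrow> (u, u, False) | (u, Some (e, s)) \<Rightarrow> (u, h e, s \<noteq> od e))"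

definition cover_label :: "('e \<Rightarrow> nat \<Rightarrow> real) \<Rightarrow> ('v, 'e) cover_edge \<Rightarrow> nat \<Rightarrow> real" where
  "cover_label l x = (case x of (u, None) \<Rightarrow> (\<lambda>_. 0) | (u, Some (e, s)) \<Rightarrow> l e)"

definition return_flow :: "'v set \<Rightarrow> (('v, 'e) cover_edge \<Rightarrow> real) \<Rightarrow> real" where
  "return_flow V \<phi> = (\<Sum>u\<in>V. \<phi> (u, None))"

definition cover_proj :: "'v set \<Rightarrow> (('v, 'e) cover_edge \<Rightarrow> real) \<Rightarrow> 'e \<Rightarrow> real" where
  "cover_proj V \<phi> e = (\<Sum>u\<in>V. \<phi> (u, Some (e, False)) + \<phi> (u, Some (e, True)))"

lemmas cover_simps = cover_tail_def cover_head_def cover_label_def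

lemma finite_cover_edges: "finite V \<Longrightarrow> finite E \<Longrightarrow> finite (cover_edges V E)"
  by (simp add: cover_edges_def)

lemma card_cover_edges:
  assumes "finite V" "finite E"
  shows "card (cover_edges V E) = card V * (2 * card E + 1)"
proof -
  have "card (Some ` (E \<times> (UNIV :: bool set))) = card E * 2"
    by (subst card_image) (auto simp: card_cartesian_product)
  moreover have "None \<notin> Some ` (E \<times> (UNIV :: bool set))" by auto
  ultimately have "card (insert None (Some ` (E \<times> (UNIV :: bool set)))) = 2 * card E + 1"
    using assms(2) by simp
  then show ?thesis by (simp add: cover_edges_def card_cartesian_product)
qed

lemma sum_cover_edges:
  assumes "finite V" "finite E"
  shows "(\<Sum>x\<in>cover_edges V E. F x) =
    (\<Sum>u\<in>V. F (u, None) + (\<Sum>e\<in>E. F (u, Some (e, False)) + F (u, Some (e, True))))"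
proof -
  have "(\<Sum>x\<in>cover_edges V E. F x) = (\<Sum>u\<in>V. \<Sum>x\<in>insert None (Some ` (E \<times> UNIV)). F (u, x))"
    unfolding cover_edges_def by (subst sum.cartesian_product) simp
  also have "\<dots> = (\<Sum>u\<in>V. F (u, None) + (\<Sum>e\<in>E. F (u, Some (e, False)) + F (u, Some (e, True))))"
  proof (rule sum.cong[OF refl])
    fix u
    have "(\<Sum>x\<in>insert None (Some ` (E \<times> UNIV)). F (u, x)) = F (u, None) + (\<Sum>x\<in>Some ` (E \<times> UNIV). F (u, x))"
      using assms by (subst sum.insert) auto
    also have "(\<Sum>x\<in>Some ` (E \<times> UNIV). F (u, x)) = (\<Sum>x\<in>E \<times> UNIV. F (u, Some x))"
      by (subst sum.reindex) auto
    also have "\<dots> = (\<Sum>e\<in>E. \<Sum>s\<in>UNIV. F (u, Some (e, s)))"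
      by (subst sum.cartesian_product) simp
    also have "\<dots> = (\<Sum>e\<in>E. F (u, Some (e, False)) + F (u, Some (e, True)))"
      by (simp add: UNIV_bool add.commute)
    finally show "(\<Sum>x\<in>insert None (Some ` (E \<times> UNIV)). F (u, x)) =
      F (u, None) + (\<Sum>e\<in>E. F (u, Some (e, False)) + F (u, Some (e, True)))" .
  qed
  finally show ?thesis .
qed

lemma cover_proj_sum:
  "(\<Sum>e\<in>E. cover_proj V \<phi> e * a e) =
    (\<Sum>u\<in>V. \<Sum>e\<in>E. \<phi> (u, Some (e, False)) * a e + \<phi> (u, Some (e, True)) * a e)"
  unfolding cover_proj_def sum_distrib_right
  by (subst sum.swap) (simp add: distrib_right)

lemma label_sum_cover:
  assumes "finite V" "finite E"
  shows "label_sum (cover_edges V E) (cover_label l) \<phi> = label_sum E l (cover_proj V \<phi>)"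
proof
  fix k
  show "label_sum (cover_edges V E) (cover_label l) \<phi> k = label_sum E l (cover_proj V \<phi>) k"
    unfolding label_sum_def sum_cover_edges[OF assms] cover_proj_sum by (simp add: cover_label_def)
qed

lemma circulation_cover_proj:
  assumes fin: "finite V" "finite E"
    and \<phi>: "circulation (cover_edges V E) (cover_tail t) (cover_head h od) \<phi>"
  shows "circulation E t h (cover_proj V \<phi>)"
  unfolding circulation_def balanced_def
proof (intro conjI allI impI)
  show "0 \<le> cover_proj V \<phi> e" for e
    using \<phi> unfolding cover_proj_def circulation_def by (intro sum_nonneg) simp
  show "cover_proj V \<phi> e = 0" if "e \<notin> E" for e
  proof -
    have "(u, Some (e, s)) \<notin> cover_edges V E" for u s using that by (auto simp: cover_edges_def)
    then have "\<phi> (u, Some (e, s)) = 0" for u s using \<phi> by (simp add: circulation_def)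
    then show ?thesis by (simp add: cover_proj_def)
  qed
  fix \<psi> :: "_ \<Rightarrow> real"
  have "(\<Sum>x\<in>cover_edges V E. \<phi> x * (\<psi> (fst (snd (cover_head h od x))) - \<psi> (fst (snd (cover_tail t x))))) = 0"
    using \<phi> unfolding circulation_def balanced_def
    by (elim conjE) (erule allE[where x = "\<lambda>w. \<psi> (fst (snd w))"])
  then show "(\<Sum>e\<in>E. cover_proj V \<phi> e * (\<psi> (h e) - \<psi> (t e))) = 0"
    unfolding sum_cover_edges[OF fin] cover_proj_sum by (simp add: cover_simps)
qed

text \<open>The sheet changes along the odd edges and along the return edges, so a circulation changes
  it equally often in both directions.\<close>

lemma odd_weight_cover_proj:
  assumes fin: "finite V" "finite E"
    and \<phi>: "circulation (cover_edges V E) (cover_tail t) (cover_head h od) \<phi>"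
  shows "odd_weight E od (cover_proj V \<phi>) =
    return_flow V \<phi> + 2 * (\<Sum>u\<in>V. \<Sum>e\<in>E. \<phi> (u, Some (e, True)) * of_bool (od e))"
proof -
  let ?\<psi> = "\<lambda>w :: 'a \<times> 'a \<times> bool. of_bool (snd (snd w)) :: real"
  have "0 = (\<Sum>x\<in>cover_edges V E. \<phi> x * (?\<psi> (cover_head h od x) - ?\<psi> (cover_tail t x)))"
    using \<phi> unfolding circulation_def balanced_def
    by (elim conjE) (erule allE[where x = ?\<psi>], simp only:)
  also have "\<dots> = (\<Sum>u\<in>V. - \<phi> (u, None) +
      (\<Sum>e\<in>E. \<phi> (u, Some (e, False)) * of_bool (od e) - \<phi> (u, Some (e, True)) * of_bool (od e)))"
    unfolding sum_cover_edges[OF fin] by (intro sum.cong refl arg_cong2[where f = "(+)"]) (auto simp: cover_simps)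
  also have "\<dots> = - return_flow V \<phi> + (\<Sum>u\<in>V. \<Sum>e\<in>E. \<phi> (u, Some (e, False)) * of_bool (od e))
      - (\<Sum>u\<in>V. \<Sum>e\<in>E. \<phi> (u, Some (e, True)) * of_bool (od e))"
    by (simp add: return_flow_def sum.distrib sum_subtractf sum_negf)
  finally have "(\<Sum>u\<in>V. \<Sum>e\<in>E. \<phi> (u, Some (e, False)) * of_bool (od e)) =
      return_flow V \<phi> + (\<Sum>u\<in>V. \<Sum>e\<in>E. \<phi> (u, Some (e, True)) * of_bool (od e))" by simp
  then show ?thesis
    unfolding odd_weight_def cover_proj_sum by (simp add: sum.distrib)
qed

text \<open>A cycle of the cover stays in the copy of one start vertex, which has a single return edge.\<close>

lemma return_flow_cycle:
  assumes fin: "finite V" and es: "dicycle (cover_edges V E) (cover_tail t) (cover_head h od) es"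
  shows "return_flow V (cycle_flow es) = 0 \<or> return_flow V (cycle_flow es) = 1"
proof -
  have step: "fst (es ! i) = fst (es ! (Suc i mod length es))" if "i < length es" for i
  proof -
    have "fst (cover_head h od (es ! i)) = fst (cover_tail t (es ! (Suc i mod length es)))"
      using es that by (simp add: dicycle_def)
    then show ?thesis by (simp add: cover_simps split: prod.splits option.splits)
  qed
  have same0: "fst (es ! i) = fst (es ! 0)" if "i < length es" for i
    using that
  proof (induction i)
    case (Suc i)
    then show ?case using step[of i] by simp
  qed simp
  define u where "u = fst (es ! 0)"
  have same: "fst x = u" if "x \<in> set es" for x
    using that same0 unfolding u_def by (metis in_set_conv_nth)
  have "return_flow V (cycle_flow es) = (\<Sum>u'\<in>V \<inter> {u}. cycle_flow es (u', None))"
    unfolding return_flow_def using fin same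
    by (intro sum.mono_neutral_right) (auto simp: cycle_flow_def dest: same)
  also have "\<dots> = 0 \<or> \<dots> = 1"
    by (cases "u \<in> V") (auto simp: cycle_flow_def)
  finally show ?thesis .
qed

lemma label_sum_add: "label_sum E l (\<lambda>e. f e + c * g e) k = label_sum E l f k + c * label_sum E l g k"
  unfolding label_sum_def sum_distrib_left sum.distrib[symmetric] by (rule sum.cong) (auto simp: algebra_simps)

lemma return_flow_add: "return_flow V (\<lambda>x. f x + c * g x) = return_flow V f + c * return_flow V g"
  unfolding return_flow_def sum_distrib_left sum.distrib[symmetric] by (rule sum.cong) (auto simp: algebra_simps)

lemma cover_proj_add: "cover_proj V (\<lambda>x. f x + c * g x) e = cover_proj V f e + c * cover_proj V g e"
  unfolding cover_proj_def sum_distrib_left sum.distrib[symmetric] by (rule sum.cong) (auto simp: algebra_simps)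

lemma sum_of_bool_single:
  assumes "finite V" "u \<in> V"
  shows "(\<Sum>u'\<in>V. of_bool (u' = u) * F u') = (F u :: real)"
proof -
  have "(\<Sum>u'\<in>V. of_bool (u' = u) * F u') = (\<Sum>u'\<in>{u}. of_bool (u' = u) * F u')"
    using assms by (intro sum.mono_neutral_right) auto
  then show ?thesis by simp
qed

text \<open>An odd cycle lifts to a path from the lower to the upper copy of its first vertex, which the
  return edge closes.\<close>

lemma lift_odd_dicycle:
  fixes t h :: "'e \<Rightarrow> 'v"
  assumes fin: "finite E" "finite V" and V: "t ` E \<subseteq> V" and es: "dicycle E t h es"
    and od: "odd_real (odd_weight E od (cycle_flow es))"
  shows "\<exists>\<phi>. circulation (cover_edges V E) (cover_tail t) (cover_head h od) \<phi> \<and>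
    return_flow V \<phi> = 1 \<and> cover_proj V \<phi> = cycle_flow es"
proof -
  define N where "N = length es"
  have N: "0 < N" using es by (simp add: N_def dicycle_def)
  define u where "u = t (es ! 0)"
  \<comment> \<open>the sheet reached after the first \<open>i\<close> edges\<close>
  define s where "s i = odd (card {j. j < i \<and> od (es ! j)})" for i
  have s0: "\<not> s 0" by (simp add: s_def)
  have sSuc: "s (Suc i) = (s i \<noteq> od (es ! i))" for i
  proof -
    have "{j. j < Suc i \<and> od (es ! j)} = (if od (es ! i) then insert i {j. j < i \<and> od (es ! j)} else {j. j < i \<and> od (es ! j)})"
      by (auto simp: less_Suc_eq)
    then show ?thesis by (simp add: s_def)
  qed
  have sN: "s N"
  proof -
    have "odd_weight E od (cycle_flow es) = (\<Sum>i<N. of_bool (od (es ! i)))"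
      unfolding odd_weight_def N_def
      by (subst sum_support_dicycle[OF es fin(1)]) (auto simp: cycle_flow_def)
    also have "\<dots> = real (card {j. j < N \<and> od (es ! j)})"
    proof -
      have "{..<N} \<inter> {j. od (es ! j)} = {j. j < N \<and> od (es ! j)}" by auto
      then show ?thesis by (simp add: of_bool_def sum.If_cases)
    qed
    also have "\<dots> = of_int (int (card {j. j < N \<and> od (es ! j)}))" by simp
    finally have weight: "odd_weight E od (cycle_flow es) = of_int (int (card {j. j < N \<and> od (es ! j)}))" .
    show ?thesis using od unfolding weight odd_real_of_int s_def by simp
  qed
  define ls where "ls = (u, None) # map (\<lambda>i. (u, Some (es ! i, s i))) [0..<N]"
  have len: "length ls = Suc N" by (simp add: ls_def)
  have ls_nth: "ls ! 0 = (u, None)" "i < N \<Longrightarrow> ls ! Suc i = (u, Some (es ! i, s i))" for i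
    by (simp_all add: ls_def)
  have inE: "es ! i \<in> E" if "i < N" for i using es that nth_mem[of i es] by (auto simp: dicycle_def N_def)
  have uV: "u \<in> V" using V inE[OF N] by (auto simp: u_def)
  have tinj: "t (es ! i) = t (es ! j) \<longleftrightarrow> i = j" if "i < N" "j < N" for i j
    using es that nth_eq_iff_index_eq[of "map t es" i j] by (simp add: dicycle_def N_def)
  have "dicycle (cover_edges V E) (cover_tail t) (cover_head h od) ls"
    unfolding dicycle_def
  proof (intro conjI allI impI)
    show "ls \<noteq> []" by (simp add: ls_def)
    show "set ls \<subseteq> cover_edges V E" using uV inE by (auto simp: ls_def cover_edges_def)
    show "distinct (map (cover_tail t) ls)"
    proof -
      have "inj_on (\<lambda>i. (u, t (es ! i), s i)) {0..<N}"
        by (rule inj_onI) (simp add: tinj)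
      moreover have "(u, u, True) \<noteq> (u, t (es ! i), s i)" if "i < N" for i
        using tinj[of i 0] that N s0 by (auto simp: u_def)
      ultimately show ?thesis by (auto simp: ls_def cover_tail_def distinct_map inj_on_def)
    qed
    fix i assume "i < length ls"
    then consider "i = 0" | j where "i = Suc j" "Suc j < N" | j where "i = Suc j" "Suc j = N"
      using len by (cases i) (auto simp: less_Suc_eq)
    then show "cover_head h od (ls ! i) = cover_tail t (ls ! (Suc i mod length ls))"
    proof cases
      case 1
      then show ?thesis using len N ls_nth(2)[of 0] s0
        by (simp add: ls_nth(1) cover_head_def cover_tail_def u_def)
    next
      case (2 j)
      have "h (es ! j) = t (es ! Suc j)" using es 2 by (simp add: dicycle_def N_def)
      then show ?thesis using 2 len ls_nth(2)[of j] ls_nth(2)[of "Suc j"] sSuc[of j]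
        by (simp add: cover_head_def cover_tail_def)
    next
      case (3 j)
      have "h (es ! j) = u" using es 3 by (auto simp: dicycle_def N_def u_def)
      moreover have "s j \<noteq> od (es ! j)" using sSuc[of j] sN 3 by simp
      ultimately show ?thesis using 3 len ls_nth(2)[of j]
        by (simp add: ls_nth(1) cover_head_def cover_tail_def)
    qed
  qed
  then have circ: "circulation (cover_edges V E) (cover_tail t) (cover_head h od) (cycle_flow ls)"
    by (rule circulation_cycle_flow) (simp add: finite_cover_edges fin)
  have flow_None: "cycle_flow ls (u', None) = of_bool (u' = u) * 1" for u'
    by (auto simp: cycle_flow_def ls_def)
  have flow_Some: "cycle_flow ls (u', Some (e, b)) = of_bool (u' = u) * of_bool (\<exists>i<N. es ! i = e \<and> s i = b)" for u' e b
    by (auto simp: cycle_flow_def ls_def)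
  have "return_flow V (cycle_flow ls) = 1"
    unfolding return_flow_def flow_None by (rule sum_of_bool_single[OF fin(2) uV])
  moreover have "cover_proj V (cycle_flow ls) e = cycle_flow es e" for e
  proof -
    have "cover_proj V (cycle_flow ls) e =
        of_bool (\<exists>i<N. es ! i = e \<and> s i = False) + of_bool (\<exists>i<N. es ! i = e \<and> s i = True)"
      unfolding cover_proj_def flow_Some distrib_left[symmetric] by (rule sum_of_bool_single[OF fin(2) uV])
    also have "\<dots> = of_bool (\<exists>i<N. es ! i = e)"
    proof -
      have "i = j" if "i < N" "j < N" "es ! i = e" "es ! j = e" for i j
        using tinj[of i j] that by simp
      then show ?thesis by (auto simp: of_bool_def)
    qed
    also have "\<dots> = cycle_flow es e" by (simp add: cycle_flow_def in_set_conv_nth N_def Bex_def conj_commute)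
    finally show ?thesis .
  qed
  ultimately show ?thesis using circ by (intro exI[of _ "cycle_flow ls"]) (simp add: fun_eq_iff)
qed

text \<open>Half of the circulation on each sheet: the two halves exchange equal amounts along the odd edges.\<close>

lemma lift_circulation:
  fixes t h :: "'e \<Rightarrow> 'v"
  assumes fin: "finite E" "finite V" and u: "u \<in> V" and r: "circulation E t h r"
  shows "\<exists>\<phi>. circulation (cover_edges V E) (cover_tail t) (cover_head h od) \<phi> \<and>
    return_flow V \<phi> = 0 \<and> cover_proj V \<phi> = r"
proof -
  define \<phi> where "\<phi> x = (case x of (u', None) \<Rightarrow> 0 | (u', Some (e, s)) \<Rightarrow> of_bool (u' = u) * (r e / 2))"
    for x :: "('v, 'e) cover_edge"
  have \<phi>_None: "\<phi> (u', None) = 0" and \<phi>_Some: "\<phi> (u', Some (e, s)) = of_bool (u' = u) * (r e / 2)" for u' e s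
    by (simp_all add: \<phi>_def)
  have "circulation (cover_edges V E) (cover_tail t) (cover_head h od) \<phi>"
    unfolding circulation_def balanced_def
  proof (intro conjI allI impI)
    show "0 \<le> \<phi> x" for x
      using r by (auto simp: \<phi>_def circulation_def split: prod.splits option.splits)
    show "\<phi> x = 0" if x: "x \<notin> cover_edges V E" for x
    proof (cases x)
      case (Pair u' y)
      show ?thesis
      proof (cases y)
        case None
        then show ?thesis using Pair by (simp add: \<phi>_None)
      next
        case (Some es)
        obtain e s where es: "es = (e, s)" by (cases es)
        have "u' \<noteq> u \<or> e \<notin> E" using x u by (auto simp: Pair Some es cover_edges_def)
        then show ?thesis using r by (auto simp: Pair Some es \<phi>_Some circulation_def)
      qed
    qed
    fix \<psi> :: "'v \<times> 'v \<times> bool \<Rightarrow> real"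
    have flip: "r e * \<psi> (u, h e, od e) / 2 + r e * \<psi> (u, h e, \<not> od e) / 2
        = r e * \<psi> (u, h e, False) / 2 + r e * \<psi> (u, h e, True) / 2" for e
      by (cases "od e") simp_all
    have "(\<Sum>x\<in>cover_edges V E. \<phi> x * (\<psi> (cover_head h od x) - \<psi> (cover_tail t x)))
      = (\<Sum>u'\<in>V. of_bool (u' = u) * (\<Sum>e\<in>E. r e / 2 *
          ((\<psi> (u', h e, False) + \<psi> (u', h e, True)) - (\<psi> (u', t e, False) + \<psi> (u', t e, True)))))"
      unfolding sum_cover_edges[OF fin(2,1)]
      by (rule sum.cong[OF refl])
        (auto simp: \<phi>_None \<phi>_Some cover_simps sum_distrib_left algebra_simps flip intro!: sum.cong)
    also have "\<dots> = (\<Sum>e\<in>E. r e / 2 *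
          ((\<psi> (u, h e, False) + \<psi> (u, h e, True)) - (\<psi> (u, t e, False) + \<psi> (u, t e, True))))"
      by (rule sum_of_bool_single[OF fin(2) u])
    also have "\<dots> = (\<Sum>e\<in>E. r e *
          ((\<psi> (u, h e, False) + \<psi> (u, h e, True)) - (\<psi> (u, t e, False) + \<psi> (u, t e, True)))) / 2"
      by (simp add: sum_divide_distrib)
    also have "(\<Sum>e\<in>E. r e *
          ((\<psi> (u, h e, False) + \<psi> (u, h e, True)) - (\<psi> (u, t e, False) + \<psi> (u, t e, True)))) = 0"
      using r unfolding circulation_def balanced_def
      by (elim conjE) (erule allE[where x = "\<lambda>v. \<psi> (u, v, False) + \<psi> (u, v, True)"])
    finally show "(\<Sum>x\<in>cover_edges V E. \<phi> x * (\<psi> (cover_head h od x) - \<psi> (cover_tail t x))) = 0" by simp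
  qed
  moreover have "return_flow V \<phi> = 0" by (simp add: return_flow_def \<phi>_None)
  moreover have "cover_proj V \<phi> e = r e" for e
  proof -
    have "cover_proj V \<phi> e = (\<Sum>u'\<in>V. of_bool (u' = u) * (r e / 2 + r e / 2))"
      unfolding cover_proj_def \<phi>_Some distrib_left[symmetric] ..
    also have "\<dots> = r e / 2 + r e / 2" by (rule sum_of_bool_single[OF fin(2) u])
    finally show ?thesis by simp
  qed
  ultimately show ?thesis by (intro exI[of _ \<phi>]) (simp add: fun_eq_iff)
qed

definition odd_circulation :: "'e set \<Rightarrow> ('e \<Rightarrow> 'v) \<Rightarrow> ('e \<Rightarrow> 'v) \<Rightarrow> ('e \<Rightarrow> bool) \<Rightarrow> ('e \<Rightarrow> real) \<Rightarrow> bool" where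
  "odd_circulation E t h od f \<longleftrightarrow>
     circulation E t h f \<and> (\<forall>e. f e \<in> \<int>) \<and> odd_real (odd_weight E od f)"

definition label_point :: "nat \<Rightarrow> (nat \<Rightarrow> real) \<Rightarrow> 'e set \<Rightarrow> ('e \<Rightarrow> nat \<Rightarrow> real) \<Rightarrow> ('e \<Rightarrow> real) \<Rightarrow> real vec" where
  "label_point n x0 E l f = vec n (\<lambda>k. x0 k - label_sum E l f k)"

lemma convex_label_points:
  assumes "\<And>f g u v. P f \<Longrightarrow> P g \<Longrightarrow> 0 \<le> u \<Longrightarrow> 0 \<le> v \<Longrightarrow> u + v = 1 \<Longrightarrow> P (\<lambda>e. u * f e + v * g e)"
  shows "convex_vec {label_point n x0 E l f | f. P f}"
  unfolding convex_vec_def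
proof (intro ballI allI impI)
  fix x y :: "real vec" and u v :: real
  assume "x \<in> {label_point n x0 E l f | f. P f}" and "y \<in> {label_point n x0 E l f | f. P f}"
    and uv: "0 \<le> u" "0 \<le> v" "u + v = 1"
  then obtain f g where f: "x = label_point n x0 E l f" "P f" and g: "y = label_point n x0 E l g" "P g"
    unfolding mem_Collect_eq by (elim exE conjE)
  have "u * (x0 k - label_sum E l f k) + v * (x0 k - label_sum E l g k)
      = x0 k - label_sum E l (\<lambda>e. u * f e + v * g e) k" for k
  proof -
    have "label_sum E l (\<lambda>e. u * f e + v * g e) k = label_sum E l (\<lambda>e. u * f e) k + v * label_sum E l g k"
      by (rule label_sum_add)
    also have "label_sum E l (\<lambda>e. u * f e) k = u * label_sum E l f k"
      unfolding label_sum_def by (simp add: sum_distrib_left mult.assoc)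
    finally have "label_sum E l (\<lambda>e. u * f e + v * g e) k = u * label_sum E l f k + v * label_sum E l g k" .
    moreover have "u * x0 k + v * x0 k = x0 k" using uv(3) by (metis distrib_right mult_1)
    ultimately show ?thesis by (simp add: algebra_simps)
  qed
  then have "u \<cdot>\<^sub>v x + v \<cdot>\<^sub>v y = label_point n x0 E l (\<lambda>e. u * f e + v * g e)"
    unfolding f(1) g(1) label_point_def vec_combination by simp
  moreover have "P (\<lambda>e. u * f e + v * g e)" using assms f(2) g(2) uv by simp
  ultimately show "u \<cdot>\<^sub>v x + v \<cdot>\<^sub>v y \<in> {label_point n x0 E l f | f. P f}"
    unfolding mem_Collect_eq by (intro exI[of _ "\<lambda>e. u * f e + v * g e"] conjI)
qed

lemma circulation_combination:
  assumes "circulation E t h f" "circulation E t h g" "0 \<le> u" "0 \<le> v"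
  shows "circulation E t h (\<lambda>e. u * f e + v * g e)"
proof -
  have "circulation E t h (\<lambda>e. 0 + u * f e)" by (rule circulation_add[OF circulation_zero assms(1,3)])
  then show ?thesis using circulation_add[OF _ assms(2,4), of "\<lambda>e. 0 + u * f e"] by simp
qed

lemma label_sum_zero: "label_sum E l (\<lambda>e. 0) k = 0"
  by (simp add: label_sum_def)

text \<open>An odd circulation is an odd cycle, which lifts to one unit of return flow, plus a circulation, which
lifts without return flow. Conversely, decompose a circulation of the cover into cycles: by parity, a
cycle with a return edge projects to an odd circulation and any other cycle to an even one, which is a
recession direction of the hull.\<close>

lemma conv_odd_circulations:
  fixes t h :: "'e \<Rightarrow> 'v"
  assumes fin: "finite E"
  defines "V \<equiv> t ` E \<union> h ` E"
  shows "conv {label_point n x0 E l f | f. odd_circulation E t h od f} =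
    {label_point n x0 (cover_edges V E) (cover_label l) \<phi> | \<phi>.
       circulation (cover_edges V E) (cover_tail t) (cover_head h od) \<phi> \<and> return_flow V \<phi> = 1}"
    (is "conv ?T = ?R")
proof -
  let ?C = "cover_edges V E" and ?t = "cover_tail t :: _ \<Rightarrow> 'v \<times> 'v \<times> bool" and ?h = "cover_head h od :: _ \<Rightarrow> 'v \<times> 'v \<times> bool"
  have finV: "finite V" using fin by (simp add: V_def)
  have finC: "finite ?C" using finV fin by (rule finite_cover_edges)
  note lab = label_sum_cover[OF finV fin]
  have T_carrier: "?T \<subseteq> carrier_vec n" by (auto simp: label_point_def)
  have convT_carrier: "conv ?T \<subseteq> carrier_vec n"
    by (rule conv_mono_convex[OF T_carrier convex_vec_carrier])
  have odd_in: "label_point n x0 E l f \<in> conv ?T" if "odd_circulation E t h od f" for f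
    by (rule hull_inc, unfold mem_Collect_eq, rule exI[of _ f]) (simp add: that)

  have T_sub: "?T \<subseteq> ?R"
  proof
    fix x assume "x \<in> ?T"
    then obtain f where x: "x = label_point n x0 E l f" and "odd_circulation E t h od f"
      unfolding mem_Collect_eq by (elim exE conjE)
    then have f: "circulation E t h f" "\<And>e. f e \<in> \<int>" "odd_real (odd_weight E od f)"
      by (simp_all add: odd_circulation_def)
    obtain es where es: "dicycle E t h es" "odd_real (odd_weight E od (cycle_flow es))"
        "\<forall>e. cycle_flow es e \<le> f e"
      using odd_circulation_contains_odd_dicycle[OF f(1) fin f(2,3)] by (elim exE conjE)
    have c: "circulation E t h (cycle_flow es)" by (rule circulation_cycle_flow[OF es(1) fin])
    have rest: "circulation E t h (\<lambda>e. f e + (- 1) * cycle_flow es e)"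
      unfolding circulation_def
    proof (intro conjI allI impI)
      show "0 \<le> f e + - 1 * cycle_flow es e" for e using spec[OF es(3), of e] by simp
      show "f e + - 1 * cycle_flow es e = 0" if "e \<notin> E" for e
        using that f(1) c by (simp add: circulation_def)
      show "balanced E t h (\<lambda>e. f e + - 1 * cycle_flow es e)"
        using f(1) c by (intro balanced_add) (simp_all add: circulation_def)
    qed
    obtain \<phi> where \<phi>: "circulation ?C ?t ?h \<phi>" "return_flow V \<phi> = 1" "cover_proj V \<phi> = cycle_flow es"
      using lift_odd_dicycle[OF fin finV _ es(1,2)] by (auto simp: V_def)
    have "es ! 0 \<in> E" using es(1) by (cases es) (auto simp: dicycle_def)
    then have uV: "t (es ! 0) \<in> V" by (simp add: V_def)
    obtain \<phi>' where \<phi>': "circulation ?C ?t ?h \<phi>'" "return_flow V \<phi>' = 0"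
        "cover_proj V \<phi>' = (\<lambda>e. f e + (- 1) * cycle_flow es e)"
      using lift_circulation[OF fin finV uV rest, of od] by (elim exE conjE)
    define \<theta> where "\<theta> = (\<lambda>x. \<phi> x + 1 * \<phi>' x)"
    have "circulation ?C ?t ?h \<theta>" unfolding \<theta>_def by (rule circulation_add[OF \<phi>(1) \<phi>'(1)]) simp
    moreover have "return_flow V \<theta> = 1" unfolding \<theta>_def return_flow_add \<phi>(2) \<phi>'(2) by simp
    moreover have "cover_proj V \<theta> = f" unfolding \<theta>_def cover_proj_add[abs_def] \<phi>(3) \<phi>'(3) by simp
    then have "x = label_point n x0 ?C (cover_label l) \<theta>"
      unfolding x label_point_def lab by simp
    ultimately show "x \<in> ?R" unfolding mem_Collect_eq by (intro exI[of _ \<theta>] conjI)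
  qed
  have R_convex: "convex_vec ?R"
  proof (rule convex_label_points, intro conjI)
    fix f g :: "('v, 'e) cover_edge \<Rightarrow> real" and u v :: real
    assume f: "circulation ?C ?t ?h f \<and> return_flow V f = 1" and g: "circulation ?C ?t ?h g \<and> return_flow V g = 1"
      and uv: "0 \<le> u" "0 \<le> v" "u + v = 1"
    show "circulation ?C ?t ?h (\<lambda>e. u * f e + v * g e)"
      using f g uv by (intro circulation_combination) simp_all
    have "return_flow V (\<lambda>e. u * f e + v * g e) = return_flow V (\<lambda>e. u * f e) + v * return_flow V g"
      by (rule return_flow_add)
    also have "return_flow V (\<lambda>e. u * f e) = u * return_flow V f"
      by (simp add: return_flow_def sum_distrib_left)
    finally show "return_flow V (\<lambda>e. u * f e + v * g e) = 1" using f g uv by simp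
  qed

  define rec where "rec q \<longleftrightarrow> (\<forall>p\<in>conv ?T. vec n (\<lambda>k. p $ k - q k) \<in> conv ?T)" for q :: "nat \<Rightarrow> real"
  have rec_add: "rec (\<lambda>k. q k + q' k)" if q: "rec q" and q': "rec q'" for q q'
    unfolding rec_def
  proof
    fix p assume p: "p \<in> conv ?T"
    have "vec n (\<lambda>k. vec n (\<lambda>k. p $ k - q k) $ k - q' k) \<in> conv ?T"
      using bspec[OF q'[unfolded rec_def] bspec[OF q[unfolded rec_def] p]] .
    moreover have "vec n (\<lambda>k. vec n (\<lambda>k. p $ k - q k) $ k - q' k) = vec n (\<lambda>k. p $ k - (q k + q' k))"
      by (intro eq_vecI) simp_all
    ultimately show "vec n (\<lambda>k. p $ k - (q k + q' k)) \<in> conv ?T" by simp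
  qed
  have rec_even: "rec (\<lambda>k. c * label_sum E l g k)"
    if g: "circulation E t h g" "\<And>e. g e \<in> \<int>" and even: "\<not> odd_real (odd_weight E od g)" and c: "0 \<le> c" for g c
    unfolding rec_def
  proof
    fix p assume p: "p \<in> conv ?T"
    show "vec n (\<lambda>k. p $ k - c * label_sum E l g k) \<in> conv ?T"
    proof (rule conv_recession[OF T_carrier _ p c])
      fix x j assume "x \<in> ?T"
      then obtain f where x: "x = label_point n x0 E l f" and "odd_circulation E t h od f"
        unfolding mem_Collect_eq by (elim exE conjE)
      then have f: "circulation E t h f" "\<And>e. f e \<in> \<int>" "odd_real (odd_weight E od f)"
        by (simp_all add: odd_circulation_def)
      define f' where "f' = (\<lambda>e. f e + real j * g e)"
      have "odd_weight E od f \<in> \<int>" by (rule odd_weight_Ints) (rule f(2))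
      then obtain a where a: "odd_weight E od f = of_int a" by (rule Ints_cases)
      have "odd_weight E od g \<in> \<int>" by (rule odd_weight_Ints) (rule g(2))
      then obtain b where b: "odd_weight E od g = of_int b" by (rule Ints_cases)
      note ab = a b
      have w: "odd_weight E od f' = of_int (a + int j * b)" unfolding f'_def odd_weight_add ab by simp
      have "odd a" "even b" using f(3) even unfolding ab odd_real_of_int by simp_all
      then have "odd_real (odd_weight E od f')" unfolding w odd_real_of_int by simp
      moreover have "circulation E t h f'" unfolding f'_def by (rule circulation_add[OF f(1) g(1)]) simp
      moreover have "f' e \<in> \<int>" for e
        unfolding f'_def by (intro Ints_add Ints_mult f(2) g(2)) simp
      ultimately have "odd_circulation E t h od f'" by (simp add: odd_circulation_def)
      moreover have "vec n (\<lambda>k. x $ k - real j * label_sum E l g k) = label_point n x0 E l f'"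
        unfolding x label_point_def f'_def label_sum_add by (intro eq_vecI) simp_all
      ultimately show "vec n (\<lambda>k. x $ k - real j * label_sum E l g k) \<in> ?T"
        unfolding mem_Collect_eq by (intro exI[of _ f'] conjI)
    qed
  qed
  \<comment> \<open>decompose a circulation of the cover: cycles through a return edge are odd circulations, the
    others are recession directions\<close>
  have R_sub: "?R \<subseteq> conv ?T"
  proof
    fix x assume "x \<in> ?R"
    then obtain \<phi> where x: "x = label_point n x0 ?C (cover_label l) \<phi>" and \<phi>: "circulation ?C ?t ?h \<phi>" "return_flow V \<phi> = 1"
      unfolding mem_Collect_eq by (elim exE conjE)
    let ?L = "\<lambda>\<phi>. label_sum ?C (cover_label l) \<phi>"
    have "(return_flow V \<phi> = 0 \<longrightarrow> (\<forall>a\<ge>0. rec (\<lambda>k. a * ?L \<phi> k))) \<and>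
        0 \<le> return_flow V \<phi> \<and>
        (0 < return_flow V \<phi> \<longrightarrow> vec n (\<lambda>k. x0 k - ?L \<phi> k / return_flow V \<phi>) \<in> conv ?T)"
      using \<phi>(1) finC
    proof (induction rule: circulation_induct)
      case zero
      have "rec (\<lambda>k. a * 0)" for a :: real
        unfolding rec_def
      proof
        fix p assume p: "p \<in> conv ?T"
        then show "vec n (\<lambda>k. p $ k - a * 0) \<in> conv ?T"
          using convT_carrier vec_self[of p n] by auto
      qed
      then show ?case by (simp add: label_sum_zero return_flow_def)
    next
      case (add f c es e0)
      let ?g = "\<lambda>x. f x + c * cycle_flow es x"
      define \<tau> where "\<tau> = return_flow V f"
      define g where "g = cover_proj V (cycle_flow es)"
      have cf: "circulation ?C ?t ?h (cycle_flow es)" by (rule circulation_cycle_flow[OF add.hyps(2) finC])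
      have gcirc: "circulation E t h g" unfolding g_def by (rule circulation_cover_proj[OF finV fin cf])
      have gint: "g e \<in> \<int>" for e
        unfolding g_def cover_proj_def by (intro Ints_sum Ints_add cycle_flow_Ints)
      define m where "m = (\<Sum>u\<in>V. \<Sum>e\<in>E. cycle_flow es (u, Some (e, True)) * of_bool (od e))"
      have "m \<in> \<int>" unfolding m_def by (intro Ints_sum Ints_mult cycle_flow_Ints) simp
      then obtain m' where m': "m = of_int m'" by (rule Ints_cases)
      have gw: "odd_weight E od g = return_flow V (cycle_flow es) + 2 * of_int m'"
        unfolding g_def odd_weight_cover_proj[OF finV fin cf] m'[symmetric] m_def ..
      have Lg: "?L ?g k = ?L f k + c * label_sum E l g k" for k
        unfolding label_sum_add by (simp add: lab g_def)
      have \<tau>: "0 \<le> \<tau>" using add.IH by (simp add: \<tau>_def)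
      have c: "0 < c" by (rule add.hyps(3))
      from return_flow_cycle[OF finV add.hyps(2)] show ?case
      proof
        assume r: "return_flow V (cycle_flow es) = 0"
        have w: "odd_weight E od g = of_int (2 * m')" using gw r by simp
        have even: "\<not> odd_real (odd_weight E od g)" unfolding w odd_real_of_int by simp
        have rg: "return_flow V ?g = \<tau>" unfolding return_flow_add r \<tau>_def by simp
        have "rec (\<lambda>k. a * ?L ?g k)" if a: "0 \<le> a" and "\<tau> = 0" for a
        proof -
          have "rec (\<lambda>k. a * ?L f k)" using add.IH that by (simp add: \<tau>_def)
          moreover have "rec (\<lambda>k. (a * c) * label_sum E l g k)"
            using a c by (intro rec_even[OF gcirc gint even]) simp
          ultimately have "rec (\<lambda>k. a * ?L f k + (a * c) * label_sum E l g k)" by (rule rec_add)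
          moreover have "a * ?L f k + (a * c) * label_sum E l g k = a * ?L ?g k" for k
            unfolding Lg by (simp add: algebra_simps)
          ultimately show ?thesis by simp
        qed
        moreover have "vec n (\<lambda>k. x0 k - ?L ?g k / \<tau>) \<in> conv ?T" if pos: "0 < \<tau>"
        proof -
          let ?p = "vec n (\<lambda>k. x0 k - ?L f k / \<tau>)"
          have "?p \<in> conv ?T" using add.IH pos by (simp add: \<tau>_def)
          moreover have "rec (\<lambda>k. (c / \<tau>) * label_sum E l g k)"
            using c pos by (intro rec_even[OF gcirc gint even]) simp
          ultimately have "vec n (\<lambda>k. ?p $ k - (c / \<tau>) * label_sum E l g k) \<in> conv ?T"
            unfolding rec_def by (rule bspec[rotated])
          moreover have "vec n (\<lambda>k. ?p $ k - (c / \<tau>) * label_sum E l g k) = vec n (\<lambda>k. x0 k - ?L ?g k / \<tau>)"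
            unfolding Lg by (intro eq_vecI) (simp_all add: add_divide_distrib)
          ultimately show ?thesis by simp
        qed
        ultimately show ?case unfolding rg using \<tau> by simp
      next
        assume r: "return_flow V (cycle_flow es) = 1"
        have w: "odd_weight E od g = of_int (1 + 2 * m')" using gw r by simp
        have "odd_real (odd_weight E od g)" unfolding w odd_real_of_int by simp
        then have "odd_circulation E t h od g" using gcirc gint by (simp add: odd_circulation_def)
        then have pg: "label_point n x0 E l g \<in> conv ?T" by (rule odd_in)
        have rg: "return_flow V ?g = \<tau> + c" unfolding return_flow_add r \<tau>_def by simp
        have "vec n (\<lambda>k. x0 k - ?L ?g k / (\<tau> + c)) \<in> conv ?T"
        proof (cases "\<tau> = 0")
          case True
          then have rec_f: "\<forall>a\<ge>0. rec (\<lambda>k. a * ?L f k)" using add.IH by (simp add: \<tau>_def)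
          have "rec (\<lambda>k. (1 / c) * ?L f k)" by (rule rec_f[rule_format]) (use c in simp)
          then have "vec n (\<lambda>k. label_point n x0 E l g $ k - (1 / c) * ?L f k) \<in> conv ?T"
            using pg unfolding rec_def by (rule bspec)
          moreover have "vec n (\<lambda>k. label_point n x0 E l g $ k - (1 / c) * ?L f k) = vec n (\<lambda>k. x0 k - ?L ?g k / (\<tau> + c))"
            unfolding Lg using True c by (intro eq_vecI) (simp_all add: label_point_def add_divide_distrib)
          ultimately show ?thesis by simp
        next
          case False
          then have pos: "0 < \<tau>" using \<tau> by simp
          have "vec n (\<lambda>k. x0 k - ?L f k / \<tau>) \<in> conv ?T" using add.IH pos by (simp add: \<tau>_def)
          then have "vec n (\<lambda>k. \<tau> / (\<tau> + c) * (x0 k - ?L f k / \<tau>) + c / (\<tau> + c) * (x0 k - label_sum E l g k)) \<in> conv ?T"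
            using pg pos c unfolding label_point_def
            by (intro convex_vecD_fun[OF convex_vec_conv]) (simp_all add: add_divide_distrib[symmetric])
          moreover have "\<tau> / (\<tau> + c) * (x0 k - ?L f k / \<tau>) + c / (\<tau> + c) * (x0 k - label_sum E l g k)
              = x0 k - ?L ?g k / (\<tau> + c)" for k
          proof -
            have "\<tau> * (x0 k - ?L f k / \<tau>) = \<tau> * x0 k - ?L f k" using pos by (simp add: right_diff_distrib)
            then have "\<tau> * (x0 k - ?L f k / \<tau>) + c * (x0 k - label_sum E l g k) = (\<tau> + c) * x0 k - ?L ?g k"
              unfolding Lg by (simp add: algebra_simps)
            then have "(\<tau> * (x0 k - ?L f k / \<tau>) + c * (x0 k - label_sum E l g k)) / (\<tau> + c) = x0 k - ?L ?g k / (\<tau> + c)"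
              using pos c by (simp add: diff_divide_distrib)
            then show ?thesis by (simp add: add_divide_distrib)
          qed
          ultimately show ?thesis by simp
        qed
        then show ?case unfolding rg using \<tau> c by simp
      qed
    qed
    then show "x \<in> conv ?T" using \<phi>(2) by (simp add: x label_point_def)
  qed
  show ?thesis
    using conv_mono_convex[OF T_sub R_convex] R_sub by (rule subset_antisym)
qed

section \<open>Rank of rows and linear dependence\<close>

text \<open>Suppose that some \<open>z\<close> is orthogonal to \<open>X\<close> but not to the new member \<open>a i\<close>. Subtracting a multiple of
\<open>a i\<close> from \<open>b\<close>, and of \<open>z\<close> from the separating vector, reduces the claim to \<open>X\<close>. If there is no
such \<open>z\<close>, then \<open>a i\<close> adds nothing to the span of \<open>X\<close>.\<close>

lemma in_span_or_separated:
  fixes a :: "'i \<Rightarrow> nat \<Rightarrow> 'a :: field"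
  assumes "finite X"
  shows "(\<exists>c. \<forall>k<n. b k = (\<Sum>j\<in>X. c j * a j k)) \<or>
    (\<exists>x. (\<forall>j\<in>X. (\<Sum>k<n. a j k * x k) = 0) \<and> (\<Sum>k<n. b k * x k) \<noteq> 0)"
  using assms
proof (induction X arbitrary: b rule: finite_induct)
  case empty
  show ?case
  proof (cases "\<forall>k<n. b k = 0")
    case True
    then show ?thesis by simp
  next
    case False
    then obtain k where k: "k < n" "b k \<noteq> 0" by blast
    have "(\<Sum>i<n. b i * (if i = k then 1 else 0)) = b k"
      using k by (simp add: if_distrib[of "\<lambda>z. _ * z"] cong: if_cong)
    then show ?thesis using k by (intro disjI2 exI[of _ "\<lambda>i. if i = k then 1 else 0"]) simp
  qed
next
  case (insert i X)
  show ?case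
  proof (cases "\<exists>z. (\<forall>j\<in>X. (\<Sum>k<n. a j k * z k) = 0) \<and> (\<Sum>k<n. a i k * z k) \<noteq> 0")
    case False
    then obtain c where c: "\<forall>k<n. a i k = (\<Sum>j\<in>X. c j * a j k)" using insert.IH[of "a i"] by blast
    have orth: "(\<Sum>k<n. a i k * x k) = 0" if "\<forall>j\<in>X. (\<Sum>k<n. a j k * x k) = 0" for x
      using False that by blast
    consider d where "\<forall>k<n. b k = (\<Sum>j\<in>X. d j * a j k)"
      | x where "\<forall>j\<in>X. (\<Sum>k<n. a j k * x k) = 0" "(\<Sum>k<n. b k * x k) \<noteq> 0"
      using insert.IH[of b] by blast
    then show ?thesis
    proof cases
      case (1 d)
      have "(\<Sum>j\<in>insert i X. (if j = i then 0 else d j) * a j k) = (\<Sum>j\<in>X. d j * a j k)" for k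
        using insert.hyps by (simp, intro sum.cong) auto
      then show ?thesis using 1 by (intro disjI1 exI[of _ "\<lambda>j. if j = i then 0 else d j"]) simp
    next
      case (2 x)
      then show ?thesis using orth by (intro disjI2 exI[of _ x]) auto
    qed
  next
    case True
    then obtain z where z: "\<forall>j\<in>X. (\<Sum>k<n. a j k * z k) = 0" "(\<Sum>k<n. a i k * z k) \<noteq> 0"
      by (elim exE conjE)
    define az where "az = (\<Sum>k<n. a i k * z k)"
    define r where "r = (\<Sum>k<n. b k * z k) / az"
    define b' where "b' k = b k - r * a i k" for k
    consider d where "\<forall>k<n. b' k = (\<Sum>j\<in>X. d j * a j k)"
      | x where "\<forall>j\<in>X. (\<Sum>k<n. a j k * x k) = 0" "(\<Sum>k<n. b' k * x k) \<noteq> 0"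
      using insert.IH[of b'] by blast
    then show ?thesis
    proof cases
      case (1 d)
      have "(\<Sum>j\<in>insert i X. (if j = i then r else d j) * a j k) = r * a i k + (\<Sum>j\<in>X. d j * a j k)" for k
        using insert.hyps by (simp, intro sum.cong) auto
      then show ?thesis using 1
        by (intro disjI1 exI[of _ "\<lambda>j. if j = i then r else d j"]) (simp add: b'_def algebra_simps)
    next
      case (2 x)
      define s where "s = (\<Sum>k<n. a i k * x k) / az"
      define x' where "x' k = x k - s * z k" for k
      have lin: "(\<Sum>k<n. v k * x' k) = (\<Sum>k<n. v k * x k) - s * (\<Sum>k<n. v k * z k)" for v
        by (simp add: x'_def algebra_simps sum_subtractf sum_distrib_left)
      have "(\<Sum>k<n. b' k * x k) = (\<Sum>k<n. b k * x k) - r * (\<Sum>k<n. a i k * x k)"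
        by (simp add: b'_def algebra_simps sum_subtractf sum_distrib_left)
      also have "r * (\<Sum>k<n. a i k * x k) = s * (\<Sum>k<n. b k * z k)"
        by (simp add: r_def s_def)
      finally have "(\<Sum>k<n. b k * x' k) \<noteq> 0" using 2(2) lin[of b] by simp
      moreover have "\<forall>j\<in>insert i X. (\<Sum>k<n. a j k * x' k) = 0"
        using 2(1) z unfolding lin by (auto simp: s_def az_def)
      ultimately show ?thesis by (intro disjI2 exI[of _ x']) simp
    qed
  qed
qed

lemma rational_common_denominator:
  fixes x :: "nat \<Rightarrow> rat"
  shows "\<exists>d :: int. d > 0 \<and> (\<forall>k<n. \<exists>z :: int. of_int d * x k = of_int z)"
proof (induction n)
  case 0
  show ?case by (intro exI[of _ 1]) simp
next
  case (Suc n)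
  then obtain d where d: "d > 0" "\<forall>k<n. \<exists>z :: int. of_int d * x k = of_int z" by blast
  obtain p q where pq: "quotient_of (x n) = (p, q)" by (cases "quotient_of (x n)")
  have q: "q > 0" "x n = of_int p / of_int q"
    using quotient_of_denom_pos[OF pq] quotient_of_div[OF pq] by simp_all
  have "\<exists>z :: int. of_int (d * q) * x k = of_int z" if k: "k < Suc n" for k
  proof (cases "k = n")
    case True
    have "of_int (d * q) * x n = of_int (d * p)" using q by simp
    then show ?thesis using True by blast
  next
    case False
    then have "k < n" using k by simp
    then obtain z where z: "of_int d * x k = of_int z" using d(2) by auto
    have "of_int (d * q) * x k = of_int q * (of_int d * x k)" by simp
    also have "\<dots> = of_int (q * z)" unfolding z by simp
    finally show ?thesis by blast
  qed
  then show ?case using d q by (intro exI[of _ "d * q"]) simp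
qed

text \<open>The alternative is applied over the rationals, so that clearing denominators gives an integer
\<open>x\<close>. This matters later: the generators of the cone have to be rational.\<close>

lemma integer_row_dependent_or_separated:
  fixes a :: "'i \<Rightarrow> nat \<Rightarrow> int"
  assumes fin: "finite X"
  shows "(\<exists>c :: 'i \<Rightarrow> real. \<forall>k<n. of_int (b k) = (\<Sum>j\<in>X. c j * of_int (a j k))) \<or>
    (\<exists>x :: nat \<Rightarrow> int. (\<forall>j\<in>X. (\<Sum>k<n. a j k * x k) = 0) \<and> (\<Sum>k<n. b k * x k) \<noteq> 0)"
proof -
  consider c :: "'i \<Rightarrow> rat" where "\<forall>k<n. of_int (b k) = (\<Sum>j\<in>X. c j * of_int (a j k))"
    | x :: "nat \<Rightarrow> rat" where "\<forall>j\<in>X. (\<Sum>k<n. of_int (a j k) * x k) = 0" "(\<Sum>k<n. of_int (b k) * x k) \<noteq> 0"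
    using in_span_or_separated[OF fin, of n "\<lambda>k. of_int (b k) :: rat" "\<lambda>j k. of_int (a j k)"] by blast
  then show ?thesis
  proof cases
    case (1 c)
    have "real_of_int (b k) = (\<Sum>j\<in>X. of_rat (c j) * of_int (a j k))" if "k < n" for k
    proof -
      have "real_of_int (b k) = of_rat (of_int (b k))" by simp
      also have "\<dots> = of_rat (\<Sum>j\<in>X. c j * of_int (a j k))" using 1 that by simp
      also have "\<dots> = (\<Sum>j\<in>X. of_rat (c j) * of_int (a j k))" by (simp add: of_rat_sum of_rat_mult)
      finally show ?thesis .
    qed
    then show ?thesis by (intro disjI1 exI[of _ "\<lambda>j. of_rat (c j)"]) simp
  next
    case (2 x)
    obtain d :: int where d: "d > 0" "\<forall>k<n. \<exists>z :: int. of_int d * x k = of_int z"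
      using rational_common_denominator[of n x] by blast
    then have "\<forall>k\<in>{..<n}. \<exists>z :: int. of_int d * x k = of_int z" by simp
    from bchoice[OF this] obtain y :: "nat \<Rightarrow> int"
      where "\<forall>k\<in>{..<n}. of_int d * x k = of_int (y k)" by (elim exE)
    then have y: "k < n \<Longrightarrow> of_int d * x k = of_int (y k)" for k by simp
    have conv: "of_int (\<Sum>k<n. v k * y k) = of_int d * (\<Sum>k<n. of_int (v k) * x k)" for v
    proof -
      have "of_int (\<Sum>k<n. v k * y k) = (\<Sum>k<n. of_int (v k) * (of_int d * x k))"
        using y by simp
      then show ?thesis by (simp add: sum_distrib_left mult.left_commute)
    qed
    have "(\<Sum>k<n. a j k * y k) = 0" if "j \<in> X" for j
    proof -
      have "rat_of_int (\<Sum>k<n. a j k * y k) = 0" unfolding conv using 2(1) that by simp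
      then show ?thesis by (simp only: of_int_eq_0_iff)
    qed
    moreover have "(\<Sum>k<n. b k * y k) \<noteq> 0"
    proof
      assume "(\<Sum>k<n. b k * y k) = 0"
      then have "of_int d * (\<Sum>k<n. of_int (b k) * x k) = 0" unfolding conv[symmetric] by (simp only: of_int_0)
      then show False using 2(2) d(1) by simp
    qed
    ultimately show ?thesis by (intro disjI2 exI[of _ y]) simp
  qed
qed

lemma bij_betw_pick:
  assumes "finite J"
  shows "bij_betw (pick J) {..<card J} J"
proof -
  have "inj_on (pick J) {..<card J}"
    by (rule inj_onI) (metis card_pick lessThan_iff)
  moreover have "pick J ` {..<card J} \<subseteq> J" using pick_in_set by auto
  ultimately show ?thesis
    using assms by (intro bij_betw_imageI card_subset_eq) (auto simp: card_image)
qed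

text \<open>The rank function of the column matroid of the transpose, where a column is a row of \<open>A\<close>.\<close>

definition row_rank :: "int mat \<Rightarrow> nat set \<Rightarrow> nat" where
  "row_rank A J = mat_rank (submatrix (map_mat real_of_int A\<^sup>T) UNIV J)"

context
  fixes A :: "int mat" and m n :: nat
  assumes A: "A \<in> carrier_mat m n"
begin

interpretation V: vec_space "TYPE(real)" n .

abbreviation (input) At where "At \<equiv> map_mat real_of_int A\<^sup>T"

lemma submatrix_carrier:
  assumes J: "J \<subseteq> {..<m}"
  shows "submatrix At UNIV J \<in> carrier_mat n (card J)"
proof -
  have "{j. j < m \<and> j \<in> J} = J" using J by auto
  then show ?thesis using A by (intro carrier_matI) (simp_all add: dim_submatrix)
qed

lemma submatrix_entry:
  assumes J: "J \<subseteq> {..<m}" and "k < n" "i < card J"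
  shows "submatrix At UNIV J $$ (k, i) = of_int (A $$ (pick J i, k))"
proof -
  have "{j. j < m \<and> j \<in> J} = J" using J by auto
  moreover have "pick J i < m" using J assms(3) pick_in_set[of i J] by auto
  ultimately show ?thesis using A assms by (subst submatrix_index) (simp_all add: pick_UNIV)
qed

lemma mult_submatrix:
  assumes J: "J \<subseteq> {..<m}"
  shows "submatrix At UNIV J *\<^sub>v vec (card J) (\<lambda>i. c (pick J i)) = vec n (\<lambda>k. \<Sum>j\<in>J. c j * of_int (A $$ (j, k)))"
proof (rule eq_vecI)
  have finJ: "finite J" using J by (rule finite_subset) simp
  fix k assume k: "k < dim_vec (vec n (\<lambda>k. \<Sum>j\<in>J. c j * real_of_int (A $$ (j, k))))"
  then have "(submatrix At UNIV J *\<^sub>v vec (card J) (\<lambda>i. c (pick J i))) $ k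
      = (\<Sum>i<card J. of_int (A $$ (pick J i, k)) * c (pick J i))"
    using submatrix_carrier[OF J] submatrix_entry[OF J] by (simp add: scalar_prod_def atLeast0LessThan)
  also have "\<dots> = (\<Sum>j\<in>J. of_int (A $$ (j, k)) * c j)"
    using sum.reindex_bij_betw[OF bij_betw_pick[OF finJ], of "\<lambda>j. of_int (A $$ (j, k)) * c j"] .
  finally show "(submatrix At UNIV J *\<^sub>v vec (card J) (\<lambda>i. c (pick J i))) $ k
      = vec n (\<lambda>k. \<Sum>j\<in>J. c j * of_int (A $$ (j, k))) $ k" using k by (simp add: mult.commute)
qed (use submatrix_carrier[OF J] in simp)

lemma cols_submatrix:
  assumes J: "J \<subseteq> {..<m}"
  shows "set (cols (submatrix At UNIV J)) = (\<lambda>j. vec n (\<lambda>k. of_int (A $$ (j, k)))) ` J"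
proof -
  have finJ: "finite J" using J by (rule finite_subset) simp
  have c: "submatrix At UNIV J \<in> carrier_mat n (card J)" by (rule submatrix_carrier[OF J])
  have col: "col (submatrix At UNIV J) i = vec n (\<lambda>k. of_int (A $$ (pick J i, k)))" if "i < card J" for i
    using that c submatrix_entry[OF J] by (intro eq_vecI) (simp_all add: col_def)
  have "set (cols (submatrix At UNIV J)) = (\<lambda>i. col (submatrix At UNIV J) i) ` {..<card J}"
    using c by (auto simp: cols_def)
  also have "\<dots> = (\<lambda>j. vec n (\<lambda>k. of_int (A $$ (j, k)))) ` (pick J ` {..<card J})"
    unfolding image_image by (rule image_cong[OF refl]) (simp add: col)
  also have "pick J ` {..<card J} = J" using bij_betw_pick[OF finJ] by (simp add: bij_betw_def)
  finally show ?thesis .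
qed

lemma row_rank_eq:
  assumes J: "J \<subseteq> {..<m}"
  shows "row_rank A J = V.rank (submatrix At UNIV J)"
  using submatrix_carrier[OF J] by (simp add: row_rank_def mat_rank_def)

lemma row_rank_insert_dependent:
  assumes J: "J \<subseteq> {..<m}" and e: "e < m"
    and dep: "\<forall>k<n. real_of_int (A $$ (e, k)) = (\<Sum>j\<in>J. c j * of_int (A $$ (j, k)))"
  shows "row_rank A (insert e J) = row_rank A J"
proof -
  let ?M = "submatrix At UNIV J" and ?M' = "submatrix At UNIV (insert e J)"
  let ?v = "vec n (\<lambda>k. real_of_int (A $$ (e, k)))"
  have J': "insert e J \<subseteq> {..<m}" using J e by simp
  have c: "?M \<in> carrier_mat n (card J)" by (rule submatrix_carrier[OF J])
  have "?v = ?M *\<^sub>v vec (card J) (\<lambda>i. c (pick J i))"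
    unfolding mult_submatrix[OF J] using dep by (intro eq_vecI) simp_all
  then have "?v \<in> V.col_space ?M"
    using c unfolding V.col_space_eq[OF c] by (auto intro!: bexI[of _ "vec (card J) (\<lambda>i. c (pick J i))"])
  then have v: "?v \<in> V.span (set (cols ?M))" by (simp add: V.col_space_def)
  have "set (cols ?M) \<subseteq> carrier_vec n" using c cols_dim by blast
  then have "V.span (set (cols ?M)) = V.span (set (cols ?M) \<union> {?v})"
    using v by (intro V.already_in_span) simp_all
  also have "set (cols ?M) \<union> {?v} = set (cols ?M')"
    unfolding cols_submatrix[OF J] cols_submatrix[OF J'] by simp
  finally show ?thesis unfolding row_rank_eq[OF J] row_rank_eq[OF J'] V.rank_def by simp
qed

text \<open>A maximal independent set of the columns for \<open>J\<close> is orthogonal to \<open>x\<close>, so it stays independent when the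
column for \<open>e\<close> is added.\<close>

lemma row_rank_insert_separated:
  assumes J: "J \<subseteq> {..<m}" and e: "e < m"
    and x: "\<forall>j\<in>J. (\<Sum>k<n. A $$ (j, k) * x k) = 0" "(\<Sum>k<n. A $$ (e, k) * x k) \<noteq> 0"
  shows "row_rank A J < row_rank A (insert e J)"
proof -
  let ?M = "submatrix At UNIV J" and ?M' = "submatrix At UNIV (insert e J)"
  let ?v = "vec n (\<lambda>k. real_of_int (A $$ (e, k)))"
  let ?x = "vec n (\<lambda>k. real_of_int (x k))"
  have J': "insert e J \<subseteq> {..<m}" using J e by simp
  have c: "?M \<in> carrier_mat n (card J)" and c': "?M' \<in> carrier_mat n (card (insert e J))"
    by (rule submatrix_carrier[OF J], rule submatrix_carrier[OF J'])
  have finJ: "finite J" using J by (rule finite_subset) simp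
  have sub: "set (cols ?M) \<subseteq> carrier_vec n" using c cols_dim by blast
  have cols': "set (cols ?M') = insert ?v (set (cols ?M))"
    unfolding cols_submatrix[OF J] cols_submatrix[OF J'] by simp
  obtain S where S: "maximal S (\<lambda>T. T \<subseteq> set (cols ?M) \<and> V.lin_indpt T)"
    using maximal_exists_superset[of "set (cols ?M)" "\<lambda>T. T \<subseteq> set (cols ?M) \<and> V.lin_indpt T" "{}"]
      V.finite_lin_indpt2[of "{}"] by auto
  then have Ssub: "S \<subseteq> set (cols ?M)" and Sind: "V.lin_indpt S" by (auto simp: maximal_def)
  have prod: "vec n (\<lambda>k. of_int (a k)) \<bullet> ?x = of_int (\<Sum>k<n. a k * x k)" for a
    by (simp add: scalar_prod_def atLeast0LessThan)
  have "v \<bullet> ?x = 0" if v: "v \<in> V.span (set (cols ?M))" for v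
  proof -
    have "v \<in> V.col_space ?M" using v by (simp add: V.col_space_def)
    then obtain y where y: "y \<in> carrier_vec (card J)" "v = ?M *\<^sub>v y"
      using c unfolding V.col_space_eq[OF c] by auto
    have "v \<bullet> ?x = (\<Sum>k<n. (\<Sum>i<card J. of_int (A $$ (pick J i, k)) * y $ i) * of_int (x k))"
      unfolding y(2) using y(1) c submatrix_entry[OF J]
      by (simp add: scalar_prod_def atLeast0LessThan)
    also have "\<dots> = (\<Sum>i<card J. y $ i * of_int (\<Sum>k<n. A $$ (pick J i, k) * x k))"
      unfolding of_int_sum sum_distrib_left sum_distrib_right by (subst sum.swap) (simp add: mult_ac)
    also have "\<dots> = 0"
    proof (intro sum.neutral ballI)
      fix i assume "i \<in> {..<card J}"
      then have "pick J i \<in> J" by (intro pick_in_set) simp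
      then show "y $ i * of_int (\<Sum>k<n. A $$ (pick J i, k) * x k) = 0" using x(1) by simp
    qed
    finally show ?thesis .
  qed
  moreover have "?v \<bullet> ?x \<noteq> 0" unfolding prod using x(2) by (simp only: of_int_eq_0_iff not_False_eq_True)
  ultimately have "?v \<notin> V.span (set (cols ?M))" by blast
  then have nin: "?v \<notin> V.span S" using V.span_is_monotone[OF Ssub] by blast
  have "?v \<notin> S" using nin V.in_own_span[of S] Ssub sub by auto
  moreover have "S \<subseteq> carrier_vec n" using Ssub sub by blast
  ultimately have ind: "V.lin_indpt (S \<union> {?v})"
    using V.lin_dep_iff_in_span[of S ?v] Sind nin by simp
  have "finite S" using Ssub finite_subset by blast
  then have "row_rank A J + 1 = card (S \<union> {?v})"
    unfolding row_rank_eq[OF J] V.rank_card_indpt[OF c S] using \<open>?v \<notin> S\<close> by simp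
  also have "\<dots> \<le> V.rank ?M'"
    using ind Ssub by (intro V.rank_ge_card_indpt[OF c']) (auto simp: cols')
  finally show ?thesis unfolding row_rank_eq[OF J'] by simp
qed

lemma row_rank_le_card: "J \<subseteq> {..<m} \<Longrightarrow> row_rank A J \<le> card J"
  unfolding row_rank_eq by (rule V.rank_le_nc[OF submatrix_carrier])

end

section \<open>Cycles, forests and potentials\<close>

definition forest_rank :: "('v, 'e) multigraph \<Rightarrow> 'e set \<Rightarrow> nat" where
  "forest_rank H X = Max (card ` {F. F \<subseteq> X \<and> is_forest H F})"

lemma is_forest_empty: "is_forest H {}"
  by (auto simp: is_forest_def is_cycle_def)

lemma is_forest_subset: "is_forest H F \<Longrightarrow> F' \<subseteq> F \<Longrightarrow> is_forest H F'"
  unfolding is_forest_def by (meson subset_trans)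

lemma forest_rank_ge:
  assumes "finite X" "F \<subseteq> X" "is_forest H F"
  shows "card F \<le> forest_rank H X"
  unfolding forest_rank_def using assms by (intro Max_ge) auto

lemma forest_rank_attained:
  assumes "finite X"
  obtains F where "F \<subseteq> X" "is_forest H F" "card F = forest_rank H X"
proof -
  have "forest_rank H X \<in> card ` {F. F \<subseteq> X \<and> is_forest H F}"
    unfolding forest_rank_def using assms is_forest_empty by (intro Max_in) auto
  then show thesis using that by auto
qed

lemma forest_rank_le:
  assumes "finite X" "\<And>F. F \<subseteq> X \<Longrightarrow> is_forest H F \<Longrightarrow> card F \<le> k"
  shows "forest_rank H X \<le> k"
  using forest_rank_attained[OF assms(1)] assms(2) by metis

lemma is_cycleD:
  assumes "is_cycle H vs es"
  shows "length vs = length es" "0 < length es" "distinct vs" "distinct es" "set es \<subseteq> edges H"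
    "i < length es \<Longrightarrow> ends H (es ! i) = {vs ! i, vs ! (Suc i mod length es)}"
  using assms by (auto simp: is_cycle_def)

lemma cycle_ends_card:
  assumes c: "is_cycle H vs es" and len: "2 \<le> length es" and i: "i < length es"
  shows "card (ends H (es ! i)) = 2"
proof -
  have "Suc i mod length es \<noteq> i" using len i by (auto simp: mod_Suc)
  moreover have "Suc i mod length es < length es"
    by (rule mod_less_divisor[OF is_cycleD(2)[OF c]])
  ultimately have "vs ! i \<noteq> vs ! (Suc i mod length es)"
    using is_cycleD[OF c] i by (simp add: nth_eq_iff_index_eq)
  then show ?thesis using is_cycleD(6)[OF c i] by simp
qed

lemma cycle_length_ge_2:
  assumes c: "is_cycle H vs es" and j: "j \<in> set es" "card (ends H j) = 2"
  shows "2 \<le> length es"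
proof (rule ccontr)
  assume "\<not> ?thesis"
  then have len: "length es = 1" using is_cycleD(2)[OF c] by linarith
  then have "j = es ! 0" using j(1) by (auto simp: in_set_conv_nth)
  then have "ends H j = {vs ! 0, vs ! 0}" using is_cycleD(6)[OF c, of 0] len by simp
  then show False using j(2) by simp
qed

text \<open>A cycle enters and leaves each of its vertices by different edges.\<close>

lemma cycle_second_edge:
  assumes c: "is_cycle H vs es" and len: "2 \<le> length es" and j: "j \<in> set es" and v: "v \<in> ends H j"
  shows "\<exists>d\<in>set es. d \<noteq> j \<and> v \<in> ends H d \<and> card (ends H d) = 2"
proof -
  let ?n = "length es"
  obtain i where i: "i < ?n" "j = es ! i" using j by (auto simp: in_set_conv_nth)
  have dist: "es ! k \<noteq> es ! i" if "k < ?n" "k \<noteq> i" for k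
    using that i is_cycleD(4)[OF c] by (simp add: nth_eq_iff_index_eq)
  have "v = vs ! i \<or> v = vs ! (Suc i mod ?n)" using v i is_cycleD(6)[OF c] by auto
  then show ?thesis
  proof
    assume v: "v = vs ! i"
    define p where "p = (if i = 0 then ?n - 1 else i - 1)"
    have p: "p < ?n" "Suc p mod ?n = i" "p \<noteq> i" using i len by (auto simp: p_def)
    then have "v \<in> ends H (es ! p)" using is_cycleD(6)[OF c p(1)] v by simp
    then show ?thesis using p dist cycle_ends_card[OF c len p(1)] i by (intro bexI[of _ "es ! p"]) auto
  next
    assume v: "v = vs ! (Suc i mod ?n)"
    define p where "p = Suc i mod ?n"
    have p: "p < ?n" "p \<noteq> i" using i len by (auto simp: p_def mod_Suc)
    then have "v \<in> ends H (es ! p)" using is_cycleD(6)[OF c p(1)] v by (simp add: p_def)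
    then show ?thesis using p dist cycle_ends_card[OF c len p(1)] i by (intro bexI[of _ "es ! p"]) auto
  qed
qed

text \<open>A cycle through \<open>j\<close> would use a second edge at \<open>v\<close>.\<close>

lemma is_forest_insert_pendant:
  assumes F: "is_forest H F" and j: "j \<in> edges H" "card (ends H j) = 2" "v \<in> ends H j"
    and v: "\<And>d. d \<in> F \<Longrightarrow> v \<in> ends H d \<Longrightarrow> card (ends H d) \<noteq> 2"
  shows "is_forest H (insert j F)"
  unfolding is_forest_def
proof (intro conjI notI)
  show "insert j F \<subseteq> edges H" using F j by (simp add: is_forest_def)
  assume "\<exists>vs es. is_cycle H vs es \<and> set es \<subseteq> insert j F"
  then obtain vs es where c: "is_cycle H vs es" and sub: "set es \<subseteq> insert j F" by blast
  have js: "j \<in> set es" using F c sub unfolding is_forest_def by blast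
  obtain d where "d \<in> set es" "d \<noteq> j" "v \<in> ends H d" "card (ends H d) = 2"
    using cycle_second_edge[OF c cycle_length_ge_2[OF c js j(2)] js j(3)] by blast
  then show False using v sub by blast
qed

text \<open>A cycle inside another one contains, with each edge, also the next edge of the larger cycle, because
its second edge at their common vertex can only be that one.\<close>

lemma cycle_minus_edge_is_forest:
  assumes c: "is_cycle H vs es" and e: "e \<in> set es"
  shows "is_forest H (set es - {e})"
  unfolding is_forest_def
proof (intro conjI notI)
  show "set es - {e} \<subseteq> edges H" using is_cycleD(5)[OF c] by blast
  assume "\<exists>vs' es'. is_cycle H vs' es' \<and> set es' \<subseteq> set es - {e}"
  then obtain vs' es' where c': "is_cycle H vs' es'" and sub: "set es' \<subseteq> set es - {e}" by blast
  let ?n = "length es"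
  have ne: "es' ! 0 \<in> set es'" using is_cycleD(2)[OF c'] by simp
  have n: "2 \<le> ?n"
  proof (rule ccontr)
    assume "\<not> ?thesis"
    then have "?n = 1" using is_cycleD(2)[OF c] by linarith
    then obtain d where "es = [d]" by (auto simp: length_Suc_conv)
    then have "set es - {e} = {}" using e by simp
    then show False using ne sub by blast
  qed
  have card2: "card (ends H d) = 2" if "d \<in> set es" for d
    using cycle_ends_card[OF c n] that by (auto simp: in_set_conv_nth)
  have n': "2 \<le> length es'"
    using cycle_length_ge_2[OF c' ne card2] ne sub by blast
  have step: "es ! (Suc i mod ?n) \<in> set es'" if i: "i < ?n" "es ! i \<in> set es'" for i
  proof -
    define v where "v = vs ! (Suc i mod ?n)"
    have "v \<in> ends H (es ! i)" using is_cycleD(6)[OF c i(1)] by (simp add: v_def)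
    then obtain d where d: "d \<in> set es'" "d \<noteq> es ! i" "v \<in> ends H d"
      using cycle_second_edge[OF c' n' i(2)] by blast
    have "d \<in> set es" using d(1) sub by blast
    then obtain l where l: "l < ?n" "d = es ! l" unfolding in_set_conv_nth by blast
    have "v = vs ! l \<or> v = vs ! (Suc l mod ?n)" using d(3) l is_cycleD(6)[OF c l(1)] by auto
    moreover have "Suc l mod ?n < ?n" "Suc i mod ?n < ?n"
      by (rule mod_less_divisor[OF is_cycleD(2)[OF c]])+
    ultimately have "Suc i mod ?n = l \<or> Suc i mod ?n = Suc l mod ?n"
      using is_cycleD(1,3)[OF c] l(1) unfolding v_def by (auto simp: nth_eq_iff_index_eq)
    moreover have "l \<noteq> i" using d(2) l(2) by blast
    then have "Suc i mod ?n \<noteq> Suc l mod ?n" using l(1) i(1) by (auto simp: mod_Suc split: if_splits)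
    ultimately show ?thesis using d(1) l(2) by simp
  qed
  have "es' ! 0 \<in> set es" using ne sub by blast
  then obtain i0 where i0: "i0 < ?n" "es ! i0 = es' ! 0" unfolding in_set_conv_nth by blast
  have all: "es ! ((i0 + k) mod ?n) \<in> set es'" for k
  proof (induction k)
    case 0
    then show ?case using i0 ne by simp
  next
    case (Suc k)
    have "(i0 + k) mod ?n < ?n" by (rule mod_less_divisor[OF is_cycleD(2)[OF c]])
    from step[OF this Suc] show ?case by (simp add: mod_Suc_eq)
  qed
  obtain i where i: "i < ?n" "es ! i = e" using e by (auto simp: in_set_conv_nth)
  have "(i0 + (?n - i0 + i)) mod ?n = i" using i0(1) i(1) by simp
  then have "e \<in> set es'" using all[of "?n - i0 + i"] i(2) by simp
  then show False using sub by blast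
qed

lemma loop_not_in_forest:
  assumes F: "is_forest H F" and j: "j \<in> F" and v: "ends H j = {v}"
  shows False
proof -
  have "j \<in> edges H" using F j by (auto simp: is_forest_def)
  then have "is_cycle H [v] [j]" using v by (simp add: is_cycle_def)
  moreover have "set [j] \<subseteq> F" using j by simp
  ultimately show False using F unfolding is_forest_def by blast
qed

text \<open>A shortest walk has no repeated vertices, so together with an edge joining its ends it is a
  cycle.\<close>

lemma cycle_from_walk:
  assumes uv: "(u, v) \<in> {(a, b). \<exists>d\<in>F. ends H d = {a, b}}\<^sup>*" "u \<noteq> v"
    and F: "F \<subseteq> edges H" and j: "j \<in> edges H" "j \<notin> F" "ends H j = {u, v}"
  shows "\<exists>vs es. is_cycle H vs es \<and> set es \<subseteq> insert j F"
proof -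
  define R where "R = {(a, b). \<exists>d\<in>F. ends H d = {a, b}}"
  have ex: "\<exists>k. (u, v) \<in> R ^^ k" using uv(1) rtrancl_imp_relpow unfolding R_def by blast
  define k where "k = (LEAST k. (u, v) \<in> R ^^ k)"
  have "(u, v) \<in> R ^^ k" unfolding k_def by (rule LeastI_ex[OF ex])
  then obtain p where p: "p 0 = u" "p k = v" "\<forall>i<k. (p i, p (Suc i)) \<in> R"
    unfolding relpow_fun_conv by blast
  have k: "0 < k" using p uv(2) by (cases k) auto
  have sub_walk: "(p a, p (a + l)) \<in> R ^^ l" if "a + l \<le> k" for a l
    unfolding relpow_fun_conv using that p(3) by (intro exI[of _ "\<lambda>i. p (a + i)"]) simp
  have "p a \<noteq> p b" if ab: "a < b" "b \<le> k" for a b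
  proof
    assume eq: "p a = p b"
    have "(u, p a) \<in> R ^^ a" using sub_walk[of 0 a] ab p(1) by simp
    moreover have "(p b, v) \<in> R ^^ (k - b)" using sub_walk[of b "k - b"] ab p(2) by simp
    ultimately have "(u, v) \<in> R ^^ (a + (k - b))" unfolding relpow_add using eq by auto
    then have "k \<le> a + (k - b)" unfolding k_def by (rule Least_le)
    then show False using ab by simp
  qed
  then have pinj: "p a = p b \<longleftrightarrow> a = b" if "a \<le> k" "b \<le> k" for a b
    using that by (metis linorder_neqE_nat)
  have "\<forall>i\<in>{..<k}. \<exists>d. d \<in> F \<and> ends H d = {p i, p (Suc i)}" using p(3) by (auto simp: R_def)
  from bchoice[OF this] obtain q where q: "\<forall>i\<in>{..<k}. q i \<in> F \<and> ends H (q i) = {p i, p (Suc i)}" ..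
  have qinj: "inj_on q {0..<k}"
  proof (rule inj_onI)
    fix a b assume ab: "a \<in> {0..<k}" "b \<in> {0..<k}" "q a = q b"
    then have "{p a, p (Suc a)} = {p b, p (Suc b)}" using q by (metis lessThan_iff atLeastLessThan_iff)
    then have "(a = b \<or> a = Suc b) \<and> (Suc a = b \<or> Suc a = Suc b)"
      using ab pinj[of a b] pinj[of a "Suc b"] pinj[of "Suc a" b] pinj[of "Suc a" "Suc b"]
      by (auto simp: doubleton_eq_iff)
    then show "a = b" by auto
  qed
  define vs where "vs = map p [0..<Suc k]"
  define es where "es = map q [0..<k] @ [j]"
  have "is_cycle H vs es"
    unfolding is_cycle_def
  proof (intro conjI allI impI)
    show "es \<noteq> []" "length vs = length es" by (simp_all add: vs_def es_def)
    have "inj_on p {0..<Suc k}" by (rule inj_onI) (simp add: pinj)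
    then show "distinct vs" by (simp add: vs_def distinct_map del: upt_Suc)
    show "distinct es" using qinj q j(2) by (auto simp: es_def distinct_map)
    show "set es \<subseteq> edges H" using q F j(1) by (auto simp: es_def)
    fix i assume "i < length es"
    then have i: "i < Suc k" by (simp add: es_def)
    show "ends H (es ! i) = {vs ! i, vs ! (Suc i mod length es)}"
    proof (cases "i = k")
      case True
      then show ?thesis using j(3) p(1,2) k by (auto simp: es_def vs_def nth_append simp del: upt_Suc)
    next
      case False
      then have "i < k" using i by simp
      then show ?thesis using q by (auto simp: es_def vs_def nth_append simp del: upt_Suc)
    qed
  qed
  moreover have "set es \<subseteq> insert j F" using q by (auto simp: es_def)
  ultimately show ?thesis by blast
qed

text \<open>Growing the forest edge by edge, one rescales the component of one end of the new edge.\<close>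

lemma forest_potential:
  fixes lam :: "'v \<Rightarrow> 'e \<Rightarrow> real"
  assumes fin: "finite F" and "is_forest H F" and card2: "\<And>j. j \<in> F \<Longrightarrow> card (ends H j) = 2"
    and lam: "\<And>j v. j \<in> F \<Longrightarrow> v \<in> ends H j \<Longrightarrow> lam v j \<noteq> 0"
  shows "\<exists>\<mu>. (\<forall>v. \<mu> v \<noteq> 0) \<and> (\<forall>j\<in>F. (\<Sum>v\<in>ends H j. \<mu> v * lam v j) = 0)"
  using assms
proof (induction F rule: finite_induct)
  case empty
  show ?case by (intro exI[of _ "\<lambda>_. 1"]) simp
next
  case (insert j F)
  have F: "is_forest H F" using is_forest_subset[OF insert.prems(1)] by blast
  have "\<exists>\<mu>. (\<forall>v. \<mu> v \<noteq> 0) \<and> (\<forall>j\<in>F. (\<Sum>v\<in>ends H j. \<mu> v * lam v j) = 0)"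
    by (rule insert.IH[OF F]) (use insert.prems in auto)
  then obtain \<mu> where \<mu>: "\<forall>v. \<mu> v \<noteq> 0" "\<forall>j\<in>F. (\<Sum>v\<in>ends H j. \<mu> v * lam v j) = 0" by (elim exE conjE)
  obtain u v where uv: "ends H j = {u, v}" "u \<noteq> v"
    using insert.prems(2)[of j] by (auto simp: card_2_iff)
  define R where "R = {(a, b). \<exists>d\<in>F. ends H d = {a, b}}"
  define K where "K = {w. (u, w) \<in> R\<^sup>*}"
  have "v \<notin> K"
  proof
    assume "v \<in> K"
    then have "(u, v) \<in> {(a, b). \<exists>d\<in>F. ends H d = {a, b}}\<^sup>*" by (simp add: K_def R_def)
    from cycle_from_walk[OF this uv(2) _ _ insert.hyps(2) uv(1)]
    have "\<exists>vs es. is_cycle H vs es \<and> set es \<subseteq> insert j F"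
      using insert.prems(1) by (auto simp: is_forest_def)
    then show False using insert.prems(1) unfolding is_forest_def by blast
  qed
  have "u \<in> K" by (simp add: K_def)
  have nz: "lam u j \<noteq> 0" "lam v j \<noteq> 0" using insert.prems(3)[of j] uv(1) by auto
  \<comment> \<open>chosen so that the two terms of the new edge cancel\<close>
  define c where "c = - \<mu> v * lam v j / (\<mu> u * lam u j)"
  have c: "c \<noteq> 0" using nz \<mu>(1) by (simp add: c_def)
  define \<mu>' where "\<mu>' w = (if w \<in> K then c * \<mu> w else \<mu> w)" for w
  have "(\<Sum>w\<in>ends H d. \<mu>' w * lam w d) = 0" if d: "d \<in> insert j F" for d
  proof (cases "d = j")
    case True
    then show ?thesis using uv nz \<mu>(1) \<open>v \<notin> K\<close> \<open>u \<in> K\<close> by (simp add: \<mu>'_def c_def)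
  next
    case False
    then have dF: "d \<in> F" using d by simp
    obtain a b where ab: "ends H d = {a, b}" "a \<noteq> b"
      using insert.prems(2)[of d] dF by (auto simp: card_2_iff)
    have "(a, b) \<in> R" "(b, a) \<in> R" using dF ab(1) by (auto simp: R_def insert_commute)
    then have same: "a \<in> K \<longleftrightarrow> b \<in> K" unfolding K_def by (metis mem_Collect_eq rtrancl.rtrancl_into_rtrancl)
    have "(\<Sum>w\<in>ends H d. \<mu>' w * lam w d) = (if a \<in> K then c else 1) * (\<Sum>w\<in>ends H d. \<mu> w * lam w d)"
      using ab same by (simp add: \<mu>'_def algebra_simps)
    then show ?thesis using \<mu>(2) dF by simp
  qed
  moreover have "\<forall>w. \<mu>' w \<noteq> 0" using \<mu>(1) c by (simp add: \<mu>'_def)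
  ultimately show ?case by (intro exI[of _ \<mu>']) simp
qed

text \<open>Functions that are nonzero at single points are combined to one that is nonzero at all of them. For
each point, at most one multiple of the next function causes a cancellation.\<close>

lemma common_nonvanishing_combination:
  fixes P :: "('i \<Rightarrow> 'a :: {idom, ring_char_0}) \<Rightarrow> bool"
  assumes fin: "finite S" and zero: "P (\<lambda>_. 0)"
    and lin: "\<And>f g c. P f \<Longrightarrow> P g \<Longrightarrow> P (\<lambda>i. f i + c * g i)"
    and ex: "\<And>e. e \<in> S \<Longrightarrow> \<exists>f. P f \<and> f e \<noteq> 0"
  shows "\<exists>f. P f \<and> (\<forall>e\<in>S. f e \<noteq> 0)"
  using fin ex
proof (induction S rule: finite_induct)
  case empty
  then show ?case using zero by (intro exI[of _ "\<lambda>_. 0"]) simp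
next
  case (insert e S)
  have "\<exists>f. P f \<and> (\<forall>e\<in>S. f e \<noteq> 0)" by (rule insert.IH) (use insert.prems in auto)
  then obtain f where f: "P f" "\<forall>e\<in>S. f e \<noteq> 0" by (elim exE conjE)
  have "\<exists>f. P f \<and> f e \<noteq> 0" by (rule insert.prems) simp
  then obtain g where g: "P g" "g e \<noteq> 0" by (elim exE conjE)
  \<comment> \<open>the multiples of \<open>g\<close> that cancel \<open>f\<close> at \<open>i\<close>\<close>
  define bad where "bad i = {k :: nat. f i + of_nat k * g i = 0}" for i
  have "finite (bad i)" if i: "i \<in> insert e S" for i
  proof (cases "g i = 0")
    case True
    then have "f i \<noteq> 0" using i f(2) g(2) by auto
    then show ?thesis using True by (simp add: bad_def)
  next
    case False
    have "k = l" if "k \<in> bad i" "l \<in> bad i" for k l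
    proof -
      have "f i + of_nat k * g i = f i + of_nat l * g i" using that by (simp add: bad_def)
      then show ?thesis using False by simp
    qed
    then have "bad i = {} \<or> (\<exists>k. bad i = {k})" by blast
    then show ?thesis by auto
  qed
  then have "finite (\<Union>i\<in>insert e S. bad i)" using insert.hyps(1) by blast
  then obtain k where k: "k \<notin> (\<Union>i\<in>insert e S. bad i)" using ex_new_if_finite[OF infinite_UNIV_nat] by blast
  have "P (\<lambda>i. f i + of_nat k * g i)" by (rule lin[OF f(1) g(1)])
  moreover have "\<forall>i\<in>insert e S. f i + of_nat k * g i \<noteq> 0" using k by (simp add: bad_def)
  ultimately show ?case by (intro exI[of _ "\<lambda>i. f i + of_nat k * g i"] conjI)
qed

section \<open>Orientations of cographic matrices\<close>

text \<open>The edges of the graph are the row indices of the matrix. The rank equation is the one of the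
dual of the cycle matroid.\<close>

locale cographic_matrix =
  fixes H :: "('v, nat) multigraph" and A :: "int mat" and m n :: nat
  assumes A: "A \<in> carrier_mat m n"
    and finH: "finite_multigraph H"
    and edges: "edges H = {..<m}"
    and rank: "\<And>X. X \<subseteq> {..<m} \<Longrightarrow>
      row_rank A X = card X + forest_rank H ({..<m} - X) - forest_rank H {..<m}"
    and full: "row_rank A {..<m} = n"
begin

definition row_val :: "(nat \<Rightarrow> int) \<Rightarrow> nat \<Rightarrow> int" where
  "row_val x j = (\<Sum>k<n. A $$ (j, k) * x k)"

definition star :: "'v \<Rightarrow> nat set" where
  "star v = {j. j < m \<and> v \<in> ends H j \<and> card (ends H j) = 2}"

lemma row_val_add: "row_val (\<lambda>k. x k + c * y k) j = row_val x j + c * row_val y j"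
  by (simp add: row_val_def sum.distrib sum_distrib_left algebra_simps)

lemma row_rank_insert_cases:
  assumes "X \<subseteq> {..<m}" "e < m"
  shows "row_rank A (insert e X) = row_rank A X \<longrightarrow>
      (\<exists>c :: nat \<Rightarrow> real. \<forall>k<n. of_int (A $$ (e, k)) = (\<Sum>j\<in>X. c j * of_int (A $$ (j, k))))"
    and "row_rank A (insert e X) \<noteq> row_rank A X \<longrightarrow>
      (\<exists>x. (\<forall>j\<in>X. row_val x j = 0) \<and> row_val x e \<noteq> 0)"
proof -
  have finX: "finite X" using assms(1) by (rule finite_subset) simp
  note alt = integer_row_dependent_or_separated[OF finX, of n "\<lambda>k. A $$ (e, k)" "\<lambda>j k. A $$ (j, k)"]
  have dep: "row_rank A (insert e X) = row_rank A X"
    if ex: "\<exists>c :: nat \<Rightarrow> real. \<forall>k<n. of_int (A $$ (e, k)) = (\<Sum>j\<in>X. c j * of_int (A $$ (j, k)))"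
  proof -
    obtain c :: "nat \<Rightarrow> real" where "\<forall>k<n. of_int (A $$ (e, k)) = (\<Sum>j\<in>X. c j * of_int (A $$ (j, k)))"
      using ex by (elim exE)
    then show ?thesis by (rule row_rank_insert_dependent[OF A assms])
  qed
  have sep: "row_rank A (insert e X) \<noteq> row_rank A X"
    if ex: "\<exists>x. (\<forall>j\<in>X. row_val x j = 0) \<and> row_val x e \<noteq> 0"
  proof -
    from ex obtain x where x: "\<forall>j\<in>X. row_val x j = 0" "row_val x e \<noteq> 0" by (elim exE conjE)
    show ?thesis using row_rank_insert_separated[OF A assms x[unfolded row_val_def]] by simp
  qed
  show "row_rank A (insert e X) = row_rank A X \<longrightarrow>
      (\<exists>c :: nat \<Rightarrow> real. \<forall>k<n. of_int (A $$ (e, k)) = (\<Sum>j\<in>X. c j * of_int (A $$ (j, k))))"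
    using alt sep unfolding row_val_def by (elim disjE) simp_all
  show "row_rank A (insert e X) \<noteq> row_rank A X \<longrightarrow>
      (\<exists>x. (\<forall>j\<in>X. row_val x j = 0) \<and> row_val x e \<noteq> 0)"
    using alt dep unfolding row_val_def by (elim disjE) simp_all
qed

text \<open>An edge of the star of \<open>v\<close> extends every forest that avoids the star. Dually, its row depends on
  the other rows of the star.\<close>

lemma star_edge_dependency:
  assumes e: "e \<in> star v"
  shows "\<exists>f :: nat \<Rightarrow> real. (\<forall>j. j \<notin> star v \<longrightarrow> f j = 0) \<and>
    (\<forall>k<n. (\<Sum>j<m. f j * of_int (A $$ (j, k))) = 0) \<and> f e \<noteq> 0"
proof -
  let ?D = "star v" and ?E = "{..<m}"
  have D: "?D \<subseteq> ?E" by (auto simp: star_def)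
  have finD: "finite ?D" using D by (rule finite_subset) simp
  have De: "?D - {e} \<subseteq> ?E" using D by blast
  have em: "e < m" using e by (simp add: star_def)
  obtain F where F: "F \<subseteq> ?E - ?D" "is_forest H F" "card F = forest_rank H (?E - ?D)"
    using forest_rank_attained[of "?E - ?D" H] by auto
  have "is_forest H (insert e F)"
  proof (rule is_forest_insert_pendant[OF F(2)])
    show "e \<in> edges H" "card (ends H e) = 2" "v \<in> ends H e" using e edges by (simp_all add: star_def)
    show "card (ends H d) \<noteq> 2" if "d \<in> F" "v \<in> ends H d" for d
      using that F(1) by (auto simp: star_def)
  qed
  moreover have "insert e F \<subseteq> ?E - (?D - {e})" using F(1) em by auto
  ultimately have "card (insert e F) \<le> forest_rank H (?E - (?D - {e}))"
    by (intro forest_rank_ge) simp_all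
  moreover have "e \<notin> F" using F(1) e by blast
  moreover have "finite F" using F(1) by (rule finite_subset) simp
  ultimately have r: "forest_rank H (?E - ?D) + 1 \<le> forest_rank H (?E - (?D - {e}))"
    using F(3) by simp
  have cD: "card ?D = card (?D - {e}) + 1" using e finD by (metis Suc_eq_plus1 card_Suc_Diff1)
  have "row_rank A ?D \<le> row_rank A (?D - {e})"
    unfolding rank[OF D] rank[OF De] using r cD by (intro diff_le_mono) simp
  moreover have ins: "insert e (?D - {e}) = ?D" using e by blast
  ultimately have "\<not> row_rank A (?D - {e}) < row_rank A (insert e (?D - {e}))" by simp
  then have "\<not> (\<exists>x. (\<forall>j\<in>?D - {e}. row_val x j = 0) \<and> row_val x e \<noteq> 0)"
    using row_rank_insert_separated[OF A De em] unfolding row_val_def by blast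
  then have "row_rank A (insert e (?D - {e})) = row_rank A (?D - {e})"
    using row_rank_insert_cases(2)[OF De em] by blast
  then obtain c :: "nat \<Rightarrow> real" where c: "\<forall>k<n. of_int (A $$ (e, k)) = (\<Sum>j\<in>?D - {e}. c j * of_int (A $$ (j, k)))"
    using row_rank_insert_cases(1)[OF De em] by (elim impE exE)
  define f where "f j = (if j = e then - 1 else if j \<in> ?D then c j else 0)" for j
  have "(\<Sum>j<m. f j * of_int (A $$ (j, k))) = 0" if "k < n" for k
  proof -
    have "(\<Sum>j<m. f j * of_int (A $$ (j, k))) = (\<Sum>j\<in>?D. f j * of_int (A $$ (j, k)))"
      using D e by (intro sum.mono_neutral_right) (auto simp: f_def)
    also have "\<dots> = f e * of_int (A $$ (e, k)) + (\<Sum>j\<in>?D - {e}. f j * of_int (A $$ (j, k)))"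
      by (rule sum.remove[OF finD e])
    also have "(\<Sum>j\<in>?D - {e}. f j * of_int (A $$ (j, k))) = (\<Sum>j\<in>?D - {e}. c j * of_int (A $$ (j, k)))"
      by (rule sum.cong) (auto simp: f_def)
    also have "\<dots> = of_int (A $$ (e, k))" using c that by simp
    finally show ?thesis by (simp add: f_def)
  qed
  moreover have "\<forall>j. j \<notin> ?D \<longrightarrow> f j = 0" using e by (auto simp: f_def)
  ultimately show ?thesis by (intro exI[of _ f]) (simp add: f_def)
qed

lemma star_dependency:
  "\<exists>f :: nat \<Rightarrow> real. (\<forall>j. f j \<noteq> 0 \<longleftrightarrow> j \<in> star v) \<and> (\<forall>k<n. (\<Sum>j<m. f j * of_int (A $$ (j, k))) = 0)"
proof -
  define P where "P f \<longleftrightarrow> (\<forall>j. j \<notin> star v \<longrightarrow> f j = 0) \<and> (\<forall>k<n. (\<Sum>j<m. f j * of_int (A $$ (j, k))) = 0)"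
    for f :: "nat \<Rightarrow> real"
  have "\<exists>f. P f \<and> (\<forall>e\<in>star v. f e \<noteq> 0)"
  proof (rule common_nonvanishing_combination)
    show "finite (star v)" by (simp add: star_def)
    show "P (\<lambda>_. 0)" by (simp add: P_def)
    show "P (\<lambda>i. f i + c * g i)" if "P f" "P g" for f g c
    proof -
      have "(\<Sum>j<m. (f j + c * g j) * of_int (A $$ (j, k))) =
        (\<Sum>j<m. f j * of_int (A $$ (j, k))) + c * (\<Sum>j<m. g j * of_int (A $$ (j, k)))" for k
        unfolding sum_distrib_left sum.distrib[symmetric] by (rule sum.cong) (simp_all add: algebra_simps)
      then show ?thesis using that by (simp add: P_def)
    qed
    show "\<exists>f. P f \<and> f e \<noteq> 0" if "e \<in> star v" for e
      using star_edge_dependency[OF that] unfolding P_def conj_assoc .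
  qed
  then obtain f where "P f" "\<forall>e\<in>star v. f e \<noteq> 0" by (elim exE conjE)
  then show ?thesis unfolding P_def by (intro exI[of _ f]) auto
qed

lemma forest_rank_empty: "forest_rank H {} = 0"
  using forest_rank_le[of "{}" H 0] by auto

text \<open>Removing any edge from a cycle leaves a forest. Dually, adding any row of a cycle to the rows
  outside the cycle gives full rank, while the rows outside do not have full rank.\<close>

lemma row_rank_cycle:
  assumes c: "is_cycle H vs es" and e: "e \<in> set es"
  shows "row_rank A (insert e ({..<m} - set es)) = n" "row_rank A ({..<m} - set es) < n"
proof -
  let ?E = "{..<m}" and ?C = "set es"
  have CE: "?C \<subseteq> ?E" using is_cycleD(5)[OF c] edges by simp
  have em: "e < m" using CE e by auto
  have card_C: "card (?E - ?C) + card ?C = m" using CE by (simp add: card_Diff_subset card_mono[of "{..<m}", simplified])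
  have n: "n = m - forest_rank H ?E" using full rank[of ?E] forest_rank_empty by simp
  have rCe: "forest_rank H (?C - {e}) = card ?C - 1"
  proof (rule antisym)
    have le: "card F \<le> card (?C - {e})" if "F \<subseteq> ?C - {e}" for F by (rule card_mono[OF _ that]) simp
    show "forest_rank H (?C - {e}) \<le> card ?C - 1"
      using le e by (intro forest_rank_le) simp_all
    have "card (?C - {e}) \<le> forest_rank H (?C - {e})"
      by (rule forest_rank_ge) (use cycle_minus_edge_is_forest[OF c e] in simp_all)
    then show "card ?C - 1 \<le> forest_rank H (?C - {e})" using e by simp
  qed
  have not_full: "forest_rank H X < card X" if X: "?C \<subseteq> X" "finite X" for X
  proof -
    obtain F where F: "F \<subseteq> X" "is_forest H F" "card F = forest_rank H X"
      using forest_rank_attained[OF X(2)] by blast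
    have "F \<noteq> X" using F(2) c X(1) unfolding is_forest_def by blast
    then have "card F < card X" using F(1) X(2) by (intro psubset_card_mono) auto
    then show ?thesis using F(3) by simp
  qed
  have C1: "1 \<le> card ?C" using e by (metis One_nat_def Suc_leI card_gt_0_iff empty_iff List.finite_set)
  have rE: "forest_rank H ?E < m" using not_full[OF CE] by simp
  have rC: "forest_rank H ?C \<le> card ?C - 1" using not_full[of ?C] by simp
  have sub1: "insert e (?E - ?C) \<subseteq> ?E" using em by auto
  have "?E - insert e (?E - ?C) = ?C - {e}" using CE by auto
  moreover have "card (insert e (?E - ?C)) = card (?E - ?C) + 1" using e by simp
  ultimately have "row_rank A (insert e (?E - ?C)) = card (?E - ?C) + 1 + (card ?C - 1) - forest_rank H ?E"
    using rank[OF sub1] rCe by simp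
  also have "\<dots> = n" using card_C C1 n by simp
  finally show "row_rank A (insert e (?E - ?C)) = n" .
  have "?E - (?E - ?C) = ?C" using CE by auto
  then have "row_rank A (?E - ?C) = card (?E - ?C) + forest_rank H ?C - forest_rank H ?E"
    using rank[of "?E - ?C"] by simp
  also have "\<dots> \<le> m - 1 - forest_rank H ?E" using rC card_C C1 by (intro diff_le_mono) linarith
  also have "\<dots> < n" using rE n by linarith
  finally show "row_rank A (?E - ?C) < n" .
qed

text \<open>Each edge of the cycle is separated from the rows outside the cycle. A generic combination of the
separating vectors has the whole cycle as its support.\<close>

lemma cycle_vector:
  assumes c: "is_cycle H vs es"
  shows "\<exists>x. \<forall>j<m. row_val x j \<noteq> 0 \<longleftrightarrow> j \<in> set es"
proof -
  have CE: "set es \<subseteq> {..<m}" using is_cycleD(5)[OF c] edges by simp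
  define P where "P y \<longleftrightarrow> (\<exists>x. \<forall>j<m. y j = row_val x j) \<and> (\<forall>j<m. j \<notin> set es \<longrightarrow> y j = 0)" for y
  have "\<exists>y. P y \<and> (\<forall>e\<in>set es. y e \<noteq> 0)"
  proof (rule common_nonvanishing_combination)
    show "P (\<lambda>_. 0)" unfolding P_def by (intro conjI exI[of _ "\<lambda>_. 0"]) (simp_all add: row_val_def)
    show "P (\<lambda>i. f i + a * g i)" if f: "P f" and g: "P g" for f g a
    proof -
      obtain x where x: "\<forall>j<m. f j = row_val x j" using f unfolding P_def by (elim conjE exE)
      obtain y where y: "\<forall>j<m. g j = row_val y j" using g unfolding P_def by (elim conjE exE)
      show ?thesis using f g x y unfolding P_def
        by (intro conjI exI[of _ "\<lambda>k. x k + a * y k"]) (simp_all add: row_val_add)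
    qed
    show "\<exists>f. P f \<and> f e \<noteq> 0" if e: "e \<in> set es" for e
    proof -
      have em: "e < m" using e CE by auto
      have "row_rank A (insert e ({..<m} - set es)) \<noteq> row_rank A ({..<m} - set es)"
        using row_rank_cycle[OF c e] by simp
      then have "\<exists>x. (\<forall>j\<in>{..<m} - set es. row_val x j = 0) \<and> row_val x e \<noteq> 0"
        by (rule row_rank_insert_cases(2)[THEN mp, rotated 2]) (use em in auto)
      then obtain x where x: "\<forall>j\<in>{..<m} - set es. row_val x j = 0" "row_val x e \<noteq> 0"
        by (elim exE conjE)
      then have "P (row_val x)" unfolding P_def by (intro conjI exI[of _ x]) simp_all
      then show ?thesis using x(2) by (intro exI[of _ "row_val x"]) simp
    qed
  qed simp
  then obtain y where y: "P y" "\<forall>e\<in>set es. y e \<noteq> 0" by (elim exE conjE)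
  then obtain x where x: "\<forall>j<m. y j = row_val x j" unfolding P_def by (elim conjE exE)
  show ?thesis
  proof (intro exI[of _ x] allI impI)
    fix j assume "j < m"
    then show "row_val x j \<noteq> 0 \<longleftrightarrow> j \<in> set es" using x y unfolding P_def by metis
  qed
qed

definition real_row_val :: "(nat \<Rightarrow> real) \<Rightarrow> nat \<Rightarrow> real" where
  "real_row_val x j = (\<Sum>k<n. of_int (A $$ (j, k)) * x k)"

lemma of_int_row_val: "of_int (row_val x j) = real_row_val (\<lambda>k. of_int (x k)) j"
  by (simp add: row_val_def real_row_val_def)

lemma ends_subset: "j < m \<Longrightarrow> ends H j \<subseteq> verts H"
  and ends_card: "j < m \<Longrightarrow> card (ends H j) = 1 \<or> card (ends H j) = 2"
  and finite_ends: "j < m \<Longrightarrow> finite (ends H j)"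
  using finH edges by (auto simp: finite_multigraph_def dest: card_ge_0_finite intro: finite_subset)

text \<open>The dependencies at the two ends of an edge can be scaled to cancel: along a maximal forest by
  the choice of the potential, and on every other edge by pairing them with the vector of its
  fundamental cycle.\<close>

lemma cancelling_star_dependencies:
  "\<exists>g :: 'v \<Rightarrow> nat \<Rightarrow> real. (\<forall>v j. g v j \<noteq> 0 \<longleftrightarrow> j \<in> star v) \<and>
    (\<forall>v. \<forall>k<n. (\<Sum>j<m. g v j * of_int (A $$ (j, k))) = 0) \<and>
    (\<forall>j<m. (\<Sum>v\<in>verts H. g v j) = 0)"
proof -
  have "\<forall>v. \<exists>f :: nat \<Rightarrow> real. (\<forall>j. f j \<noteq> 0 \<longleftrightarrow> j \<in> star v) \<and> (\<forall>k<n. (\<Sum>j<m. f j * of_int (A $$ (j, k))) = 0)"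
    using star_dependency by (intro allI)
  from choice[OF this] obtain lam :: "'v \<Rightarrow> nat \<Rightarrow> real"
    where lam: "\<forall>v. (\<forall>j. lam v j \<noteq> 0 \<longleftrightarrow> j \<in> star v) \<and> (\<forall>k<n. (\<Sum>j<m. lam v j * of_int (A $$ (j, k))) = 0)" ..
  have lam_nz: "lam v j \<noteq> 0 \<longleftrightarrow> j \<in> star v" for v j using lam by (elim allE[of _ v] conjE) simp
  have lam_dep: "(\<Sum>j<m. lam v j * of_int (A $$ (j, k))) = 0" if "k < n" for v k
    using lam that by simp
  have finV: "finite (verts H)" using finH by (simp add: finite_multigraph_def)
  obtain F where F: "F \<subseteq> {..<m}" "is_forest H F" "card F = forest_rank H {..<m}"
    using forest_rank_attained[of "{..<m}" H] by auto
  have finF: "finite F" using F(1) by (rule finite_subset) simp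
  have F2: "card (ends H j) = 2" if j: "j \<in> F" for j
  proof (rule ccontr)
    assume "card (ends H j) \<noteq> 2"
    then have "card (ends H j) = 1" using ends_card[of j] j F(1) by auto
    then obtain v where "ends H j = {v}" by (auto simp: card_1_singleton_iff)
    then show False using loop_not_in_forest[OF F(2) j] by simp
  qed
  have "\<exists>\<mu>. (\<forall>v. \<mu> v \<noteq> 0) \<and> (\<forall>j\<in>F. (\<Sum>v\<in>ends H j. \<mu> v * lam v j) = 0)"
  proof (rule forest_potential[OF finF F(2) F2])
    show "lam v j \<noteq> 0" if "j \<in> F" "v \<in> ends H j" for j v
      using that F2[of j] F(1) by (auto simp: lam_nz star_def)
  qed
  then obtain \<mu> where \<mu>: "\<forall>v. \<mu> v \<noteq> 0" "\<forall>j\<in>F. (\<Sum>v\<in>ends H j. \<mu> v * lam v j) = 0" by (elim exE conjE)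
  define g where "g v j = \<mu> v * lam v j" for v j
  have g_nz: "g v j \<noteq> 0 \<longleftrightarrow> j \<in> star v" for v j using \<mu>(1) by (simp add: g_def lam_nz)
  have g_dep: "(\<Sum>j<m. g v j * of_int (A $$ (j, k))) = 0" if "k < n" for v k
    using lam_dep[OF that, of v] by (simp add: g_def mult.assoc sum_distrib_left[symmetric])
  have g_sum_ends: "(\<Sum>v\<in>verts H. g v j) = (\<Sum>v\<in>ends H j. g v j)" if "j < m" for j
    using finV ends_subset[OF that] g_nz by (intro sum.mono_neutral_right) (auto simp: star_def)
  have g_forest: "(\<Sum>v\<in>verts H. g v j) = 0" if "j \<in> F" for j
    using \<mu>(2) that F(1) g_sum_ends[of j] by (auto simp: g_def)
  have g_val: "(\<Sum>j<m. g v j * of_int (row_val x j)) = 0" for v x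
  proof -
    have "(\<Sum>j<m. g v j * of_int (row_val x j)) = (\<Sum>k<n. of_int (x k) * (\<Sum>j<m. g v j * of_int (A $$ (j, k))))"
      unfolding row_val_def of_int_sum sum_distrib_left by (subst sum.swap) (simp add: mult_ac)
    then show ?thesis using g_dep by simp
  qed
  have "(\<Sum>v\<in>verts H. g v e) = 0" if e: "e < m" for e
  proof (cases "e \<in> F")
    case True
    then show ?thesis by (rule g_forest)
  next
    case False
    have "\<not> is_forest H (insert e F)"
    proof
      assume "is_forest H (insert e F)"
      then have "card (insert e F) \<le> forest_rank H {..<m}"
        using F(1) e by (intro forest_rank_ge) simp_all
      then show False using F(3) False finF by simp
    qed
    then obtain vs es where c: "is_cycle H vs es" "set es \<subseteq> insert e F"
      using F(1) e edges unfolding is_forest_def by blast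
    have es: "e \<in> set es" using F(2) c unfolding is_forest_def by blast
    \<comment> \<open>only the chord \<open>e\<close> survives in the pairing: the forest edges cancel already\<close>
    obtain x where x: "\<forall>j<m. row_val x j \<noteq> 0 \<longleftrightarrow> j \<in> set es" using cycle_vector[OF c(1)] by (elim exE)
    have "0 = (\<Sum>v\<in>verts H. \<Sum>j<m. g v j * of_int (row_val x j))" unfolding g_val by simp
    also have "\<dots> = (\<Sum>j<m. of_int (row_val x j) * (\<Sum>v\<in>verts H. g v j))"
      unfolding sum_distrib_left by (subst sum.swap) (simp add: mult.commute)
    also have "\<dots> = (\<Sum>j\<in>{e}. of_int (row_val x j) * (\<Sum>v\<in>verts H. g v j))"
    proof (rule sum.mono_neutral_right)
      show "\<forall>j\<in>{..<m} - {e}. of_int (row_val x j) * (\<Sum>v\<in>verts H. g v j) = 0"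
      proof
        fix j assume j: "j \<in> {..<m} - {e}"
        show "of_int (row_val x j) * (\<Sum>v\<in>verts H. g v j) = 0"
        proof (cases "j \<in> set es")
          case True
          then have "j \<in> F" using c(2) j by blast
          then show ?thesis using g_forest by simp
        next
          case False
          then have "row_val x j = 0" using x j by blast
          then show ?thesis by simp
        qed
      qed
    qed (use e in auto)
    finally have "of_int (row_val x e) * (\<Sum>v\<in>verts H. g v e) = 0" by simp
    moreover have "row_val x e \<noteq> 0" using x es e by blast
    ultimately show ?thesis by simp
  qed
  then show ?thesis using g_nz g_dep by (intro exI[of _ g]) simp
qed

text \<open>So the rows, positively scaled, can be read as the edges of an orientation of the graph in such
  a way that the column space consists of circulations.\<close>

lemma cographic_orientation:
  "\<exists>(t :: nat \<Rightarrow> 'v) h \<kappa>. (\<forall>j<m. 0 < \<kappa> j) \<and>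
    (\<forall>x. balanced {..<m} t h (\<lambda>j. \<kappa> j * real_row_val x j)) \<and>
    (\<forall>es. dicycle {..<m} t h es \<longrightarrow> is_cycle H (map t es) es)"
proof -
  have finV: "finite (verts H)" using finH by (simp add: finite_multigraph_def)
  obtain g :: "'v \<Rightarrow> nat \<Rightarrow> real" where g_nz: "\<forall>v j. g v j \<noteq> 0 \<longleftrightarrow> j \<in> star v"
    and g_dep: "\<forall>v. \<forall>k<n. (\<Sum>j<m. g v j * of_int (A $$ (j, k))) = 0"
    and g_sum: "\<forall>j<m. (\<Sum>v\<in>verts H. g v j) = 0"
    using cancelling_star_dependencies by (elim exE conjE)
  define good where "good j a \<longleftrightarrow> 0 < snd (snd a) \<and> ends H j = {fst a, fst (snd a)} \<and>
      (\<forall>\<phi>. (\<Sum>v\<in>verts H. \<phi> v * g v j) = snd (snd a) * (\<phi> (fst (snd a)) - \<phi> (fst a)))"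
    for j and a :: "'v \<times> 'v \<times> real"
  have "\<exists>a. good j a" if j: "j < m" for j
  proof -
    have restrict: "(\<Sum>v\<in>verts H. \<phi> v * g v j) = (\<Sum>v\<in>ends H j. \<phi> v * g v j)" for \<phi>
      using finV ends_subset[OF j] g_nz by (intro sum.mono_neutral_right) (auto simp: star_def)
    from ends_card[OF j] show ?thesis
    proof
      assume "card (ends H j) = 1"
      then obtain v where v: "ends H j = {v}" by (auto simp: card_1_singleton_iff)
      have "j \<notin> star v" using v by (simp add: star_def)
      then have "g v j = 0" using g_nz by blast
      then have "good j (v, v, 1)" using v by (simp add: good_def restrict)
      then show ?thesis by (rule exI)
    next
      assume c2: "card (ends H j) = 2"
      then obtain u v where uv: "ends H j = {u, v}" "u \<noteq> v" by (auto simp: card_2_iff)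
      have "j \<in> star u" using uv c2 j by (simp add: star_def)
      then have gu: "g u j \<noteq> 0" using g_nz by blast
      have "(\<Sum>v\<in>verts H. g v j) = (\<Sum>v\<in>ends H j. g v j)" using restrict[of "\<lambda>_. 1"] by simp
      then have gv: "g v j = - g u j" using g_sum j uv by simp
      show ?thesis
      proof (cases "0 < g u j")
        case True
        then have "good j (v, u, g u j)" using uv gv by (auto simp: good_def restrict algebra_simps)
        then show ?thesis by (rule exI)
      next
        case False
        then have "good j (u, v, - g u j)" using uv gv gu by (auto simp: good_def restrict algebra_simps)
        then show ?thesis by (rule exI)
      qed
    qed
  qed
  then have "\<forall>j\<in>{..<m}. \<exists>a. good j a" by simp
  from bchoice[OF this] obtain a where a: "\<forall>j\<in>{..<m}. good j (a j)" ..
  define t h \<kappa> where "t j = fst (a j)" and "h j = fst (snd (a j))" and "\<kappa> j = snd (snd (a j))" for j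
  have \<kappa>: "0 < \<kappa> j" and ends: "ends H j = {t j, h j}"
    and pot: "(\<Sum>v\<in>verts H. \<phi> v * g v j) = \<kappa> j * (\<phi> (h j) - \<phi> (t j))" if "j < m" for j \<phi>
    using bspec[OF a, of j] that by (simp_all add: good_def t_def h_def \<kappa>_def)
  have "balanced {..<m} t h (\<lambda>j. \<kappa> j * real_row_val x j)" for x
    unfolding balanced_def
  proof
    fix \<phi> :: "'v \<Rightarrow> real"
    have "(\<Sum>j<m. \<kappa> j * real_row_val x j * (\<phi> (h j) - \<phi> (t j))) = (\<Sum>j<m. \<Sum>v\<in>verts H. real_row_val x j * (\<phi> v * g v j))"
    proof (rule sum.cong[OF refl])
      fix j assume "j \<in> {..<m}"
      then have "\<kappa> j * (\<phi> (h j) - \<phi> (t j)) = (\<Sum>v\<in>verts H. \<phi> v * g v j)" using pot by simp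
      then have "real_row_val x j * (\<kappa> j * (\<phi> (h j) - \<phi> (t j))) = (\<Sum>v\<in>verts H. real_row_val x j * (\<phi> v * g v j))"
        by (simp add: sum_distrib_left)
      then show "\<kappa> j * real_row_val x j * (\<phi> (h j) - \<phi> (t j)) = (\<Sum>v\<in>verts H. real_row_val x j * (\<phi> v * g v j))"
        by (simp add: mult_ac)
    qed
    also have "\<dots> = (\<Sum>v\<in>verts H. \<Sum>j<m. real_row_val x j * (\<phi> v * g v j))" by (rule sum.swap)
    also have "\<dots> = 0"
    proof (rule sum.neutral, rule ballI)
      fix v
      have "(\<Sum>j<m. real_row_val x j * (\<phi> v * g v j))
          = \<phi> v * (\<Sum>k<n. x k * (\<Sum>j<m. g v j * of_int (A $$ (j, k))))"
        unfolding real_row_val_def sum_distrib_left sum_distrib_right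
        by (subst sum.swap) (simp add: mult_ac)
      then show "(\<Sum>j<m. real_row_val x j * (\<phi> v * g v j)) = 0" using g_dep by simp
    qed
    finally show "(\<Sum>j<m. \<kappa> j * real_row_val x j * (\<phi> (h j) - \<phi> (t j))) = 0" .
  qed
  moreover have "is_cycle H (map t es) es" if es: "dicycle {..<m} t h es" for es
    unfolding is_cycle_def
  proof (intro conjI allI impI)
    show "es \<noteq> []" "distinct (map t es)" "length (map t es) = length es" using es by (simp_all add: dicycle_def)
    show "distinct es" by (rule dicycle_distinct[OF es])
    show "set es \<subseteq> edges H" using es edges by (simp add: dicycle_def)
    fix i assume i: "i < length es"
    have "set es \<subseteq> {..<m}" using es by (simp add: dicycle_def)
    then have "es ! i < m" using nth_mem[OF i] by blast
    then have "ends H (es ! i) = {t (es ! i), t (es ! (Suc i mod length es))}"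
      using es i ends by (simp add: dicycle_def)
    moreover have "Suc i mod length es < length es" using i by (intro mod_less_divisor) linarith
    ultimately show "ends H (es ! i) = {map t es ! i, map t es ! (Suc i mod length es)}" using i by simp
  qed
  ultimately show ?thesis using \<kappa> by (intro exI[of _ t] exI[of _ h] exI[of _ \<kappa>]) simp
qed

end

section \<open>Minors of absolute value at most two\<close>

lemma Ints_det_of_int:
  assumes "N \<in> carrier_mat n n"
  shows "Determinant.det (map_mat real_of_int N) \<in> \<int>"
  by (simp add: of_int_hom.hom_det)

text \<open>By Cramer's rule, this product is the determinant of an integer matrix.\<close>

lemma det_times_solution_Ints:
  fixes x :: "nat \<Rightarrow> real"
  assumes N: "N \<in> carrier_mat n n" and int: "\<And>r. r < n \<Longrightarrow> (\<Sum>j<n. of_int (N $$ (r, j)) * x j) \<in> \<int>"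
    and i: "i < n"
  shows "x i * of_int (Determinant.det N) \<in> \<int>"
proof -
  let ?N = "map_mat real_of_int N" and ?x = "vec n x"
  have prod: "(?N *\<^sub>v ?x) $ r = (\<Sum>j<n. of_int (N $$ (r, j)) * x j)" if "r < n" for r
    using N that by (simp add: scalar_prod_def atLeast0LessThan)
  define y where "y r = \<lfloor>\<Sum>j<n. of_int (N $$ (r, j)) * x j\<rfloor>" for r
  have y: "of_int (y r) = (?N *\<^sub>v ?x) $ r" if "r < n" for r
    using int[OF that] prod[OF that] by (simp add: y_def)
  have "replace_col ?N (?N *\<^sub>v ?x) i = map_mat real_of_int (mat n n (\<lambda>(r, j). if j = i then y r else N $$ (r, j)))"
    using N y by (intro eq_matI) (auto simp: replace_col_def)
  then have "Determinant.det (replace_col ?N (?N *\<^sub>v ?x) i) \<in> \<int>"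
    using Ints_det_of_int[of "mat n n (\<lambda>(r, j). if j = i then y r else N $$ (r, j))" n] by simp
  moreover have "Determinant.det (replace_col ?N (?N *\<^sub>v ?x) i) = x i * of_int (Determinant.det N)"
    using cramer_lemma_mat[of ?N n ?x i] N i by (simp add: of_int_hom.hom_det)
  ultimately show ?thesis by simp
qed

text \<open>Otherwise a suitable multiple of \<open>x\<close> would contradict Cramer's rule.\<close>

lemma det_solution_zero:
  fixes x :: "nat \<Rightarrow> real"
  assumes N: "N \<in> carrier_mat n n" and det: "Determinant.det N \<noteq> 0"
    and zero: "\<And>r. r < n \<Longrightarrow> (\<Sum>j<n. of_int (N $$ (r, j)) * x j) = 0" and i: "i < n"
  shows "x i = 0"
proof (rule ccontr)
  assume x: "x i \<noteq> 0"
  \<comment> \<open>scaled so that the product in Cramer's rule is one half\<close>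
  define s where "s = 1 / (2 * x i * of_int (Determinant.det N))"
  have "(\<Sum>j<n. of_int (N $$ (r, j)) * (s * x j)) = s * (\<Sum>j<n. of_int (N $$ (r, j)) * x j)" for r
    by (simp add: sum_distrib_left mult.left_commute)
  then have "(\<Sum>j<n. of_int (N $$ (r, j)) * (s * x j)) \<in> \<int>" if "r < n" for r
    using zero[OF that] by simp
  from det_times_solution_Ints[OF N this i] have "s * x i * of_int (Determinant.det N) \<in> \<int>" by simp
  moreover have "s * x i * of_int (Determinant.det N) = 1 / 2" using x det by (simp add: s_def)
  ultimately have "(1 / 2 :: real) \<in> \<int>" by simp
  then obtain k where "(1 / 2 :: real) = of_int k" by (rule Ints_cases)
  then have "of_int (2 * k) = (1 :: real)" by simp
  then have "2 * k = 1" by (simp only: of_int_eq_1_iff)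
  then show False by presburger
qed

text \<open>Exchanging a column for a fractional solution \<open>z\<close> halves a determinant of absolute value two.
  So with \<open>z\<close> added to the lattice, the matrix becomes unimodular.\<close>

lemma det_le_2_solutions:
  fixes x z :: "nat \<Rightarrow> real"
  assumes N: "N \<in> carrier_mat n n" and det: "Determinant.det N \<noteq> 0" "\<bar>Determinant.det N\<bar> \<le> 2"
    and z: "\<And>r. r < n \<Longrightarrow> (\<Sum>j<n. of_int (N $$ (r, j)) * z j) \<in> \<int>" "\<not> (\<forall>k<n. z k \<in> \<int>)"
    and x: "\<And>r. r < n \<Longrightarrow> (\<Sum>j<n. of_int (N $$ (r, j)) * x j) \<in> \<int>"
  shows "\<forall>k<n. 2 * z k \<in> \<int>" and "(\<forall>k<n. x k \<in> \<int>) \<or> (\<forall>k<n. x k - z k \<in> \<int>)"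
proof -
  obtain i where i: "i < n" "z i \<notin> \<int>" using z(2) by blast
  have det2: "\<bar>Determinant.det N\<bar> = 2"
  proof (rule ccontr)
    assume "\<not> ?thesis"
    then have "Determinant.det N = 1 \<or> Determinant.det N = - 1" using det by linarith
    moreover have "z i * of_int (Determinant.det N) \<in> \<int>" by (rule det_times_solution_Ints[OF N z(1) i(1)])
    ultimately show False using i(2) by auto
  qed
  then have detN: "Determinant.det N = 2 \<or> Determinant.det N = - 2" by linarith
  have two_z: "2 * z k \<in> \<int>" if "k < n" for k
    using det_times_solution_Ints[OF N z(1) that] detN by (auto simp: mult.commute)
  then show "\<forall>k<n. 2 * z k \<in> \<int>" by blast
  obtain p where p: "2 * z i = of_int p" using two_z[OF i(1)] by (rule Ints_cases)
  have "odd p"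
  proof
    assume "even p"
    then obtain q where "p = 2 * q" by (rule evenE)
    then have "z i = of_int q" using p by simp
    then show False using i(2) by simp
  qed
  then obtain q where q: "p = 2 * q + 1" by (rule oddE)
  have zi: "z i = of_int q + 1 / 2" using p q by simp
  \<comment> \<open>shift \<open>z\<close> by an integer vector so that the coordinate \<open>i\<close> becomes one half\<close>
  define z' where "z' k = (if k = i then 1 / 2 else z k)" for k
  have sum_split: "(\<Sum>j<n. of_int (N $$ (r, j)) * f j) =
      of_int (N $$ (r, i)) * f i + (\<Sum>j\<in>{..<n} - {i}. of_int (N $$ (r, j)) * f j)" for r and f :: "nat \<Rightarrow> real"
    using i(1) by (intro sum.remove) simp_all
  have rest: "(\<Sum>j\<in>{..<n} - {i}. of_int (N $$ (r, j)) * z' j) = (\<Sum>j\<in>{..<n} - {i}. of_int (N $$ (r, j)) * z j)" for r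
    by (rule sum.cong) (auto simp: z'_def)
  have Nz': "(\<Sum>j<n. of_int (N $$ (r, j)) * z' j) = (\<Sum>j<n. of_int (N $$ (r, j)) * z j) - of_int (N $$ (r, i) * q)" for r
    unfolding sum_split rest using zi by (simp add: z'_def algebra_simps)
  have Nz'_int: "(\<Sum>j<n. of_int (N $$ (r, j)) * z' j) \<in> \<int>" if "r < n" for r
    unfolding Nz' using z(1)[OF that] by (intro Ints_diff) simp_all
  define y where "y r = \<lfloor>\<Sum>j<n. of_int (N $$ (r, j)) * z' j\<rfloor>" for r
  have y: "of_int (y r) = (\<Sum>j<n. of_int (N $$ (r, j)) * z' j)" if "r < n" for r
    using Nz'_int[OF that] by (simp add: y_def)
  define N' where "N' = mat n n (\<lambda>(r, j). if j = i then y r else N $$ (r, j))"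
  have N': "N' \<in> carrier_mat n n" by (simp add: N'_def)
  have "replace_col (map_mat real_of_int N) (map_mat real_of_int N *\<^sub>v vec n z') i = map_mat real_of_int N'"
    using N y by (intro eq_matI) (auto simp: replace_col_def N'_def scalar_prod_def atLeast0LessThan)
  then have "of_int (Determinant.det N') = z' i * of_int (Determinant.det N)"
    using cramer_lemma_mat[of "map_mat real_of_int N" n "vec n z'" i] N i(1) by (simp add: of_int_hom.hom_det)
  then have detN': "real_of_int (Determinant.det N') = 1 \<or> real_of_int (Determinant.det N') = - 1"
    using detN by (auto simp: z'_def)
  \<comment> \<open>the coordinates of \<open>x\<close> in the basis in which \<open>z'\<close> replaces the unit vector \<open>i\<close>\<close>
  define c where "c j = (if j = i then 2 * x i else x j - 2 * x i * z' j)" for j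
  have "(\<Sum>j<n. of_int (N' $$ (r, j)) * c j) \<in> \<int>" if r: "r < n" for r
  proof -
    have "(\<Sum>j<n. of_int (N' $$ (r, j)) * c j) =
        of_int (N' $$ (r, i)) * c i + (\<Sum>j\<in>{..<n} - {i}. of_int (N' $$ (r, j)) * c j)"
      using i(1) by (intro sum.remove) simp_all
    also have "of_int (N' $$ (r, i)) * c i = 2 * x i * (\<Sum>j<n. of_int (N $$ (r, j)) * z' j)"
      using y[OF r] r i(1) by (simp add: N'_def c_def)
    also have "(\<Sum>j\<in>{..<n} - {i}. of_int (N' $$ (r, j)) * c j)
        = (\<Sum>j\<in>{..<n} - {i}. of_int (N $$ (r, j)) * x j - 2 * x i * (of_int (N $$ (r, j)) * z' j))"
      using r by (intro sum.cong) (auto simp: N'_def c_def algebra_simps)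
    also have "\<dots> = (\<Sum>j\<in>{..<n} - {i}. of_int (N $$ (r, j)) * x j)
        - 2 * x i * (\<Sum>j\<in>{..<n} - {i}. of_int (N $$ (r, j)) * z' j)"
      by (simp add: sum_subtractf sum_distrib_left)
    also have "2 * x i * (\<Sum>j<n. of_int (N $$ (r, j)) * z' j) + \<dots> = (\<Sum>j<n. of_int (N $$ (r, j)) * x j)"
      unfolding sum_split[of r z'] sum_split[of r x] by (simp add: z'_def algebra_simps)
    finally show ?thesis using x[OF r] by simp
  qed
  then have "c k * of_int (Determinant.det N') \<in> \<int>" if "k < n" for k
    by (rule det_times_solution_Ints[OF N' _ that])
  then have cint: "c k \<in> \<int>" if "k < n" for k
    using that detN' by auto
  obtain ci where ci: "2 * x i = of_int ci" using cint[OF i(1)] unfolding c_def by (auto elim: Ints_cases)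
  have diff: "x k - of_int ci * z k \<in> \<int>" if k: "k < n" for k
  proof (cases "k = i")
    case True
    have "x i - of_int ci * z i = of_int (- ci * q)" unfolding zi using ci by (simp add: algebra_simps)
    then show ?thesis using True by simp
  next
    case False
    then show ?thesis using cint[OF k] ci by (simp add: c_def z'_def)
  qed
  show "(\<forall>k<n. x k \<in> \<int>) \<or> (\<forall>k<n. x k - z k \<in> \<int>)"
  proof (cases "even ci")
    case True
    then obtain d where d: "ci = 2 * d" by (rule evenE)
    have "x k \<in> \<int>" if k: "k < n" for k
    proof -
      have "x k = (x k - of_int ci * z k) + of_int d * (2 * z k)" using d by simp
      then show ?thesis using diff[OF k] two_z[OF k] by (metis Ints_add Ints_mult Ints_of_int)
    qed
    then show ?thesis by blast
  next
    case False
    then obtain d where d: "ci = 2 * d + 1" by (rule oddE)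
    have "x k - z k \<in> \<int>" if k: "k < n" for k
    proof -
      have "x k - z k = (x k - of_int ci * z k) + of_int d * (2 * z k)" using d by (simp add: algebra_simps)
      then show ?thesis using diff[OF k] two_z[OF k] by (metis Ints_add Ints_mult Ints_of_int)
    qed
    then show ?thesis by blast
  qed
qed

context cographic_matrix
begin

text \<open>Scaled and collected, the vectors in the last condition form the inverse of the submatrix.\<close>

definition row_basis :: "nat set \<Rightarrow> bool" where
  "row_basis I \<longleftrightarrow> I \<subseteq> {..<m} \<and> card I = n \<and> Determinant.det (submatrix A\<^sup>T {..<n} I) \<noteq> 0 \<and>
     (\<forall>e\<in>I. \<exists>x. (\<forall>j\<in>I - {e}. row_val x j = 0) \<and> row_val x e \<noteq> 0)"

lemma minor_carrier:
  assumes "I \<subseteq> {..<m}" "card I = n"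
  shows "submatrix A\<^sup>T {..<n} I \<in> carrier_mat n n"
    and "map_mat real_of_int (submatrix A\<^sup>T {..<n} I) = submatrix (map_mat real_of_int A\<^sup>T) UNIV I"
    and "k < n \<Longrightarrow> i < n \<Longrightarrow> submatrix A\<^sup>T {..<n} I $$ (k, i) = A $$ (pick I i, k)"
proof -
  have I: "{j. j < m \<and> j \<in> I} = I" using assms(1) by auto
  have r: "{k. k < n \<and> k \<in> {..<n}} = {..<n}" by auto
  show c: "submatrix A\<^sup>T {..<n} I \<in> carrier_mat n n"
    using A assms(2) I r by (intro carrier_matI) (simp_all add: dim_submatrix)
  have pick_n: "pick {..<n} k = k" if "k < n" for k
  proof -
    have "{a \<in> {..<n}. a < k} = {..<k}" using that by auto
    then show ?thesis using pick_card_in_set[of k "{..<n}"] that by simp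
  qed
  show entry: "submatrix A\<^sup>T {..<n} I $$ (k, i) = A $$ (pick I i, k)" if "k < n" "i < n" for k i
  proof -
    have "pick I i < m" using assms that pick_in_set[of i I] by auto
    then show ?thesis using A assms(2) I r that pick_n by (subst submatrix_index) simp_all
  qed
  show "map_mat real_of_int (submatrix A\<^sup>T {..<n} I) = submatrix (map_mat real_of_int A\<^sup>T) UNIV I"
    using c submatrix_carrier[OF A assms(1)] entry submatrix_entry[OF A assms(1)] assms(2)
    by (intro eq_matI) auto
qed

text \<open>A smallest set of rows of full rank is independent, so it has \<open>n\<close> elements.\<close>

lemma row_basis_exists:
  assumes X: "X \<subseteq> {..<m}" and r: "row_rank A X = n"
  shows "\<exists>I\<subseteq>X. row_basis I"
proof -
  have finX: "finite X" using X by (rule finite_subset) simp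
  define \<I> where "\<I> = {I. I \<subseteq> X \<and> row_rank A I = n}"
  have "finite \<I>" "X \<in> \<I>" using finX r by (simp_all add: \<I>_def)
  then obtain I where I: "I \<in> \<I>" "\<forall>J\<in>\<I>. \<not> card J < card I"
    using ex_min_if_finite[of "card ` \<I>"] by auto
  then have IX: "I \<subseteq> X" and rI: "row_rank A I = n" by (simp_all add: \<I>_def)
  have Im: "I \<subseteq> {..<m}" using IX X by blast
  have finI: "finite I" using IX finX by (rule finite_subset)
  have sep: "\<exists>x. (\<forall>j\<in>I - {e}. row_val x j = 0) \<and> row_val x e \<noteq> 0" if e: "e \<in> I" for e
  proof -
    have "card (I - {e}) < card I" using finI e by (rule card_Diff1_less)
    then have "I - {e} \<notin> \<I>" using I(2) by blast
    then have "row_rank A (I - {e}) \<noteq> n" using IX by (auto simp: \<I>_def)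
    moreover have "insert e (I - {e}) = I" using e by blast
    ultimately have ne: "row_rank A (insert e (I - {e})) \<noteq> row_rank A (I - {e})" using rI by simp
    show ?thesis
      by (rule row_rank_insert_cases(2)[THEN mp, OF _ _ ne]) (use Im e in auto)
  qed
  have "card J \<le> row_rank A J" if "J \<subseteq> I" for J
    using finite_subset[OF that finI] that
  proof (induction J rule: finite_induct)
    case (insert e J)
    have "e \<in> I" using insert.prems by blast
    from sep[OF this] obtain x where x: "\<forall>j\<in>I - {e}. row_val x j = 0" "row_val x e \<noteq> 0"
      by (elim exE conjE)
    have "\<forall>j\<in>J. row_val x j = 0" using x(1) insert.prems insert.hyps by blast
    moreover have "J \<subseteq> {..<m}" "e < m" using Im insert.prems \<open>e \<in> I\<close> by auto
    ultimately have "row_rank A J < row_rank A (insert e J)"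
      using x(2) unfolding row_val_def by (intro row_rank_insert_separated[OF A])
    then show ?case using insert by simp
  qed simp
  from this[of I] have "card I = n" using rI row_rank_le_card[OF A Im] by simp
  moreover have "Determinant.det (submatrix A\<^sup>T {..<n} I) \<noteq> 0"
  proof -
    interpret V: vec_space "TYPE(real)" n .
    have sq: "submatrix (map_mat real_of_int A\<^sup>T) UNIV I \<in> carrier_mat n n"
      using submatrix_carrier[OF A Im] \<open>card I = n\<close> by simp
    have "Determinant.det (submatrix (map_mat real_of_int A\<^sup>T) UNIV I) \<noteq> 0"
      unfolding V.det_rank_iff[OF sq] using rI unfolding row_rank_eq[OF A Im] .
    then have "Determinant.det (map_mat real_of_int (submatrix A\<^sup>T {..<n} I)) \<noteq> 0"
      unfolding minor_carrier(2)[OF Im \<open>card I = n\<close>] .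
    then show ?thesis by (simp add: of_int_hom.hom_det)
  qed
  ultimately have "row_basis I" using Im sep by (simp add: row_basis_def)
  then show ?thesis using IX by blast
qed

text \<open>The transposed submatrix maps \<open>x\<close> to its row values on the basis, which makes the statements on
solutions of square systems applicable.\<close>

lemma row_basis_matrix:
  assumes I: "row_basis I"
  obtains N where "N \<in> carrier_mat n n" "Determinant.det N = Determinant.det (submatrix A\<^sup>T {..<n} I)"
    "\<forall>r<n. \<forall>x. \<exists>j\<in>I. (\<Sum>k<n. of_int (N $$ (r, k)) * x k) = real_row_val x j"
proof
  have I': "I \<subseteq> {..<m}" "card I = n" using I by (simp_all add: row_basis_def)
  let ?N = "(submatrix A\<^sup>T {..<n} I)\<^sup>T"
  show "?N \<in> carrier_mat n n" using minor_carrier(1)[OF I'] by simp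
  show "Determinant.det ?N = Determinant.det (submatrix A\<^sup>T {..<n} I)"
    by (rule det_transpose[OF minor_carrier(1)[OF I']])
  show "\<forall>r<n. \<forall>x. \<exists>j\<in>I. (\<Sum>k<n. of_int (?N $$ (r, k)) * x k) = real_row_val x j"
  proof (intro allI impI)
    fix r and x :: "nat \<Rightarrow> real" assume r: "r < n"
    have "pick I r \<in> I" using r I'(2) by (intro pick_in_set) simp
    moreover have "(\<Sum>k<n. of_int (?N $$ (r, k)) * x k) = real_row_val x (pick I r)"
      unfolding real_row_val_def using r minor_carrier[OF I'] by (intro sum.cong) auto
    ultimately show "\<exists>j\<in>I. (\<Sum>k<n. of_int (?N $$ (r, k)) * x k) = real_row_val x j" by blast
  qed
qed

end

section \<open>Integer hulls with an integral apex\<close>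

lemma label_points_reduce:
  assumes red: "reduces_to E t h l E' t' h' l'"
  shows "{label_point n x0 E l f | f. circulation E t h f} = {label_point n x0 E' l' f | f. circulation E' t' h' f}"
    (is "?L = ?R")
proof (intro equalityI subsetI)
  fix x assume "x \<in> ?L"
  then obtain f where f: "x = label_point n x0 E l f" "circulation E t h f"
    unfolding mem_Collect_eq by (elim exE conjE)
  obtain f' where f': "circulation E' t' h' f'" "label_sum E' l' f' = label_sum E l f"
    using reduces_toD(2)[OF red f(2)] by (elim exE conjE)
  then show "x \<in> ?R" using f(1) unfolding mem_Collect_eq label_point_def
    by (intro exI[of _ f'] conjI) simp_all
next
  fix x assume "x \<in> ?R"
  then obtain f' where f': "x = label_point n x0 E' l' f'" "circulation E' t' h' f'"
    unfolding mem_Collect_eq by (elim exE conjE)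
  obtain f where f: "circulation E t h f" "label_sum E l f = label_sum E' l' f'"
    using reduces_toD(3)[OF red f'(2)] by (elim exE conjE)
  then show "x \<in> ?L" using f'(1) unfolding mem_Collect_eq label_point_def
    by (intro exI[of _ f] conjI) simp_all
qed

text \<open>With \<open>k + 1\<close> vertices and \<open>2 k\<close> edges, the cover has \<open>(k + 1) (4 k + 1)\<close> edges and at most
\<open>2 (k + 1)\<^sup>2\<close> vertices. Every vertex equation, the normalisation and each of the \<open>k\<close> coordinate equations count
twice.\<close>

definition size_bound :: "nat \<Rightarrow> nat" where
  "size_bound k = 8 * k\<^sup>2 + 15 * k + 7"

text \<open>The outcome of \<open>cographic_orientation\<close>, with the orientation and the factors fixed.\<close>

locale oriented_cographic_matrix = cographic_matrix H A m n
  for H :: "('v, nat) multigraph" and A m n +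
  fixes t h :: "nat \<Rightarrow> 'v" and \<kappa> :: "nat \<Rightarrow> real"
  assumes \<kappa>_pos: "\<And>j. j < m \<Longrightarrow> 0 < \<kappa> j"
    and balanced_rows: "\<And>x. balanced {..<m} t h (\<lambda>j. \<kappa> j * real_row_val x j)"
    and dicycle_is_cycle: "\<And>es. dicycle {..<m} t h es \<Longrightarrow> is_cycle H (map t es) es"
begin

lemma real_row_val_add: "real_row_val (\<lambda>k. x k + c * y k) j = real_row_val x j + c * real_row_val y j"
  by (simp add: real_row_val_def sum.distrib sum_distrib_left algebra_simps)

lemma real_row_val_scale: "real_row_val (\<lambda>k. c * x k) j = c * real_row_val x j"
  using real_row_val_add[of "\<lambda>_. 0" c x j] by (simp add: real_row_val_def)

lemma real_row_val_diff: "real_row_val (\<lambda>k. x k - y k) j = real_row_val x j - real_row_val y j"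
  using real_row_val_add[of x "- 1" y j] by simp

lemma real_row_val_cong: "(\<And>k. k < n \<Longrightarrow> x k = y k) \<Longrightarrow> real_row_val x j = real_row_val y j"
  by (simp add: real_row_val_def)

lemma real_row_val_sum:
  "real_row_val (\<lambda>k. \<Sum>i\<in>S. c i * x i k) j = (\<Sum>i\<in>S. c i * real_row_val (x i) j)"
  unfolding real_row_val_def sum_distrib_left by (subst sum.swap) (simp add: mult_ac)

text \<open>The inverse of the square submatrix of a basis \<open>I\<close>, with zero rows outside \<open>I\<close>.\<close>

lemma row_basis_labels:
  assumes I: "row_basis I"
  obtains l :: "nat \<Rightarrow> nat \<Rightarrow> real"
  where "\<forall>x. \<forall>k<n. x k = (\<Sum>j<m. real_row_val x j * l j k)"
    and "\<forall>j. \<forall>i\<in>I. real_row_val (l j) i \<in> \<int>"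
proof -
  have Im: "I \<subseteq> {..<m}" and det: "Determinant.det (submatrix A\<^sup>T {..<n} I) \<noteq> 0"
    and sep: "\<forall>e\<in>I. \<exists>x. (\<forall>j\<in>I - {e}. row_val x j = 0) \<and> row_val x e \<noteq> 0"
    using I by (simp_all add: row_basis_def)
  from bchoice[OF sep] obtain X
    where X: "\<forall>e\<in>I. (\<forall>j\<in>I - {e}. row_val (X e) j = 0) \<and> row_val (X e) e \<noteq> 0" ..
  define l where "l e k = (if e \<in> I then (1 / of_int (row_val (X e) e)) * of_int (X e k) else 0 :: real)" for e k
  have unit: "real_row_val (l j) i = of_bool (j = i)" if i: "i \<in> I" for i j
  proof (cases "j \<in> I")
    case True
    then have lj: "l j = (\<lambda>k. (1 / of_int (row_val (X j) j)) * of_int (X j k))" by (simp add: l_def fun_eq_iff)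
    have "real_row_val (l j) i = (1 / of_int (row_val (X j) j)) * of_int (row_val (X j) i)"
      unfolding lj real_row_val_scale by (simp only: of_int_row_val)
    then show ?thesis using X True i by (cases "j = i") auto
  next
    case False
    then have "l j = (\<lambda>_. 0)" by (simp add: l_def fun_eq_iff)
    then show ?thesis using False i by (auto simp: real_row_val_def)
  qed
  obtain N where N: "N \<in> carrier_mat n n" "Determinant.det N = Determinant.det (submatrix A\<^sup>T {..<n} I)"
    "\<forall>r<n. \<forall>x. \<exists>j\<in>I. (\<Sum>k<n. of_int (N $$ (r, k)) * x k) = real_row_val x j"
    using row_basis_matrix[OF I] .
  have "x k = (\<Sum>j<m. real_row_val x j * l j k)" if k: "k < n" for x k
  proof -
    define d where "d k = x k - (\<Sum>j<m. real_row_val x j * l j k)" for k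
    have "real_row_val d i = 0" if i: "i \<in> I" for i
    proof -
      have "i < m" using Im i by auto
      have "(\<Sum>j<m. real_row_val x j * of_bool (j = i)) = (\<Sum>j\<in>{i}. real_row_val x j * of_bool (j = i))"
        using \<open>i < m\<close> by (intro sum.mono_neutral_right) auto
      then show ?thesis
        unfolding d_def real_row_val_diff real_row_val_sum unit[OF i] by simp
    qed
    note d0 = this
    have "(\<Sum>k<n. of_int (N $$ (r, k)) * d k) = 0" if r: "r < n" for r
    proof -
      obtain j where "j \<in> I" "(\<Sum>k<n. of_int (N $$ (r, k)) * d k) = real_row_val d j"
        using spec[OF mp[OF spec[OF N(3), of r] r], of d] by (elim bexE)
      then show ?thesis using d0[of j] by simp
    qed
    moreover have "Determinant.det N \<noteq> 0" using det N(2) by simp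
    ultimately have "d k = 0" using k by (intro det_solution_zero[OF N(1), of d k])
    then show ?thesis by (simp add: d_def)
  qed
  moreover have "real_row_val (l j) i \<in> \<int>" if "i \<in> I" for i j using unit[OF that] by simp
  ultimately show thesis by (intro that[of l] allI impI ballI)
qed

text \<open>The integer vector of the cycle becomes, after scaling the rows, a balanced vector supported on a
directed cycle. Hence it is constant there.\<close>

lemma dicycle_vector:
  assumes es: "dicycle {..<m} t h es"
  shows "\<exists>(x :: nat \<Rightarrow> int) a. 0 < a \<and> (\<forall>j<m. \<kappa> j * of_int (row_val x j) = a * cycle_flow es j)"
proof -
  obtain x where x: "\<forall>j<m. row_val x j \<noteq> 0 \<longleftrightarrow> j \<in> set es"
    using cycle_vector[OF dicycle_is_cycle[OF es]] by (elim exE)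
  define f where "f j = (if j < m then \<kappa> j * of_int (row_val x j) else 0)" for j
  have f0: "f e = 0" if e: "e \<notin> set es" for e
  proof (cases "e < m")
    case True
    then have "row_val x e = 0" using spec[OF x, of e] e by simp
    then show ?thesis by (simp add: f_def)
  qed (simp add: f_def)
  have bal: "balanced {..<m} t h f"
    using balanced_rows[of "\<lambda>k. of_int (x k)"] unfolding of_int_row_val[symmetric] balanced_def
    by (simp add: f_def)
  have const: "f e = f e'" if e: "e \<in> set es" "e' \<in> set es" for e e'
    by (rule balanced_const_on_dicycle[of "{..<m}" t h es f, OF es finite_lessThan _ bal e]) (rule f0)
  have "set es \<subseteq> {..<m}" using es by (simp add: dicycle_def)
  then have em: "e < m" if "e \<in> set es" for e using that by auto
  have e0: "es ! 0 \<in> set es" using es by (simp add: dicycle_def)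
  define a where "a = f (es ! 0)"
  have a: "a \<noteq> 0" using x em[OF e0] e0 \<kappa>_pos[OF em[OF e0]] by (simp add: a_def f_def)
  have fa: "f j = a * cycle_flow es j" for j
    using const[of j "es ! 0"] e0 f0[of j] by (cases "j \<in> set es") (simp_all add: a_def cycle_flow_def)
  have fm: "\<kappa> j * of_int (row_val x j) = a * cycle_flow es j" if "j < m" for j
    using fa[of j] that by (simp add: f_def)
  show ?thesis
  proof (cases "0 < a")
    case True
    then show ?thesis using fm by (intro exI[of _ x] exI[of _ a]) simp
  next
    case False
    have "\<kappa> j * of_int (row_val (\<lambda>k. - x k) j) = - a * cycle_flow es j" if "j < m" for j
    proof -
      have "row_val (\<lambda>k. - x k) j = - row_val x j" by (simp add: row_val_def sum_negf)
      then show ?thesis using fm[OF that] by simp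
    qed
    then show ?thesis using False a by (intro exI[of _ "\<lambda>k. - x k"] exI[of _ "- a"]) simp
  qed
qed

lemma label_sum_scaled:
  assumes l: "\<forall>x. \<forall>k<n. x k = (\<Sum>j<m. real_row_val x j * l j k)"
    and k: "k < n" and f: "\<forall>j<m. \<kappa> j * real_row_val z j = f j"
  shows "label_sum {..<m} (\<lambda>j k. l j k / \<kappa> j) f k = z k"
proof -
  have "f j * (l j k / \<kappa> j) = real_row_val z j * l j k" if j: "j < m" for j
  proof -
    have "f j = \<kappa> j * real_row_val z j" using f j by simp
    then show ?thesis using \<kappa>_pos[OF j] by simp
  qed
  then show ?thesis unfolding label_sum_def using spec[OF l, of z] k by simp
qed

lemma scaled_circulation_is_row_val:
  assumes "circulation {..<m} t h f"
  shows "\<exists>z. \<forall>j<m. \<kappa> j * real_row_val z j = f j"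
  using assms finite_lessThan
proof (induction rule: circulation_induct)
  case zero
  show ?case by (intro exI[of _ "\<lambda>_. 0"]) (simp add: real_row_val_def)
next
  case (add f c es e)
  obtain z where z: "\<forall>j<m. \<kappa> j * real_row_val z j = f j" using add.IH by (elim exE)
  obtain x :: "nat \<Rightarrow> int" and a where x: "0 < a" "\<forall>j<m. \<kappa> j * of_int (row_val x j) = a * cycle_flow es j"
    using dicycle_vector[OF add.hyps(2)] by (elim exE conjE)
  have "\<kappa> j * real_row_val (\<lambda>k. z k + c / a * of_int (x k)) j = f j + c * cycle_flow es j" if "j < m" for j
  proof -
    have "\<kappa> j * real_row_val (\<lambda>k. z k + c / a * of_int (x k)) j
        = \<kappa> j * real_row_val z j + c / a * (\<kappa> j * of_int (row_val x j))"
      unfolding real_row_val_add of_int_row_val by (simp add: algebra_simps)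
    then show ?thesis using z x that by simp
  qed
  then show ?case by (intro exI[of _ "\<lambda>k. z k + c / a * of_int (x k)"]) simp
qed

lemma row_val_is_scaled_circulation:
  assumes "\<forall>j<m. 0 \<le> real_row_val z j"
  shows "circulation {..<m} t h (\<lambda>j. if j < m then \<kappa> j * real_row_val z j else 0)"
proof -
  have "0 \<le> \<kappa> j * real_row_val z j" if "j < m" for j
    using assms \<kappa>_pos[OF that] that by simp
  then show ?thesis using balanced_rows[of z] by (simp add: circulation_def balanced_def)
qed

definition shifted_points :: "(nat \<Rightarrow> real) \<Rightarrow> real vec set" where
  "shifted_points x0 = {x \<in> carrier_vec n. (\<forall>j<m. 0 \<le> real_row_val (\<lambda>k. x0 k - x $ k) j) \<and> (\<forall>k<n. x $ k \<in> \<int>)}"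

text \<open>The apex is a lattice point, and every directed cycle gives a generator with an integer multiple, so
every generator is a recession direction of the hull.\<close>

lemma conv_shifted_points_integral:
  assumes x0: "\<forall>k<n. x0 k \<in> \<int>"
    and l: "\<forall>x. \<forall>k<n. x k = (\<Sum>j<m. real_row_val x j * l j k)"
  shows "conv (shifted_points x0) =
    {label_point n x0 {..<m} (\<lambda>j k. l j k / \<kappa> j) f | f. circulation {..<m} t h f}"
    (is "conv ?T = ?R")
proof -
  let ?l = "\<lambda>j k. l j k / \<kappa> j"
  have T: "?T \<subseteq> carrier_vec n" by (auto simp: shifted_points_def)
  note lab = label_sum_scaled[OF l]
  have "?T \<subseteq> ?R"
  proof
    fix x assume x: "x \<in> ?T"
    define z where "z = (\<lambda>k. x0 k - x $ k)"
    define f where "f j = (if j < m then \<kappa> j * real_row_val z j else 0)" for j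
    have "\<forall>j<m. 0 \<le> real_row_val z j" using x by (simp add: shifted_points_def z_def)
    then have f: "circulation {..<m} t h f" unfolding f_def by (rule row_val_is_scaled_circulation)
    have "label_sum {..<m} ?l f k = z k" if "k < n" for k by (rule lab[OF that]) (simp add: f_def)
    then have "x = label_point n x0 {..<m} ?l f"
      using x by (intro eq_vecI) (auto simp: label_point_def shifted_points_def z_def)
    then show "x \<in> ?R" using f unfolding mem_Collect_eq by (intro exI[of _ f] conjI)
  qed
  moreover have "convex_vec ?R" by (rule convex_label_points) (rule circulation_combination)
  ultimately have "conv ?T \<subseteq> ?R" by (rule conv_mono_convex)
  moreover have "?R \<subseteq> conv ?T"
  proof
    fix x assume "x \<in> ?R"
    then obtain f where x: "x = label_point n x0 {..<m} ?l f" and f: "circulation {..<m} t h f"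
      unfolding mem_Collect_eq by (elim exE conjE)
    have "label_point n x0 {..<m} ?l f \<in> conv ?T"
      using f finite_lessThan
    proof (induction rule: circulation_induct)
      case zero
      have "label_point n x0 {..<m} ?l (\<lambda>_. 0) \<in> ?T"
        using x0 by (auto simp: shifted_points_def label_point_def label_sum_zero real_row_val_def intro!: sum_nonneg)
      then show ?case by (rule hull_inc)
    next
      case (add f c es e)
      obtain q :: "nat \<Rightarrow> int" and a where q: "0 < a" "\<forall>j<m. \<kappa> j * of_int (row_val q j) = a * cycle_flow es j"
        using dicycle_vector[OF add.hyps(2)] by (elim exE conjE)
      have qnn: "0 \<le> real_row_val (\<lambda>k. of_int (q k)) j" if "j < m" for j
      proof -
        have "0 \<le> \<kappa> j * of_int (row_val q j)" using q that by (simp add: cycle_flow_def)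
        then show ?thesis using \<kappa>_pos[OF that] unfolding of_int_row_val by (simp add: zero_le_mult_iff)
      qed
      have Lq: "label_sum {..<m} ?l (cycle_flow es) k = of_int (q k) / a" if "k < n" for k
      proof -
        have "\<forall>j<m. \<kappa> j * real_row_val (\<lambda>k. (1 / a) * of_int (q k)) j = cycle_flow es j"
          using q unfolding real_row_val_scale of_int_row_val by (simp add: field_simps)
        from lab[OF that this] show ?thesis by simp
      qed
      have "vec n (\<lambda>k. label_point n x0 {..<m} ?l f $ k - (c / a) * of_int (q k)) \<in> conv ?T"
      proof (rule conv_recession[OF T _ add.IH])
        show "0 \<le> c / a" using add.hyps q by simp
        fix p j assume p: "p \<in> ?T"
        let ?p' = "vec n (\<lambda>k. p $ k - real j * of_int (q k))"
        have "real_row_val (\<lambda>k. x0 k - ?p' $ k) i = real_row_val (\<lambda>k. x0 k - p $ k) i + real j * real_row_val (\<lambda>k. of_int (q k)) i" for i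
          unfolding real_row_val_add[symmetric] by (rule real_row_val_cong) simp
        then show "?p' \<in> ?T" using p qnn by (simp add: shifted_points_def)
      qed
      moreover have "vec n (\<lambda>k. label_point n x0 {..<m} ?l f $ k - (c / a) * of_int (q k))
          = label_point n x0 {..<m} ?l (\<lambda>e. f e + c * cycle_flow es e)"
        by (intro eq_vecI) (simp_all add: label_point_def label_sum_add Lq)
      ultimately show ?case by simp
    qed
    then show "x \<in> conv ?T" using x by simp
  qed
  ultimately show ?thesis by (rule subset_antisym)
qed

lemma row_basis_ex: "\<exists>I. row_basis I"
  using row_basis_exists[of "{..<m}"] full by blast

lemma admits_integral:
  assumes x0: "\<forall>k<n. x0 k \<in> \<int>"
  shows "\<exists>k\<le>size_bound n. admits_ext_formulation n (conv (shifted_points x0)) k"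
proof -
  obtain I where I: "row_basis I" using row_basis_ex by (elim exE)
  obtain l :: "nat \<Rightarrow> nat \<Rightarrow> real" where l: "\<forall>x. \<forall>k<n. x k = (\<Sum>j<m. real_row_val x j * l j k)"
    using row_basis_labels[OF I] .
  let ?l = "\<lambda>j k. l j k / \<kappa> j"
  have inj: "labels_injective n {..<m} t h ?l"
    unfolding labels_injective_def
  proof (intro allI impI)
    fix f f' assume f: "circulation {..<m} t h f" and f': "circulation {..<m} t h f'"
      and eq: "\<forall>k<n. label_sum {..<m} ?l f k = label_sum {..<m} ?l f' k"
    note lab = label_sum_scaled[OF l]
    obtain z where z: "\<forall>j<m. \<kappa> j * real_row_val z j = f j" using scaled_circulation_is_row_val[OF f] by (elim exE)
    obtain z' where z': "\<forall>j<m. \<kappa> j * real_row_val z' j = f' j" using scaled_circulation_is_row_val[OF f'] by (elim exE)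
    have "z k = z' k" if "k < n" for k using lab[OF that z] lab[OF that z'] eq that by simp
    then have "real_row_val z j = real_row_val z' j" for j by (rule real_row_val_cong)
    then have "f j = f' j" if "j < m" for j using spec[OF z, of j] spec[OF z', of j] that by simp
    moreover have "f j = f' j" if "\<not> j < m" for j using f f' that by (simp add: circulation_def)
    ultimately show "f = f'" by (intro ext) blast
  qed
  obtain E' t' h' l' where red: "reduces_to {..<m} t h ?l E' (t' :: nat \<Rightarrow> 'v) h' l'"
    and card: "card E' \<le> 2 * n" "card (t' ` E' \<union> h' ` E') \<le> n + 1"
    using digraph_reduction[OF _ inj, of "\<lambda>_. True"] by auto
  have finE': "finite E'" using reduces_toD(1)[OF red] by (rule finite_subset) simp
  have eq: "conv (shifted_points x0) = {vec n (\<lambda>k. x0 k - label_sum E' l' \<phi> k) | \<phi>.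
      circulation E' t' h' \<phi> \<and> (\<Sum>e\<in>E'. 0 * \<phi> e) = 0}"
    unfolding conv_shifted_points_integral[OF x0 l] label_points_reduce[OF red]
    unfolding label_point_def by simp
  have "card E' + 2 * card (t' ` E' \<union> h' ` E') + 2 + 2 * n \<le> size_bound n"
    using card by (simp add: size_bound_def)
  then show ?thesis
    using admits_circulation_formulation[OF finE', of n x0 l' t' h' "\<lambda>_. 0" 0] unfolding eq by blast
qed

end

section \<open>Integer hulls with a fractional apex\<close>

lemma card_cover_vertices:
  fixes t h :: "'e \<Rightarrow> 'v"
  assumes "finite E"
  defines "V \<equiv> t ` E \<union> h ` E"
  shows "card (cover_tail t ` cover_edges V E \<union> cover_head h od ` cover_edges V E) \<le> 2 * (card V)\<^sup>2"
proof -
  have finV: "finite V" using assms by simp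
  have "cover_tail t ` cover_edges V E \<union> cover_head h od ` cover_edges V E \<subseteq> V \<times> V \<times> UNIV"
    by (auto simp: cover_edges_def cover_tail_def cover_head_def V_def)
  then have "card (cover_tail t ` cover_edges V E \<union> cover_head h od ` cover_edges V E) \<le> card (V \<times> V \<times> (UNIV :: bool set))"
    using finV by (intro card_mono) simp_all
  also have "\<dots> = 2 * (card V)\<^sup>2" by (simp add: card_cartesian_product power2_eq_square)
  finally show ?thesis .
qed

locale fractional_apex = oriented_cographic_matrix H A m n t h \<kappa>
  for H :: "('v, nat) multigraph" and A m n t h \<kappa> +
  fixes x0 :: "nat \<Rightarrow> real"
  assumes minors: "\<And>I. I \<subseteq> {..<m} \<Longrightarrow> card I = n \<Longrightarrow> \<bar>Determinant.det (submatrix A\<^sup>T {..<n} I)\<bar> \<le> 2"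
    and x0_val: "\<And>j. j < m \<Longrightarrow> real_row_val x0 j \<in> \<int>"
    and x0_frac: "\<not> (\<forall>k<n. x0 k \<in> \<int>)"
begin

definition int_vector :: "(nat \<Rightarrow> real) \<Rightarrow> bool" where
  "int_vector x \<longleftrightarrow> (\<forall>k<n. x k \<in> \<int>)"

text \<open>Membership in the lattice generated by the integer vectors and \<open>x0\<close>; twice \<open>x0\<close> is integral, so there are
only two cosets.\<close>

definition half_integral :: "(nat \<Rightarrow> real) \<Rightarrow> bool" where
  "half_integral x \<longleftrightarrow> int_vector x \<or> int_vector (\<lambda>k. x k - x0 k)"

lemma row_basis_half_integral:
  assumes I: "row_basis I" and x: "\<And>i. i \<in> I \<Longrightarrow> real_row_val x i \<in> \<int>"
  shows "half_integral x" "\<forall>k<n. 2 * x0 k \<in> \<int>"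
proof -
  have I': "I \<subseteq> {..<m}" "card I = n" "Determinant.det (submatrix A\<^sup>T {..<n} I) \<noteq> 0"
    using I by (simp_all add: row_basis_def)
  obtain N where N: "N \<in> carrier_mat n n" "Determinant.det N = Determinant.det (submatrix A\<^sup>T {..<n} I)"
    "\<forall>r<n. \<forall>x. \<exists>j\<in>I. (\<Sum>k<n. of_int (N $$ (r, k)) * x k) = real_row_val x j"
    using row_basis_matrix[OF I] .
  have val: "\<exists>j\<in>I. (\<Sum>k<n. of_int (N $$ (r, k)) * y k) = real_row_val y j" if r: "r < n" for r y
    using spec[OF mp[OF spec[OF N(3), of r] r], of y] .
  have det: "Determinant.det N \<noteq> 0" "\<bar>Determinant.det N\<bar> \<le> 2" using N(2) I' minors by simp_all
  have zint: "(\<Sum>k<n. of_int (N $$ (r, k)) * x0 k) \<in> \<int>" if r: "r < n" for r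
  proof -
    obtain j where j: "j \<in> I" "(\<Sum>k<n. of_int (N $$ (r, k)) * x0 k) = real_row_val x0 j"
      using val[OF r, of x0] by (elim bexE)
    then show ?thesis using I'(1) x0_val[of j] by auto
  qed
  have xint: "(\<Sum>k<n. of_int (N $$ (r, k)) * x k) \<in> \<int>" if r: "r < n" for r
  proof -
    obtain j where j: "j \<in> I" "(\<Sum>k<n. of_int (N $$ (r, k)) * x k) = real_row_val x j"
      using val[OF r, of x] by (elim bexE)
    then show ?thesis using x[of j] by simp
  qed
  show "\<forall>k<n. 2 * x0 k \<in> \<int>"
    by (rule det_le_2_solutions(1)[of N n x0 x, OF N(1) det zint x0_frac xint])
  show "half_integral x"
    using det_le_2_solutions(2)[of N n x0 x, OF N(1) det zint x0_frac xint]
    by (simp add: half_integral_def int_vector_def)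
qed

lemma two_x0: "k < n \<Longrightarrow> 2 * x0 k \<in> \<int>"
proof -
  obtain I where I: "row_basis I" using row_basis_ex by (elim exE)
  have "\<forall>k<n. 2 * x0 k \<in> \<int>"
    by (rule row_basis_half_integral(2)[OF I, of "\<lambda>_. 0"]) (simp add: real_row_val_def)
  then show "k < n \<Longrightarrow> 2 * x0 k \<in> \<int>" by simp
qed

lemma int_vectorI: "(\<And>k. k < n \<Longrightarrow> x k \<in> \<int>) \<Longrightarrow> int_vector x"
  by (simp add: int_vector_def)

lemma int_vectorD: "int_vector x \<Longrightarrow> k < n \<Longrightarrow> x k \<in> \<int>"
  by (simp add: int_vector_def)

lemma int_vector_add: "int_vector x \<Longrightarrow> int_vector y \<Longrightarrow> int_vector (\<lambda>k. x k + y k)"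
  by (simp add: int_vector_def)

lemma half_integral_add:
  assumes x: "half_integral x" and y: "half_integral y"
  shows "half_integral (\<lambda>k. x k + y k)"
proof -
  have two: "int_vector (\<lambda>k. 2 * x0 k)" using two_x0 by (simp add: int_vector_def)
  consider "int_vector x" "int_vector y" | "int_vector x" "int_vector (\<lambda>k. y k - x0 k)"
    | "int_vector (\<lambda>k. x k - x0 k)" "int_vector y" | "int_vector (\<lambda>k. x k - x0 k)" "int_vector (\<lambda>k. y k - x0 k)"
    using x y by (auto simp: half_integral_def)
  then show ?thesis
  proof cases
    case 1
    then show ?thesis using int_vector_add by (simp add: half_integral_def)
  next
    case 2
    then show ?thesis using int_vector_add[OF 2] by (simp add: half_integral_def algebra_simps)
  next
    case 3
    then show ?thesis using int_vector_add[OF 3] by (simp add: half_integral_def algebra_simps)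
  next
    case 4
    have "int_vector (\<lambda>k. (x k - x0 k) + (y k - x0 k) + 2 * x0 k)"
      by (intro int_vector_add 4 two)
    then show ?thesis by (simp add: half_integral_def algebra_simps)
  qed
qed

lemma int_vector_row_val:
  assumes "int_vector x"
  shows "real_row_val x j \<in> \<int>"
  unfolding real_row_val_def using assms by (intro Ints_sum Ints_mult) (simp_all add: int_vector_def)

lemma half_integral_row_val:
  assumes x: "half_integral x" and j: "j < m"
  shows "real_row_val x j \<in> \<int>"
  using x unfolding half_integral_def
proof
  assume "int_vector (\<lambda>k. x k - x0 k)"
  then have "real_row_val x j - real_row_val x0 j \<in> \<int>"
    using int_vector_row_val real_row_val_diff by metis
  then show ?thesis using x0_val[OF j] by (metis Ints_add diff_add_cancel)
qed (rule int_vector_row_val)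

text \<open>Complete the rows outside a cycle by one row \<open>e\<close> of the cycle to a basis. Integrality on this
basis shows that the entries of the cycle vector are multiples of its entry at \<open>e\<close>, for every \<open>e\<close>.
The entries on the cycle are positive, so they all agree, and with them the scaling factors.\<close>

lemma dicycle_row_val:
  assumes es: "dicycle {..<m} t h es"
  shows "\<exists>x. \<forall>j<m. real_row_val x j = cycle_flow es j"
    and "\<And>e e'. e \<in> set es \<Longrightarrow> e' \<in> set es \<Longrightarrow> \<kappa> e = \<kappa> e'"
proof -
  obtain x :: "nat \<Rightarrow> int" and a where a: "0 < a" and x: "\<forall>j<m. \<kappa> j * of_int (row_val x j) = a * cycle_flow es j"
    using dicycle_vector[OF es] by (elim exE conjE)
  define y where "y j = real_of_int (row_val x j)" for j
  have "set es \<subseteq> {..<m}" using es by (simp add: dicycle_def)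
  then have em: "e < m" if "e \<in> set es" for e using that by auto
  have \<kappa>y: "\<kappa> e * y e = a" if "e \<in> set es" for e
    using spec[OF x, of e] em[OF that] that by (simp add: y_def cycle_flow_def)
  have y0: "y j = 0" if "j < m" "j \<notin> set es" for j
    using spec[OF x, of j] that \<kappa>_pos[OF that(1)] by (simp add: y_def cycle_flow_def)
  have ypos: "0 < y e" if "e \<in> set es" for e
    using \<kappa>y[OF that] a \<kappa>_pos[OF em[OF that]] by (metis zero_less_mult_pos)
  have mult: "y j / y e \<in> \<int>" if e: "e \<in> set es" and j: "j < m" for e j
  proof -
    have "insert e ({..<m} - set es) \<subseteq> {..<m}" using em[OF e] by auto
    then obtain I where I: "I \<subseteq> insert e ({..<m} - set es)" "row_basis I"
      using row_basis_exists row_rank_cycle(1)[OF dicycle_is_cycle[OF es] e] by blast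
    define x' where "x' = (\<lambda>k. (1 / y e) * of_int (x k))"
    have val: "real_row_val x' i = y i / y e" for i
      unfolding x'_def real_row_val_scale by (simp add: y_def of_int_row_val)
    have "real_row_val x' i \<in> \<int>" if i: "i \<in> I" for i
    proof (cases "i = e")
      case True
      then show ?thesis using ypos[OF e] by (simp add: val)
    next
      case False
      then have "i < m" "i \<notin> set es" using I(1) i by auto
      then show ?thesis using y0 by (simp add: val)
    qed
    then have "half_integral x'" by (rule row_basis_half_integral(1)[OF I(2)])
    then show ?thesis using half_integral_row_val[OF _ j] val by metis
  qed
  have ge: "y e \<le> y e'" if e: "e \<in> set es" and e': "e' \<in> set es" for e e'
  proof -
    obtain p where p: "y e' / y e = of_int p" using mult[OF e em[OF e']] by (rule Ints_cases)
    have "0 < y e' / y e" using ypos[OF e] ypos[OF e'] by simp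
    then have "1 \<le> p" unfolding p by simp
    then have "1 \<le> y e' / y e" unfolding p by simp
    then show ?thesis using ypos[OF e] by (simp add: pos_le_divide_eq)
  qed
  have eq: "y e = y e'" if "e \<in> set es" "e' \<in> set es" for e e'
    using ge[OF that] ge[OF that(2,1)] by simp
  show "\<kappa> e = \<kappa> e'" if e: "e \<in> set es" and e': "e' \<in> set es" for e e'
    using \<kappa>y[OF e] \<kappa>y[OF e'] eq[OF e e'] ypos[OF e'] by (metis less_irrefl mult_cancel_right)
  have e0: "es ! 0 \<in> set es" using es by (simp add: dicycle_def)
  define x' where "x' = (\<lambda>k. (1 / y (es ! 0)) * of_int (x k))"
  have val: "real_row_val x' i = y i / y (es ! 0)" for i
    unfolding x'_def real_row_val_scale by (simp add: y_def of_int_row_val)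
  have "real_row_val x' j = cycle_flow es j" if j: "j < m" for j
  proof (cases "j \<in> set es")
    case True
    then show ?thesis using eq[OF True e0] ypos[OF e0] by (simp add: val cycle_flow_def)
  next
    case False
    then show ?thesis using y0[OF j] by (simp add: val cycle_flow_def)
  qed
  then show "\<exists>x. \<forall>j<m. real_row_val x j = cycle_flow es j" by (intro exI[of _ x'] allI impI)
qed

lemma circulation_is_row_val:
  assumes "circulation {..<m} t h f"
  shows "\<exists>z. \<forall>j<m. real_row_val z j = f j"
  using assms finite_lessThan
proof (induction rule: circulation_induct)
  case zero
  show ?case by (intro exI[of _ "\<lambda>_. 0"]) (simp add: real_row_val_def)
next
  case (add f c es e)
  obtain z where z: "\<forall>j<m. real_row_val z j = f j" using add.IH by (elim exE)
  obtain x where x: "\<forall>j<m. real_row_val x j = cycle_flow es j" using dicycle_row_val(1)[OF add.hyps(2)] by (elim exE)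
  show ?case using z x by (intro exI[of _ "\<lambda>k. z k + c * x k"]) (simp add: real_row_val_add)
qed

text \<open>The scaling factors are constant on cycles, so scaling preserves circulations.\<close>

lemma row_val_is_circulation:
  assumes z: "\<forall>j<m. 0 \<le> real_row_val z j"
  shows "circulation {..<m} t h (\<lambda>j. if j < m then real_row_val z j else 0)"
proof -
  define g where "g = (\<lambda>j. if j < m then \<kappa> j * real_row_val z j else 0)"
  have "circulation {..<m} t h g" unfolding g_def by (rule row_val_is_scaled_circulation[OF z])
  then have "balanced {..<m} t h (\<lambda>j. g j / \<kappa> j)"
    using finite_lessThan
  proof (induction rule: circulation_induct)
    case zero
    show ?case by (simp add: balanced_def)
  next
    case (add f c es e)
    define K where "K = \<kappa> (es ! 0)"
    have e0: "es ! 0 \<in> set es" using add.hyps(2) by (simp add: dicycle_def)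
    have "circulation {..<m} t h (cycle_flow es)"
      by (rule circulation_cycle_flow[OF add.hyps(2) finite_lessThan])
    then have "balanced {..<m} t h (\<lambda>j. f j / \<kappa> j + (c / K) * cycle_flow es j)"
      using add.IH by (intro balanced_add) (simp_all add: circulation_def)
    moreover have "f j / \<kappa> j + (c / K) * cycle_flow es j = (f j + c * cycle_flow es j) / \<kappa> j" for j
    proof (cases "j \<in> set es")
      case True
      then have "\<kappa> j = K" unfolding K_def by (rule dicycle_row_val(2)[OF add.hyps(2) _ e0])
      then show ?thesis using True by (simp add: cycle_flow_def add_divide_distrib)
    next
      case False
      then show ?thesis by (simp add: cycle_flow_def)
    qed
    ultimately show ?case by simp
  qed
  moreover have "g j / \<kappa> j = (if j < m then real_row_val z j else 0)" for j
    using \<kappa>_pos[of j] by (auto simp: g_def)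
  ultimately have "balanced {..<m} t h (\<lambda>j. if j < m then real_row_val z j else 0)" by simp
  then show ?thesis using z by (simp add: circulation_def)
qed

text \<open>Each odd edge contributes one copy of \<open>x0\<close> modulo the integers.\<close>

lemma label_sum_mod_integers:
  assumes l: "\<forall>e\<in>E. half_integral (l e)" and f: "\<forall>e. f e \<in> \<int>"
  shows "int_vector (\<lambda>k. label_sum E l f k - odd_weight E (\<lambda>e. \<not> int_vector (l e)) f * x0 k)"
proof (rule int_vectorI)
  fix k assume k: "k < n"
  have "label_sum E l f k - odd_weight E (\<lambda>e. \<not> int_vector (l e)) f * x0 k
      = (\<Sum>e\<in>E. f e * (l e k - of_bool (\<not> int_vector (l e)) * x0 k))"
    unfolding label_sum_def odd_weight_def sum_distrib_right sum_subtractf[symmetric]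
    by (rule sum.cong) (simp_all add: algebra_simps)
  also have "\<dots> \<in> \<int>"
  proof (intro Ints_sum Ints_mult)
    fix e assume e: "e \<in> E"
    show "f e \<in> \<int>" using f by simp
    show "l e k - of_bool (\<not> int_vector (l e)) * x0 k \<in> \<int>"
      using bspec[OF l e] k unfolding half_integral_def int_vector_def by auto
  qed
  finally show "label_sum E l f k - odd_weight E (\<lambda>e. \<not> int_vector (l e)) f * x0 k \<in> \<int>" .
qed

text \<open>Each odd edge contributes \<open>x0\<close> modulo the integers, and twice \<open>x0\<close> vanishes modulo the integers.\<close>

lemma label_point_integral_iff:
  assumes l: "\<forall>e\<in>E. half_integral (l e)" and f: "\<forall>e. f e \<in> \<int>"
  shows "int_vector (\<lambda>k. x0 k - label_sum E l f k) \<longleftrightarrow> odd_real (odd_weight E (\<lambda>e. \<not> int_vector (l e)) f)"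
proof -
  have "odd_weight E (\<lambda>e. \<not> int_vector (l e)) f \<in> \<int>" using f by (intro odd_weight_Ints) simp
  then obtain w where w: "odd_weight E (\<lambda>e. \<not> int_vector (l e)) f = of_int w" by (rule Ints_cases)
  have mod: "label_sum E l f k - of_int w * x0 k \<in> \<int>" if "k < n" for k
    using int_vectorD[OF label_sum_mod_integers[OF l f] that] unfolding w .
  have eq: "x0 k - label_sum E l f k = (1 - of_int w) * x0 k - (label_sum E l f k - of_int w * x0 k)" for k
    by (simp add: algebra_simps)
  show ?thesis
    unfolding w odd_real_of_int
  proof
    assume "odd w"
    then obtain d where d: "w = 2 * d + 1" by (rule oddE)
    have "x0 k - label_sum E l f k \<in> \<int>" if k: "k < n" for k
    proof -
      have "(1 - of_int w) * x0 k = of_int (- d) * (2 * x0 k)" using d by simp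
      also have "\<dots> \<in> \<int>" by (rule Ints_mult[OF Ints_of_int two_x0[OF k]])
      finally show ?thesis unfolding eq using mod[OF k] by (rule Ints_diff)
    qed
    then show "int_vector (\<lambda>k. x0 k - label_sum E l f k)" by (simp add: int_vector_def)
  next
    assume int: "int_vector (\<lambda>k. x0 k - label_sum E l f k)"
    show "odd w"
    proof
      assume "even w"
      then obtain d where d: "w = 2 * d" by (rule evenE)
      have "x0 k \<in> \<int>" if k: "k < n" for k
      proof -
        have "x0 k = (x0 k - label_sum E l f k) + (label_sum E l f k - of_int w * x0 k) + of_int d * (2 * x0 k)"
          using d by simp
        also have "\<dots> \<in> \<int>"
          by (intro Ints_add Ints_mult[OF Ints_of_int two_x0[OF k]] int_vectorD[OF int k] mod[OF k])
        finally show ?thesis .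
      qed
      then show False using x0_frac by blast
    qed
  qed
qed

text \<open>The reduction keeps the labels in the lattice, so it keeps the parity of edges meaningful: in the
reduced digraph an edge is odd iff its label is not integral.\<close>

lemma admits_fractional: "\<exists>k\<le>size_bound n. admits_ext_formulation n (conv (shifted_points x0)) k"
proof -
  obtain I where I: "row_basis I" using row_basis_ex by (elim exE)
  obtain l :: "nat \<Rightarrow> nat \<Rightarrow> real" where l: "\<forall>x. \<forall>k<n. x k = (\<Sum>j<m. real_row_val x j * l j k)"
    and lI: "\<forall>j. \<forall>i\<in>I. real_row_val (l j) i \<in> \<int>"
    using row_basis_labels[OF I] .
  have lhalf: "half_integral (l j)" for j
    using lI by (intro row_basis_half_integral(1)[OF I]) simp
  have lab: "label_sum {..<m} l f k = z k" if "k < n" "\<forall>j<m. real_row_val z j = f j" for f z k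
    unfolding label_sum_def using spec[OF l, of z] that by simp
  have inj: "labels_injective n {..<m} t h l"
    unfolding labels_injective_def
  proof (intro allI impI)
    fix f f' assume f: "circulation {..<m} t h f" and f': "circulation {..<m} t h f'"
      and eq: "\<forall>k<n. label_sum {..<m} l f k = label_sum {..<m} l f' k"
    obtain z where z: "\<forall>j<m. real_row_val z j = f j" using circulation_is_row_val[OF f] by (elim exE)
    obtain z' where z': "\<forall>j<m. real_row_val z' j = f' j" using circulation_is_row_val[OF f'] by (elim exE)
    have "z k = z' k" if "k < n" for k using lab[OF that z] lab[OF that z'] eq that by simp
    then have "real_row_val z j = real_row_val z' j" for j by (rule real_row_val_cong)
    then have "f j = f' j" if "j < m" for j using spec[OF z, of j] spec[OF z', of j] that by simp
    moreover have "f j = f' j" if "\<not> j < m" for j using f f' that by (simp add: circulation_def)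
    ultimately show "f = f'" by (intro ext) blast
  qed
  have "\<exists>E' t' h' l'. reduces_to {..<m} t h l E' (t' :: nat \<Rightarrow> 'v) h' l' \<and> card E' \<le> 2 * n \<and>
      card (t' ` E' \<union> h' ` E') \<le> n + 1 \<and> (\<forall>e\<in>E'. half_integral (l' e))"
    by (rule digraph_reduction[OF finite_lessThan inj lhalf half_integral_add])
  then obtain E' l' and t' h' :: "nat \<Rightarrow> 'v" where red: "reduces_to {..<m} t h l E' t' h' l'"
    and card: "card E' \<le> 2 * n" "card (t' ` E' \<union> h' ` E') \<le> n + 1"
    and lhalf': "\<forall>e\<in>E'. half_integral (l' e)"
    by (elim exE conjE)
  \<comment> \<open>the labels of the reduced digraph, not those of the original one, define the odd edges\<close>
  define od where "od e \<longleftrightarrow> \<not> int_vector (l' e)" for e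
  have finE': "finite E'" using reduces_toD(1)[OF red] by (rule finite_subset) simp
  have points: "shifted_points x0 = {label_point n x0 E' l' f | f. odd_circulation E' t' h' od f}"
    (is "_ = ?R")
  proof (intro equalityI subsetI)
    fix x assume x: "x \<in> shifted_points x0"
    define z where "z = (\<lambda>k. x0 k - x $ k)"
    define f where "f j = (if j < m then real_row_val z j else 0)" for j
    have "\<forall>j<m. 0 \<le> real_row_val z j" using x by (simp add: shifted_points_def z_def)
    then have f: "circulation {..<m} t h f" unfolding f_def by (rule row_val_is_circulation)
    have fz: "\<forall>j<m. real_row_val z j = f j" by (simp add: f_def)
    have "int_vector (\<lambda>k. - (x $ k))" using x by (simp add: shifted_points_def int_vector_def)
    then have "half_integral z" by (simp add: half_integral_def z_def)
    then have fint: "\<forall>e. f e \<in> \<int>" using half_integral_row_val by (simp add: f_def)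
    obtain f' where f': "circulation E' t' h' f'" "label_sum E' l' f' = label_sum {..<m} l f"
        "(\<forall>e. f e \<in> \<int>) \<longrightarrow> (\<forall>e. f' e \<in> \<int>)"
      using reduces_toD(2)[OF red f] by (elim exE conjE)
    have f'int: "\<forall>e. f' e \<in> \<int>" using f'(3) fint by (rule mp)
    have val: "x0 k - label_sum E' l' f' k = x $ k" if "k < n" for k
      unfolding f'(2) lab[OF that fz] by (simp add: z_def)
    have "int_vector (\<lambda>k. x0 k - label_sum E' l' f' k)"
      using x val by (simp add: shifted_points_def int_vector_def)
    then have "odd_circulation E' t' h' od f'"
      using f'(1) f'int label_point_integral_iff[OF lhalf' f'int] by (simp add: odd_circulation_def od_def[abs_def])
    moreover have "x = label_point n x0 E' l' f'"
      using x val by (intro eq_vecI) (auto simp: label_point_def shifted_points_def)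
    ultimately show "x \<in> ?R" unfolding mem_Collect_eq by (intro exI[of _ f'] conjI)
  next
    fix x assume "x \<in> ?R"
    then obtain f' where x: "x = label_point n x0 E' l' f'" and od: "odd_circulation E' t' h' od f'"
      unfolding mem_Collect_eq by (elim exE conjE)
    then have f': "circulation E' t' h' f'" and f'int: "\<forall>e. f' e \<in> \<int>" and
        w: "odd_real (odd_weight E' od f')"
      by (simp_all add: odd_circulation_def)
    obtain f where f: "circulation {..<m} t h f" "label_sum {..<m} l f = label_sum E' l' f'"
      using reduces_toD(3)[OF red f'] by (elim exE conjE)
    obtain z where z: "\<forall>j<m. real_row_val z j = f j" using circulation_is_row_val[OF f(1)] by (elim exE)
    have Lz: "label_sum E' l' f' k = z k" if "k < n" for k using lab[OF that z] f(2) by simp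
    have "int_vector (\<lambda>k. x0 k - label_sum E' l' f' k)"
      using w label_point_integral_iff[OF lhalf' f'int] by (simp add: od_def[abs_def])
    then have "\<forall>k<n. x $ k \<in> \<int>" by (simp add: x label_point_def int_vector_def)
    moreover have "real_row_val (\<lambda>k. x0 k - x $ k) j = real_row_val z j" for j
      by (rule real_row_val_cong) (simp add: x label_point_def Lz)
    then have "\<forall>j<m. 0 \<le> real_row_val (\<lambda>k. x0 k - x $ k) j" using z f(1) by (simp add: circulation_def)
    ultimately show "x \<in> shifted_points x0" by (simp add: shifted_points_def x label_point_def)
  qed
  define V where "V = t' ` E' \<union> h' ` E'"
  have finV: "finite V" using finE' by (simp add: V_def)
  define C where "C = cover_edges V E'"
  have finC: "finite C" unfolding C_def by (rule finite_cover_edges[OF finV finE'])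
  define w where "w x = (of_bool (snd x = None) :: real)" for x :: "('v, nat) cover_edge"
  have weight: "return_flow V \<phi> = (\<Sum>x\<in>C. w x * \<phi> x)" for \<phi>
    unfolding C_def sum_cover_edges[OF finV finE'] by (simp add: w_def return_flow_def)
  have conv: "conv (shifted_points x0) = {vec n (\<lambda>k. x0 k - label_sum C (cover_label l') \<phi> k) | \<phi>.
      circulation C (cover_tail t') (cover_head h' od) \<phi> \<and> (\<Sum>x\<in>C. w x * \<phi> x) = 1}"
    unfolding points conv_odd_circulations[OF finE'] V_def[symmetric] C_def[symmetric] weight
    unfolding label_point_def ..
  have "card V \<le> n + 1" using card(2) by (simp add: V_def)
  then have "card C \<le> (n + 1) * (4 * n + 1)"
    unfolding C_def card_cover_edges[OF finV finE'] using card(1) by (intro mult_le_mono) simp_all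
  moreover have "card (cover_tail t' ` C \<union> cover_head h' od ` C) \<le> 2 * (n + 1)\<^sup>2"
  proof -
    have "card (cover_tail t' ` C \<union> cover_head h' od ` C) \<le> 2 * (card V)\<^sup>2"
      unfolding C_def V_def by (rule card_cover_vertices[OF finE'])
    also have "\<dots> \<le> 2 * (n + 1)\<^sup>2" using \<open>card V \<le> n + 1\<close> by (intro mult_le_mono power_mono) simp_all
    finally show ?thesis .
  qed
  ultimately have "card C + 2 * card (cover_tail t' ` C \<union> cover_head h' od ` C) + 2 + 2 * n
      \<le> (n + 1) * (4 * n + 1) + 2 * (2 * (n + 1)\<^sup>2) + 2 + 2 * n" by linarith
  also have "\<dots> = size_bound n" by (simp add: size_bound_def power2_eq_square algebra_simps)
  finally show ?thesis
    using admits_circulation_formulation[OF finC, of n x0 "cover_label l'" "cover_tail t'" "cover_head h' od" w 1]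
    unfolding conv by (intro exI conjI)
qed

end

section \<open>Bimodular cographic matrices\<close>

definition reindex_edges :: "('v, 'e) multigraph \<Rightarrow> (nat \<Rightarrow> 'e) \<Rightarrow> nat \<Rightarrow> ('v, nat) multigraph" where
  "reindex_edges H f m = \<lparr>verts = verts H, edges = {..<m}, ends = (\<lambda>j. ends H (f j))\<rparr>"

lemma is_forest_reindex_edges:
  assumes f: "bij_betw f {..<m} (edges H)" and F: "F \<subseteq> {..<m}"
  shows "is_forest (reindex_edges H f m) F \<longleftrightarrow> is_forest H (f ` F)"
proof -
  let ?H = "reindex_edges H f m"
  have inj: "inj_on f {..<m}" and img: "f ` {..<m} = edges H" using f by (simp_all add: bij_betw_def)
  have fwd: "is_cycle H vs (map f es)" if c: "is_cycle ?H vs es" for vs es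
  proof -
    have es: "set es \<subseteq> {..<m}" using c by (simp add: is_cycle_def reindex_edges_def)
    then have "inj_on f (set es)" using inj inj_on_subset by blast
    then have "distinct (map f es)" using c by (simp add: is_cycle_def distinct_map)
    moreover have "f ` set es \<subseteq> edges H" using es img by blast
    ultimately show ?thesis using c by (simp add: is_cycle_def reindex_edges_def)
  qed
  have bwd: "\<exists>es'. is_cycle ?H vs es' \<and> set es' \<subseteq> F" if c: "is_cycle H vs es" and es: "set es \<subseteq> f ` F" for vs es
  proof -
    define g where "g = inv_into {..<m} f"
    have fg: "f (g e) = e" "g e \<in> F" if e: "e \<in> set es" for e
    proof -
      obtain j where j: "j \<in> F" "e = f j" using es e by blast
      then have "g e = j" using inj F by (simp add: g_def inv_into_f_f subset_iff)
      then show "f (g e) = e" "g e \<in> F" using j by simp_all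
    qed
    have "inj_on g (set es)" using fg(1) by (rule inj_on_inverseI)
    then have "distinct (map g es)" using c by (simp add: is_cycle_def distinct_map)
    moreover have gF: "g ` set es \<subseteq> F" using fg(2) by blast
    moreover have "f (g (es ! i)) = es ! i" if "i < length es" for i using fg(1) that by simp
    ultimately have "is_cycle ?H vs (map g es)"
      using c F by (simp add: is_cycle_def reindex_edges_def)
    then show ?thesis using gF by (intro exI[of _ "map g es"]) simp
  qed
  have "(\<exists>vs es. is_cycle ?H vs es \<and> set es \<subseteq> F) \<longleftrightarrow> (\<exists>vs es. is_cycle H vs es \<and> set es \<subseteq> f ` F)"
  proof
    assume "\<exists>vs es. is_cycle ?H vs es \<and> set es \<subseteq> F"
    then obtain vs es where "is_cycle ?H vs es" "set es \<subseteq> F" by blast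
    then have "is_cycle H vs (map f es)" "set (map f es) \<subseteq> f ` F" using fwd by auto
    then show "\<exists>vs es. is_cycle H vs es \<and> set es \<subseteq> f ` F" by blast
  next
    assume "\<exists>vs es. is_cycle H vs es \<and> set es \<subseteq> f ` F"
    then show "\<exists>vs es. is_cycle ?H vs es \<and> set es \<subseteq> F" using bwd by blast
  qed
  moreover have "f ` F \<subseteq> edges H" "F \<subseteq> edges ?H" using F img by (auto simp: reindex_edges_def)
  ultimately show ?thesis by (simp add: is_forest_def)
qed

lemma forest_rank_reindex_edges:
  assumes f: "bij_betw f {..<m} (edges H)" and X: "X \<subseteq> {..<m}"
  shows "forest_rank (reindex_edges H f m) X = forest_rank H (f ` X)"
proof -
  let ?H = "reindex_edges H f m"
  have inj: "inj_on f X" using f X by (auto simp: bij_betw_def intro: inj_on_subset)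
  have "{F. F \<subseteq> f ` X \<and> is_forest H F} = (`) f ` {F. F \<subseteq> X \<and> is_forest ?H F}"
  proof (intro equalityI subsetI)
    fix F assume "F \<in> {F. F \<subseteq> f ` X \<and> is_forest H F}"
    then obtain F' where F': "F' \<subseteq> X" "F = f ` F'" "is_forest H F" by (auto simp: subset_image_iff)
    then have "is_forest ?H F'" using is_forest_reindex_edges[OF f, of F'] X by auto
    then show "F \<in> (`) f ` {F. F \<subseteq> X \<and> is_forest ?H F}" using F' by blast
  next
    fix F assume "F \<in> (`) f ` {F. F \<subseteq> X \<and> is_forest ?H F}"
    then obtain F' where F': "F' \<subseteq> X" "is_forest ?H F'" "F = f ` F'" by blast
    then have "is_forest H F" using is_forest_reindex_edges[OF f, of F'] X by auto
    then show "F \<in> {F. F \<subseteq> f ` X \<and> is_forest H F}" using F' by blast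
  qed
  then have "card ` {F. F \<subseteq> f ` X \<and> is_forest H F} = (\<lambda>F. card (f ` F)) ` {F. F \<subseteq> X \<and> is_forest ?H F}"
    by (simp add: image_image)
  also have "\<dots> = card ` {F. F \<subseteq> X \<and> is_forest ?H F}"
    using inj by (intro image_cong refl card_image) (auto intro: inj_on_subset)
  finally show ?thesis by (simp add: forest_rank_def)
qed

lemma row_rank_all:
  assumes A: "A \<in> carrier_mat m n"
  shows "row_rank A {..<m} = mat_rank (map_mat real_of_int A\<^sup>T)"
proof -
  have "submatrix (map_mat real_of_int A\<^sup>T) UNIV {..<m} = map_mat real_of_int A\<^sup>T"
  proof (rule eq_matI)
    have c: "submatrix (map_mat real_of_int A\<^sup>T) UNIV {..<m} \<in> carrier_mat n m"
      using submatrix_carrier[OF A, of "{..<m}"] by simp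
    have pick_m: "pick {..<m} j = j" if "j < m" for j
    proof -
      have "{a \<in> {..<m}. a < j} = {..<j}" using that by auto
      then show ?thesis using pick_card_in_set[of j "{..<m}"] that by simp
    qed
    show "submatrix (map_mat real_of_int A\<^sup>T) UNIV {..<m} $$ (k, j) = map_mat real_of_int A\<^sup>T $$ (k, j)"
      if "k < dim_row (map_mat real_of_int A\<^sup>T)" "j < dim_col (map_mat real_of_int A\<^sup>T)" for k j
      using submatrix_entry[OF A, of "{..<m}" k j] that A pick_m[of j] by simp
    show "dim_row (submatrix (map_mat real_of_int A\<^sup>T) UNIV {..<m}) = dim_row (map_mat real_of_int A\<^sup>T)"
      "dim_col (submatrix (map_mat real_of_int A\<^sup>T) UNIV {..<m}) = dim_col (map_mat real_of_int A\<^sup>T)"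
      using c A by simp_all
  qed
  then show ?thesis by (simp add: row_rank_def)
qed

lemma admits_bimodular_cographic:
  fixes H :: "('v, 'e) multigraph"
  assumes finH: "finite_multigraph H"
    and A: "A \<in> carrier_mat m n" and bim: "bimodular A\<^sup>T"
    and rank_n: "mat_rank (map_mat real_of_int A\<^sup>T) = n"
    and iso: "matroid_iso (column_matroid (map_mat real_of_int A\<^sup>T)) (cographic_matroid H)"
    and b: "b \<in> carrier_vec m" and span: "map_vec real_of_int b \<in> column_span (map_mat real_of_int A)"
  shows "\<exists>l\<le>size_bound n. admits_ext_formulation n (conv (constraint_polyhedron A b \<inter> integer_points n)) l"
proof -
  obtain f where f: "bij_betw f {..<m} (edges H)"
    and rk: "\<forall>X\<subseteq>{..<m}. rk (cographic_matroid H) (f ` X) = row_rank A X"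
    using iso A by (auto simp: matroid_iso_def column_matroid_def dual_matroid_def cycle_matroid_def row_rank_def)
  define H' where "H' = reindex_edges H f m"
  have inj: "inj_on f {..<m}" and img: "f ` {..<m} = edges H" using f by (simp_all add: bij_betw_def)
  have mat_rank_X: "row_rank A X = card X + forest_rank H' ({..<m} - X) - forest_rank H' {..<m}" if X: "X \<subseteq> {..<m}" for X
  proof -
    have "row_rank A X = card (f ` X) + forest_rank H (edges H - f ` X) - forest_rank H (edges H)"
      using rk X by (simp add: dual_matroid_def cycle_matroid_def forest_rank_def)
    moreover have "card (f ` X) = card X" using inj X by (intro card_image) (rule inj_on_subset)
    moreover have "edges H - f ` X = f ` ({..<m} - X)"
      unfolding img[symmetric] using inj X by (intro inj_on_image_set_diff[symmetric]) auto
    moreover have "forest_rank H (f ` ({..<m} - X)) = forest_rank H' ({..<m} - X)"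
      unfolding H'_def by (rule forest_rank_reindex_edges[OF f, symmetric]) blast
    moreover have "forest_rank H (edges H) = forest_rank H' {..<m}"
      unfolding H'_def img[symmetric] by (rule forest_rank_reindex_edges[OF f, symmetric]) blast
    ultimately show ?thesis by simp
  qed
  interpret cographic_matrix H' A m n
  proof
    show "A \<in> carrier_mat m n" by (rule A)
    have "ends H (f j) \<subseteq> verts H \<and> card (ends H (f j)) \<in> {1, 2}" if "j < m" for j
      using finH img that by (auto simp: finite_multigraph_def)
    then show "finite_multigraph H'"
      using finH by (simp add: finite_multigraph_def H'_def reindex_edges_def)
    show "edges H' = {..<m}" by (simp add: H'_def reindex_edges_def)
    show "row_rank A {..<m} = n" using row_rank_all[OF A] rank_n by simp
  qed (rule mat_rank_X)
  obtain t h :: "nat \<Rightarrow> 'v" and \<kappa> where "\<forall>j<m. 0 < \<kappa> j"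
      "\<forall>x. balanced {..<m} t h (\<lambda>j. \<kappa> j * real_row_val x j)"
      "\<forall>es. dicycle {..<m} t h es \<longrightarrow> is_cycle H' (map t es) es"
    using cographic_orientation by (elim exE conjE)
  then interpret oriented_cographic_matrix H' A m n t h \<kappa> by unfold_locales simp_all
  interpret W: vec_space "TYPE(real)" m .
  have cA: "map_mat real_of_int A \<in> carrier_mat m n" using A by simp
  have "map_vec real_of_int b \<in> W.col_space (map_mat real_of_int A)"
    using span A by (simp add: column_span_def)
  then obtain x where x: "x \<in> carrier_vec n" "map_mat real_of_int A *\<^sub>v x = map_vec real_of_int b"
    unfolding W.col_space_eq[OF cA] using cA by auto
  define x0 where "x0 k = x $ k" for k
  have val: "(map_mat real_of_int A *\<^sub>v y) $ j = real_row_val (\<lambda>k. y $ k) j" if "y \<in> carrier_vec n" "j < m" for y j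
    using that A by (simp add: scalar_prod_def real_row_val_def atLeast0LessThan)
  have bval: "real_of_int (b $ j) = real_row_val x0 j" if j: "j < m" for j
    using val[OF x(1) j] x(2) b j by (simp add: x0_def[abs_def])
  have le: "map_mat real_of_int A *\<^sub>v y \<le> map_vec real_of_int b \<longleftrightarrow>
      (\<forall>j<m. 0 \<le> real_row_val (\<lambda>k. x0 k - y $ k) j)" if y: "y \<in> carrier_vec n" for y
  proof -
    have "map_mat real_of_int A *\<^sub>v y \<le> map_vec real_of_int b \<longleftrightarrow>
        (\<forall>j<m. (map_mat real_of_int A *\<^sub>v y) $ j \<le> map_vec real_of_int b $ j)"
      using A b unfolding less_eq_vec_def by (simp del: index_mult_mat_vec)
    also have "\<dots> \<longleftrightarrow> (\<forall>j<m. real_row_val (\<lambda>k. y $ k) j \<le> real_row_val x0 j)"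
      using val[OF y] b bval by (simp del: index_mult_mat_vec)
    finally show ?thesis unfolding real_row_val_diff by simp
  qed
  have points: "constraint_polyhedron A b \<inter> integer_points n = shifted_points x0"
    using A le by (auto simp: constraint_polyhedron_def integer_points_def shifted_points_def
        simp del: index_mult_mat_vec)
  show ?thesis
  proof (cases "\<forall>k<n. x0 k \<in> \<int>")
    case True
    then show ?thesis unfolding points by (rule admits_integral)
  next
    case False
    interpret fractional_apex H' A m n t h \<kappa> x0
    proof
      show "\<bar>Determinant.det (submatrix A\<^sup>T {..<n} I)\<bar> \<le> 2" if "I \<subseteq> {..<m}" "card I = n" for I
        using bim[unfolded bimodular_def, rule_format, of "{..<n}" I] that A rank_n by simp
      show "real_row_val x0 j \<in> \<int>" if "j < m" for j unfolding bval[OF that, symmetric] by simp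
      show "\<not> (\<forall>k<n. x0 k \<in> \<int>)" by (rule False)
    qed
    show ?thesis unfolding points by (rule admits_fractional)
  qed
qed

lemma size_bound_bigo: "(\<lambda>n. real (size_bound n)) \<in> O(\<lambda>n. real n ^ 2)"
proof (rule bigoI[where c = 30], rule eventually_sequentiallyI)
  fix n :: nat assume n: "1 \<le> n"
  then have "n \<le> n\<^sup>2" "1 \<le> n\<^sup>2" by (simp_all add: power2_eq_square)
  then have "size_bound n \<le> 30 * n\<^sup>2" by (simp add: size_bound_def)
  then have "real (size_bound n) \<le> real (30 * n\<^sup>2)" by (rule of_nat_mono)
  then show "norm (real (size_bound n)) \<le> 30 * norm (real n ^ 2)" by simp
qed

theorem corollary2:
  shows "\<exists>s :: nat \<Rightarrow> nat. (\<lambda>n. real (s n)) \<in> O(\<lambda>n. real n ^ 2) \<and>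
    (\<forall>(H :: (nat, nat) multigraph) (m :: nat) (n :: nat) (A :: int mat) (b :: int vec).
       finite_multigraph H \<longrightarrow>
       \<not> projective_planar H \<longrightarrow>
       A \<in> carrier_mat m n \<longrightarrow>
       bimodular A\<^sup>T \<longrightarrow>
       mat_rank (map_mat real_of_int A\<^sup>T) = n \<longrightarrow>
       matroid_iso (column_matroid (map_mat real_of_int A\<^sup>T)) (cographic_matroid H) \<longrightarrow>
       b \<in> carrier_vec m \<longrightarrow>
       map_vec real_of_int b \<in> column_span (map_mat real_of_int A) \<longrightarrow>
       (\<exists>l \<le> s n. admits_ext_formulation n (conv (constraint_polyhedron A b \<inter> integer_points n)) l))"
  by (intro exI[of _ size_bound] conjI size_bound_bigo allI impI admits_bimodular_cographic)

end
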